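(* Let $p\in[1,\infty)$, let $(\mu_k)_{k\in\mathbb{Z}}$ be a bi-sequence in $M^1(\mathbb{R}^d)$ (the noise process) that has independent $\ell_p$-paths, and let $\phi$ be an invertible linear map on $\mathbb{R}^d$. Consider the equation $$\lambda_k=\mu_k*\phi(\lambda_{k-1}),\qquad k\in\mathbb{Z}.\tag{E}$$ The following are equivalent: (1) there exists $(x_k)_{k\in\mathbb{Z}}$ in $\ell_p$ such that each $\mu_k$ is supported on the coset $C(\phi)-x_k$, and the logarithmic moment condition $M_p<\infty$ is satisfied; (2) there is a (fundamental) solution $(\lambda_k)$ of (E) such that $(\lambda_k*\delta_{y_k})_{k\in\mathbb{Z}}$ has independent $\ell_p$-paths for some bi-sequence $(y_k)_{k\in\mathbb{Z}}$ in $\mathbb{R}^d$ such that $y_k=x_k+\phi(y_{k-1})$ for all $k\in\mathbb{Z}$, where $(x_k)$ is the bi-sequence of (1).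
   Context: $M^1(\mathbb{R}^d)$ is the space of Borel probability measures on $\mathbb{R}^d$; $*$ is convolution, $\delta_x$ is the Dirac measure at $x$, and $\phi(\nu)$ is the image (push-forward) of $\nu$ under $\phi$. $\ell_p=\{(x_k)\in(\mathbb{R}^d)^{\mathbb{Z}}:\sum_{k\in\mathbb{Z}}\|x_k\|^p<\infty\}$. A bi-sequence $(\rho_k)$ in $M^1(\mathbb{R}^d)$ has independent $\ell_p$-paths if there is a bi-sequence $(Y_k)_{k\in\mathbb{Z}}$ of independent $\mathbb{R}^d$-valued random variables, $Y_k$ having law $\rho_k$, such that $(Y_k(\omega))_{k\in\mathbb{Z}}\in\ell_p$ almost surely. $C(\phi)=\{v\in\mathbb{R}^d:\phi^n(v)\to0\text{ as }n\to\infty\}$ is the contraction subspace of $\phi$. The logarithmic moment is $$M_p=\lim_{n\to\infty}\int_{(\mathbb{R}^d)^{2n+1}}\log\Big(\big(\sum_{-n\le k\le n}\|v_k\|^p\big)^{1/p}+1\Big)\,d(\mu_{-n}\times\cdots\times\mu_n)(v_{-n},\dots,v_n).$$ A solution of (E) is a bi-sequence $(\lambda_k)_{k\in\mathbb{Z}}$ in $M^1(\mathbb{R}^d)$ satisfying (E) for all $k\in\mathbb{Z}$. A solution $(\lambda_k)$ is fundamental if for each solution $(\nu_k)$ of (E) there is $\nu\in M^1(\mathbb{R}^d)$ such that $\nu_k=\lambda_k*\phi^k(\nu)$ for all $k\in\mathbb{Z}$. The parenthesis in "(fundamental) solution" means that (2) may be read either with "solution" or with "fundamental solution". *)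

theory Defs
  imports "HOL-Probability.Probability"
begin

abbreviation borel_probs :: "(real ^ 'd) measure set"
  where "borel_probs \<equiv> space (prob_algebra borel)"

definition lp_seqs :: "real \<Rightarrow> (int \<Rightarrow> real ^ 'd) set"
  where "lp_seqs p = {x. (\<lambda>k. norm (x k) powr p) summable_on UNIV}"

(* HOL cannot quantify over the type of sample points, so the sample space is a set of
   bi-sequences.  This is no restriction: a process on any probability space can be replaced
   by the coordinate process under its joint law. *)
definition independent_lp_paths :: "real \<Rightarrow> (int \<Rightarrow> (real ^ 'd) measure) \<Rightarrow> bool"
  where "independent_lp_paths p \<rho> \<longleftrightarrow>
    (\<exists>(P :: (int \<Rightarrow> real ^ 'd) measure) (Y :: int \<Rightarrow> (int \<Rightarrow> real ^ 'd) \<Rightarrow> real ^ 'd).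
       prob_space P \<and>
       prob_space.indep_vars P (\<lambda>_. borel) Y UNIV \<and>
       (\<forall>k. distr P borel (Y k) = \<rho> k) \<and>
       (AE \<omega> in P. (\<lambda>k. Y k \<omega>) \<in> lp_seqs p))"

definition contraction_subspace :: "(real ^ 'd \<Rightarrow> real ^ 'd) \<Rightarrow> (real ^ 'd) set"
  where "contraction_subspace \<phi> = {v. (\<lambda>n. (\<phi> ^^ n) v) \<longlonglongrightarrow> 0}"

definition supported_on :: "(real ^ 'd) measure \<Rightarrow> (real ^ 'd) set \<Rightarrow> bool"
  where "supported_on \<nu> S \<longleftrightarrow> (AE v in \<nu>. v \<in> S)"

(* The integrands are nonnegative and the integrals increase with n, so the limit
   always exists in the extended nonnegative reals. *)
definition log_moment :: "real \<Rightarrow> (int \<Rightarrow> (real ^ 'd) measure) \<Rightarrow> ennreal"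
  where "log_moment p \<mu> =
    lim (\<lambda>n::nat. \<integral>\<^sup>+ v.
           ennreal (ln ((\<Sum>k\<in>{- int n..int n}. norm (v k) powr p) powr (1 / p) + 1))
         \<partial>(\<Pi>\<^sub>M k\<in>{- int n..int n}. \<mu> k))"

definition int_iterate :: "('a \<Rightarrow> 'a) \<Rightarrow> int \<Rightarrow> 'a \<Rightarrow> 'a"
  where "int_iterate \<phi> k = (if 0 \<le> k then \<phi> ^^ nat k else inv \<phi> ^^ nat (- k))"

definition solution ::
    "(int \<Rightarrow> (real ^ 'd) measure) \<Rightarrow> (real ^ 'd \<Rightarrow> real ^ 'd) \<Rightarrow> (int \<Rightarrow> (real ^ 'd) measure) \<Rightarrow> bool"
  where "solution \<mu> \<phi> l \<longleftrightarrow>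
    (\<forall>k. l k \<in> borel_probs) \<and> (\<forall>k. l k = (\<mu> k \<star> distr (l (k - 1)) borel \<phi>))"

definition fundamental_solution ::
    "(int \<Rightarrow> (real ^ 'd) measure) \<Rightarrow> (real ^ 'd \<Rightarrow> real ^ 'd) \<Rightarrow> (int \<Rightarrow> (real ^ 'd) measure) \<Rightarrow> bool"
  where "fundamental_solution \<mu> \<phi> l \<longleftrightarrow>
    solution \<mu> \<phi> l \<and>
    (\<forall>l'. solution \<mu> \<phi> l' \<longrightarrow>
       (\<exists>\<nu>\<in>borel_probs. \<forall>k. l' k = (l k \<star> distr \<nu> borel (int_iterate \<phi> k))))"

definition lp_paths_after_shift ::
    "real \<Rightarrow> (real ^ 'd \<Rightarrow> real ^ 'd) \<Rightarrow> (int \<Rightarrow> real ^ 'd) \<Rightarrow> (int \<Rightarrow> (real ^ 'd) measure) \<Rightarrow> bool"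
  where "lp_paths_after_shift p \<phi> x l \<longleftrightarrow>
    (\<exists>y :: int \<Rightarrow> real ^ 'd. (\<forall>k. y k = x k + \<phi> (y (k - 1))) \<and>
       independent_lp_paths p (\<lambda>k. l k \<star> return borel (y k)))"

definition supported_on_cosets ::
    "(int \<Rightarrow> (real ^ 'd) measure) \<Rightarrow> (real ^ 'd \<Rightarrow> real ^ 'd) \<Rightarrow> (int \<Rightarrow> real ^ 'd) \<Rightarrow> bool"
  where "supported_on_cosets \<mu> \<phi> x \<longleftrightarrow>
    (\<forall>k. supported_on (\<mu> k) ((\<lambda>c. c - x k) ` contraction_subspace \<phi>))"

end

theory Submission
  imports Defs
begin

text \<open>
  Shifting \<open>\<mu> k\<close> by \<open>x k\<close> and the solution by \<open>y k\<close> preserves the equation, so one may assume that the noise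
  lives on the contraction subspace, where \<open>\<parallel>\<phi>\<^sup>n v\<parallel> \<le> K a\<^sup>n \<parallel>v\<parallel>\<close> with \<open>a < 1\<close>.
  Then \<open>Z k = (\<Sum>n. \<phi>\<^sup>n (w (k - n)))\<close> converges for independent noise \<open>w\<close> and its laws solve the equation. The number
  of \<open>n\<close> for which \<open>\<phi>\<^sup>n v\<close> stays large is comparable to \<open>ln \<parallel>v\<parallel>\<close>, which turns the logarithmic moment of the
  noise into the summability of the paths of \<open>Z\<close>, and conversely.

  The solution is fundamental: for any other solution \<open>l\<close>, the measures \<open>\<phi>\<^sup>n (l (- n))\<close> are realized by
  Kolmogorov extension as one process whose increments \<open>\<phi>\<^sup>n (w (- n))\<close> are absolutely summable; the law of its limit
  is the required \<open>\<nu>\<close>.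

  Conversely, if \<open>l k\<close> concentrates near \<open>0\<close> as \<open>k \<rightarrow> \<infinity>\<close>, then \<open>\<phi>\<^sup>n (v - u) \<rightarrow> 0\<close> for typical points \<open>v\<close>, \<open>u\<close>
  of \<open>l k\<close>, so each \<open>l k\<close> is supported on a coset of the contraction subspace, and one sample path of the
  solution supplies representatives of the cosets in \<open>\<ell>\<^sub>p\<close>.
\<close>

section \<open>Elementary inequalities and orbits of linear maps\<close>

text \<open>Independence reduces statements about paths to the marginal laws: almost sure l_p-paths
  mean that \<open>trunc_cost\<close> is finite. The moment \<open>M_p\<close> integrates a
  logarithm of a sum; given finite truncated cost, it is finite exactly when the sum of logarithms
  \<open>log_cost\<close> is. The two costs meet because \<open>\<Sum>n. min 1 (r ^ n * t)\<close>
  is comparable to \<open>ln (1 + t)\<close>: a noise value acts on all later times with geometric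
  decay, and its truncated effects add up to its logarithm.

  Two obstacles shape the converse. A solution is only a family of laws, so it is coupled with the
  noise on finite windows, by an initial value drawn from the solution. And the effects of several
  large noise values may cancel, so they are examined on the disjoint events where a single value is
  large. Moreover, the \<open>x\<close> that comes with a solution need not describe the cosets of
  the noise; it has to be corrected by an l_p sequence.\<close>

lemma ln_increment_bounds:
  fixes r s :: real
  assumes r: "0 < r" "r < 1" and s: "0 \<le> s"
  shows "(1 - r) / 2 * min 1 s \<le> ln (1 + s) - ln (1 + r * s)"
    and "ln (1 + s) - ln (1 + r * s) \<le> 1 / r * min 1 s"
proof -
  have pos: "0 < 1 + s" "0 < 1 + r * s" using r s by (auto intro: add_pos_nonneg)
  have eq: "ln (1 + s) - ln (1 + r * s) = ln ((1 + s) / (1 + r * s))"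
    using pos by (simp add: ln_div)
  have "ln ((1 + r * s) / (1 + s)) \<le> (1 + r * s) / (1 + s) - 1"
    using pos by (intro ln_le_minus_one) simp
  then have "(1 - r) * (s / (1 + s)) \<le> ln ((1 + s) / (1 + r * s))"
    using pos by (simp add: ln_div field_simps)
  moreover have "min 1 s / 2 \<le> s / (1 + s)"
  proof (cases "s \<le> 1")
    case True
    then have "s * s \<le> s" using s by (simp add: mult_left_le)
    then show ?thesis using True s pos by (simp add: field_simps)
  qed (use pos in \<open>simp add: field_simps\<close>)
  then have "(1 - r) * (min 1 s / 2) \<le> (1 - r) * (s / (1 + s))"
    using r by (intro mult_left_mono) auto
  ultimately have "(1 - r) * (min 1 s / 2) \<le> ln ((1 + s) / (1 + r * s))"
    by (rule order_trans[rotated])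
  then show "(1 - r) / 2 * min 1 s \<le> ln (1 + s) - ln (1 + r * s)"
    unfolding eq by simp
  have "ln ((1 + s) / (1 + r * s)) \<le> (1 + s) / (1 + r * s) - 1"
    using pos by (intro ln_le_minus_one) simp
  also have "\<dots> \<le> 1 / r * min 1 s"
  proof -
    have "(1 - r) * s \<le> 1 / r * min 1 s * (1 + r * s)"
    proof (cases "s \<le> 1")
      case True
      have "1 - r \<le> 1" "1 \<le> 1 / r" using r by auto
      then have "(1 - r) * s \<le> 1 / r * s" using s by (intro mult_right_mono) linarith+
      also have "\<dots> \<le> 1 / r * s * (1 + r * s)" using r s by (simp add: field_simps)
      finally show ?thesis using True by simp
    next
      case False
      have "(1 - r) * s \<le> 1 * s" using r s by (intro mult_right_mono) auto
      also have "\<dots> \<le> 1 / r * (1 + r * s)" using r by (simp add: field_simps)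
      finally show ?thesis using False by simp
    qed
    then have "(1 - r) * s / (1 + r * s) \<le> 1 / r * min 1 s" using pos by (simp add: pos_divide_le_eq)
    moreover have "(1 + s) / (1 + r * s) - 1 = (1 - r) * s / (1 + r * s)" using pos by (simp add: field_simps)
    ultimately show ?thesis by simp
  qed
  finally show "ln (1 + s) - ln (1 + r * s) \<le> 1 / r * min 1 s" unfolding eq .
qed

lemma telescope_ln:
  fixes r t :: real
  shows "(\<Sum>n<N. ln (1 + r ^ n * t) - ln (1 + r * (r ^ n * t))) = ln (1 + t) - ln (1 + r ^ N * t)"
  by (induction N) (simp_all add: mult.assoc)

text \<open>Each term is at most a constant times an increment of \<open>ln (1 + r ^ n * t)\<close>,
  so the partial sums telescope. The factor \<open>C \<ge> 1\<close> can be taken out of the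
  minimum, and \<open>2 / (1 - r)\<close> is the reciprocal of the constant in the lower bound for
  the increments.\<close>

lemma sum_min_geometric_le_ln:
  fixes r t :: real
  assumes r: "0 < r" "r < 1" and t: "0 \<le> t" and C: "1 \<le> C"
  shows "(\<Sum>n. ennreal (min 1 (C * r ^ n * t))) \<le> ennreal (2 * C / (1 - r) * ln (1 + t))"
proof (rule suminf_le_const)
  fix N
  have "(\<Sum>n<N. min 1 (C * r ^ n * t)) \<le> (\<Sum>n<N. C * (2 / (1 - r)) * (ln (1 + r ^ n * t) - ln (1 + r * (r ^ n * t))))"
  proof (rule sum_mono)
    fix n
    have nn: "0 \<le> r ^ n * t" using r t by simp
    have "(1 - r) / 2 * min 1 (r ^ n * t) \<le> ln (1 + r ^ n * t) - ln (1 + r * (r ^ n * t))"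
      by (rule ln_increment_bounds[OF r nn])
    then have "min 1 (r ^ n * t) \<le> 2 / (1 - r) * (ln (1 + r ^ n * t) - ln (1 + r * (r ^ n * t)))"
      using r by (simp add: field_simps)
    then have "C * min 1 (r ^ n * t) \<le> C * (2 / (1 - r) * (ln (1 + r ^ n * t) - ln (1 + r * (r ^ n * t))))"
      using C by (intro mult_left_mono) auto
    moreover have "min 1 (C * r ^ n * t) \<le> C * min 1 (r ^ n * t)"
    proof (cases "r ^ n * t \<le> 1")
      case False
      then show ?thesis using C by simp
    qed (use C in \<open>simp add: mult.assoc\<close>)
    ultimately show "min 1 (C * r ^ n * t) \<le> C * (2 / (1 - r)) * (ln (1 + r ^ n * t) - ln (1 + r * (r ^ n * t)))"
      by (simp only: mult.assoc)
  qed
  also have "\<dots> = 2 * C / (1 - r) * (ln (1 + t) - ln (1 + r ^ N * t))"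
    unfolding sum_distrib_left[symmetric] telescope_ln by simp
  also have "\<dots> \<le> 2 * C / (1 - r) * ln (1 + t)"
    using r t C by (intro mult_left_mono) auto
  finally show "(\<Sum>n<N. ennreal (min 1 (C * r ^ n * t))) \<le> ennreal (2 * C / (1 - r) * ln (1 + t))"
    using r t C by (subst sum_ennreal) (auto intro!: ennreal_leI)
qed auto

text \<open>The same telescoping read in the other direction: the increments are at most
  \<open>1 / r\<close> times the truncated terms, and the remainder
  \<open>ln (1 + r ^ N * t)\<close> vanishes in the limit.\<close>

lemma ln_le_sum_min_geometric:
  fixes r t :: real
  assumes r: "0 < r" "r < 1" and t: "0 \<le> t"
  shows "ennreal (ln (1 + t)) \<le> ennreal (1 / r) * (\<Sum>n. ennreal (min 1 (r ^ n * t)))"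
proof (rule tendsto_upperbound[of _ _ sequentially])
  have "(\<lambda>N. r ^ N * t) \<longlonglongrightarrow> 0"
    using r by (intro tendsto_mult_left_zero LIMSEQ_power_zero) auto
  then have "(\<lambda>N. ln (1 + t) - ln (1 + r ^ N * t)) \<longlonglongrightarrow> ln (1 + t) - ln (1 + 0)"
    by (intro tendsto_intros) auto
  then show "(\<lambda>N. ennreal (ln (1 + t) - ln (1 + r ^ N * t))) \<longlonglongrightarrow> ennreal (ln (1 + t))"
    by (intro tendsto_ennrealI) simp
  show "\<forall>\<^sub>F N in sequentially. ennreal (ln (1 + t) - ln (1 + r ^ N * t)) \<le>
      ennreal (1 / r) * (\<Sum>n. ennreal (min 1 (r ^ n * t)))"
  proof (intro always_eventually allI)
    fix N
    have "ln (1 + t) - ln (1 + r ^ N * t) \<le> (\<Sum>n<N. 1 / r * min 1 (r ^ n * t))"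
      unfolding telescope_ln[symmetric] using r t
      by (intro sum_mono ln_increment_bounds) auto
    also have "\<dots> = 1 / r * (\<Sum>n<N. min 1 (r ^ n * t))" by (simp add: sum_distrib_left)
    finally have "ennreal (ln (1 + t) - ln (1 + r ^ N * t)) \<le> ennreal (1 / r) * (\<Sum>n<N. ennreal (min 1 (r ^ n * t)))"
      using r t by (subst sum_ennreal) (auto simp: ennreal_mult[symmetric] sum_nonneg intro!: ennreal_leI)
    also have "\<dots> \<le> ennreal (1 / r) * (\<Sum>n. ennreal (min 1 (r ^ n * t)))"
      by (intro mult_left_mono sum_le_suminf) auto
    finally show "ennreal (ln (1 + t) - ln (1 + r ^ N * t)) \<le> ennreal (1 / r) * (\<Sum>n. ennreal (min 1 (r ^ n * t)))" .
  qed
qed simp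

text \<open>A geometrically weighted series is dominated by one of its terms if a part of the decay
  is given up. This replaces Hoelder's inequality for the power of a sum, and it survives
  truncation: \<open>min 1\<close> of a single term is bounded by the sum of the truncated
  terms.\<close>

lemma weighted_sum_powr_le_term:
  fixes a K p :: real
  assumes a: "0 < a" "a < 1" and K: "0 < K" and p: "1 \<le> p"
  obtains C r where "1 \<le> C" "0 < r" "r < 1"
    "\<And>z u. 0 \<le> z \<Longrightarrow> (\<And>n. 0 \<le> u n) \<Longrightarrow> summable (\<lambda>n. a ^ n * u n) \<Longrightarrow>
      z \<le> K * (\<Sum>n. a ^ n * u n) \<Longrightarrow> \<exists>n. z powr p \<le> C * r ^ n * u n powr p"
proof
  \<comment> \<open>Since \<open>a = b * b\<close>, one factor \<open>b ^ n\<close> stays with the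
    dominant term and the other makes the series converge. The constant \<open>D\<close> below is
    chosen so that the absence of a dominant term would give \<open>z \<le> z / 2\<close>.\<close>
  define b where "b = sqrt a"
  have b: "0 < b" "b < 1" and bb: "a = b * b" using a by (auto simp: b_def)
  define D where "D = 2 * K / (1 - b)"
  have D: "0 < D" using K b by (simp add: D_def)
  show "1 \<le> max 1 (D powr p)" "0 < b powr p" "b powr p < 1"
    using b p powr_less_mono2[of p b 1] by auto
  fix z :: real and u :: "nat \<Rightarrow> real"
  assume z: "0 \<le> z" and u: "\<And>n. 0 \<le> u n" and sm: "summable (\<lambda>n. a ^ n * u n)"
    and le: "z \<le> K * (\<Sum>n. a ^ n * u n)"
  have "\<exists>n. z \<le> D * b ^ n * u n"
  proof (rule ccontr)
    assume "\<not> ?thesis"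
    then have *: "\<And>n. D * b ^ n * u n < z" by (simp add: not_le)
    have z0: "0 < z" using *[of 0] D u[of 0] by (smt (verit) mult_nonneg_nonneg power_0)
    have "a ^ n * u n \<le> b ^ n * (z / D)" for n
    proof -
      have "b ^ n * u n \<le> z / D" using *[of n] D by (simp add: field_simps)
      then have "b ^ n * (b ^ n * u n) \<le> b ^ n * (z / D)" using b by (intro mult_left_mono) auto
      then show ?thesis by (simp add: bb power_mult_distrib mult.assoc)
    qed
    then have "(\<Sum>n. a ^ n * u n) \<le> (\<Sum>n. b ^ n * (z / D))"
      using b by (intro suminf_le sm summable_mult2 summable_geometric) auto
    also have "\<dots> = (1 / (1 - b)) * (z / D)"
      using b by (subst suminf_mult2[symmetric]) (auto simp: suminf_geometric summable_geometric)
    finally have "z \<le> K * ((1 / (1 - b)) * (z / D))" using le K by (meson mult_left_mono less_imp_le order_trans)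
    also have "\<dots> = z / 2" using K b by (simp add: D_def)
    finally show False using z0 by simp
  qed
  then obtain n where "z \<le> D * b ^ n * u n" by blast
  then have "z powr p \<le> (D * b ^ n * u n) powr p" using z p by (intro powr_mono2) auto
  also have "\<dots> = D powr p * (b powr p) ^ n * u n powr p"
    using D b u[of n] by (simp add: powr_mult powr_power[symmetric] flip: powr_realpow) (simp add: powr_powr mult.commute)
  also have "\<dots> \<le> max 1 (D powr p) * (b powr p) ^ n * u n powr p"
    by (intro mult_right_mono) auto
  finally show "\<exists>n. z powr p \<le> max 1 (D powr p) * (b powr p) ^ n * u n powr p" by blast
qed

section \<open>Geometric bounds along the orbits of a linear map\<close>

lemma linear_funpow: "linear (f :: 'a::real_vector \<Rightarrow> 'a) \<Longrightarrow> linear (f ^^ n)"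
  by (induction n) (auto simp: linear_id[unfolded id_def] id_def intro: linear_compose)

text \<open>Pointwise convergence on the contraction subspace is uniform on its unit ball because an
  orthonormal basis is finite. Hence some iterate \<open>N\<close> halves all norms there, and the
  \<open>N\<close>-th root of \<open>1 / 2\<close> serves as the rate.\<close>

lemma contraction_bound:
  fixes f :: "'a::euclidean_space \<Rightarrow> 'a"
  assumes f: "linear f"
  obtains K a where "0 < a" "a < 1" "1 \<le> K"
    "\<And>v n. (\<lambda>n. (f ^^ n) v) \<longlonglongrightarrow> 0 \<Longrightarrow> norm ((f ^^ n) v) \<le> K * a ^ n * norm v"
proof -
  define V where "V = {v. (\<lambda>n. (f ^^ n) v) \<longlonglongrightarrow> 0}"
  have fn: "linear (f ^^ n)" for n by (rule linear_funpow[OF f])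
  have "subspace V"
    unfolding V_def by (auto intro!: subspaceI simp: linear_0[OF fn] linear_add[OF fn] linear_scale[OF fn]
        intro: tendsto_add_zero tendsto_scaleR[OF tendsto_const, of _ 0, simplified])
  then obtain B where B: "B \<subseteq> V" "pairwise orthogonal B" "\<And>x. x \<in> B \<Longrightarrow> norm x = 1"
     "independent B" "span B = V"
    using orthonormal_basis_subspace by metis
  have fin: "finite B" using B(4) by (rule independent_imp_finite)
  have bd: "norm ((f ^^ n) v) \<le> norm v * (\<Sum>b\<in>B. norm ((f ^^ n) b))" if "v \<in> V" for v n
  proof -
    have v: "v = (\<Sum>b\<in>B. (v \<bullet> b) *\<^sub>R b)"
      using orthonormal_basis_expand[of B v] B that fin by (auto simp: pairwise_def)
    have "(f ^^ n) v = (\<Sum>b\<in>B. (v \<bullet> b) *\<^sub>R (f ^^ n) b)"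
      by (subst v) (simp add: linear_sum[OF fn] linear_scale[OF fn])
    then have "norm ((f ^^ n) v) \<le> (\<Sum>b\<in>B. \<bar>v \<bullet> b\<bar> * norm ((f ^^ n) b))"
      using norm_sum[of "\<lambda>b. (v \<bullet> b) *\<^sub>R (f ^^ n) b" B] by simp
    also have "\<dots> \<le> (\<Sum>b\<in>B. norm v * norm ((f ^^ n) b))"
    proof (intro sum_mono mult_right_mono)
      fix b assume "b \<in> B"
      then show "\<bar>v \<bullet> b\<bar> \<le> norm v" using B(3) Cauchy_Schwarz_ineq2[of v b] by simp
    qed simp
    finally show ?thesis by (simp add: sum_distrib_left)
  qed
  have "(\<lambda>n. \<Sum>b\<in>B. norm ((f ^^ n) b)) \<longlonglongrightarrow> (\<Sum>b\<in>B. 0)"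
    using B(1) by (intro tendsto_sum tendsto_norm_zero) (auto simp: V_def)
  then have "\<forall>\<^sub>F n in sequentially. (\<Sum>b\<in>B. norm ((f ^^ n) b)) < 1 / 2"
    by (intro order_tendstoD) auto
  then obtain N0 where N0: "\<And>n. n \<ge> N0 \<Longrightarrow> (\<Sum>b\<in>B. norm ((f ^^ n) b)) < 1 / 2"
    unfolding eventually_sequentially by blast
  define N where "N = Suc N0"
  have N: "(\<Sum>b\<in>B. norm ((f ^^ N) b)) < 1 / 2" "0 < N" using N0[of N] by (simp_all only: N_def)
  have fV: "(f ^^ n) v \<in> V" if "v \<in> V" for v n
  proof -
    have "(\<lambda>m. (f ^^ (m + n)) v) \<longlonglongrightarrow> 0" using that unfolding V_def by (auto intro: LIMSEQ_ignore_initial_segment)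
    then show ?thesis by (simp add: V_def funpow_add)
  qed
  have half: "norm ((f ^^ (N * q)) v) \<le> (1 / 2) ^ q * norm v" if "v \<in> V" for v q
  proof (induction q)
    case (Suc q)
    have "norm ((f ^^ (N * Suc q)) v) = norm ((f ^^ N) ((f ^^ (N * q)) v))" by (simp add: funpow_add)
    also have "\<dots> \<le> norm ((f ^^ (N * q)) v) * (\<Sum>b\<in>B. norm ((f ^^ N) b))"
      by (rule bd[OF fV[OF that]])
    also have "\<dots> \<le> norm ((f ^^ (N * q)) v) * (1 / 2)" using N by (intro mult_left_mono) auto
    also have "\<dots> \<le> (1 / 2) ^ Suc q * norm v" using Suc by simp
    finally show ?case .
  qed simp
  define a where "a = root N (1 / 2)"
  have a: "0 < a" "a < 1" "a ^ N = 1 / 2" using N by (auto simp: a_def)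
  define D where "D = (\<Sum>r<N. \<Sum>b\<in>B. norm ((f ^^ r) b))"
  have D: "0 \<le> D" by (simp add: D_def sum_nonneg)
  \<comment> \<open>\<open>D\<close> bounds the steps within one block of length \<open>N\<close>,
    the factor 2 pays for the decay missing in an incomplete block, and the summand 1 ensures
    \<open>1 \<le> K\<close>.\<close>
  define K where "K = 1 + 2 * D"
  have "norm ((f ^^ n) v) \<le> K * a ^ n * norm v" if "v \<in> V" for v n
  proof -
    define q r where "q = n div N" and "r = n mod N"
    have n: "n = r + N * q" by (simp add: q_def r_def)
    have rN: "r < N" using N by (simp add: r_def)
    have "norm ((f ^^ n) v) = norm ((f ^^ r) ((f ^^ (N * q)) v))" by (simp add: n funpow_add)
    also have "\<dots> \<le> norm ((f ^^ (N * q)) v) * (\<Sum>b\<in>B. norm ((f ^^ r) b))" by (rule bd[OF fV[OF that]])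
    also have "\<dots> \<le> norm ((f ^^ (N * q)) v) * D"
      unfolding D_def using rN
      by (intro mult_left_mono member_le_sum[of r "{..<N}" "\<lambda>r. \<Sum>b\<in>B. norm ((f ^^ r) b)"]) (auto intro: sum_nonneg)
    also have "\<dots> \<le> (1 / 2) ^ q * norm v * D" using half[OF that] D by (intro mult_right_mono) auto
    also have "(1 / 2) ^ q = a ^ (N * q)" by (simp add: power_mult a)
    also have "a ^ (N * q) * norm v * D \<le> (2 * a ^ n) * norm v * D"
    proof (intro mult_right_mono)
      have "1 / 2 = a ^ N" using a by simp
      also have "\<dots> \<le> a ^ r" using a rN by (intro power_decreasing) auto
      finally have "1 * a ^ (N * q) \<le> (2 * a ^ r) * a ^ (N * q)" using a by (intro mult_right_mono) auto
      then show "a ^ (N * q) \<le> 2 * a ^ n" by (simp add: n power_add)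
    qed (use D in auto)
    also have "\<dots> = 2 * D * (a ^ n * norm v)" by simp
    also have "\<dots> \<le> K * (a ^ n * norm v)" using a by (intro mult_right_mono) (auto simp: K_def)
    finally show ?thesis by (simp add: mult.assoc)
  qed
  then show ?thesis using a D by (intro that[of a K]) (auto simp: K_def V_def)
qed

text \<open>The counterpart of the contraction bound for the converse direction: since orbits cannot
  shrink faster than geometrically, a large vector stays large for a number of steps at least of the
  order of its logarithm.\<close>

lemma injective_linear_funpow_lower_bound:
  fixes f :: "'a::euclidean_space \<Rightarrow> 'a"
  assumes "linear f" "inj f"
  obtains b where "0 < b" "b < 1" "\<And>v n. b ^ n * norm v \<le> norm ((f ^^ n) v)"
proof -
  obtain B where B: "B > 0" "\<And>x. B * norm x \<le> norm (f x)"
    using linear_inj_bounded_below_pos[OF assms] by blast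
  define b where "b = min B (1 / 2)"
  have b: "0 < b" "b < 1" "b \<le> B" using B by (auto simp: b_def)
  have "b ^ n * norm v \<le> norm ((f ^^ n) v)" for v n
  proof (induction n)
    case (Suc n)
    have "b ^ Suc n * norm v \<le> b * norm ((f ^^ n) v)" using Suc b by (simp add: mult.assoc)
    also have "\<dots> \<le> B * norm ((f ^^ n) v)" using b by (intro mult_right_mono) auto
    also have "\<dots> \<le> norm ((f ^^ Suc n) v)" using B(2) by simp
    finally show ?case .
  qed simp
  with b show ?thesis using that by blast
qed

section \<open>Convolutions and infinite products\<close>

lemma borel_probsD:
  assumes "\<rho> \<in> borel_probs"
  shows "prob_space \<rho>" "finite_measure \<rho>" "sets \<rho> = sets borel" "space \<rho> = UNIV"
proof -
  show "prob_space \<rho>" "sets \<rho> = sets borel" using assms by (auto simp: space_prob_algebra)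
  then show "finite_measure \<rho>" "space \<rho> = UNIV"
    by (auto simp: prob_space_def dest: sets_eq_imp_space_eq)
qed

lemma borel_probsI: "prob_space \<rho> \<Longrightarrow> sets \<rho> = sets borel \<Longrightarrow> \<rho> \<in> borel_probs"
  by (simp add: space_prob_algebra)

lemma distr_in_borel_probs:
  "prob_space M \<Longrightarrow> f \<in> borel_measurable M \<Longrightarrow> distr M borel f \<in> borel_probs"
  by (intro borel_probsI prob_space.prob_space_distr) auto

lemma return_in_borel_probs: "return borel x \<in> borel_probs"
  by (intro borel_probsI prob_space_return) auto

lemma convolution_in_borel_probs:
  fixes M N :: "(real ^ 'd) measure"
  assumes "M \<in> borel_probs" "N \<in> borel_probs"
  shows "(M \<star> N) \<in> borel_probs"
proof -
  note [measurable_cong] = borel_probsD(3)[OF assms(1)] borel_probsD(3)[OF assms(2)]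
  interpret M: prob_space M by (rule borel_probsD(1)[OF assms(1)])
  interpret N: prob_space N by (rule borel_probsD(1)[OF assms(2)])
  interpret pair_prob_space M N ..
  show ?thesis unfolding convolution_def by (rule distr_in_borel_probs) (unfold_locales, measurable)
qed

lemma borel_probs_eqI:
  fixes M N :: "(real ^ 'd) measure"
  assumes "M \<in> borel_probs" "N \<in> borel_probs"
    and "\<And>h :: real ^ 'd \<Rightarrow> ennreal. h \<in> borel_measurable borel \<Longrightarrow> (\<integral>\<^sup>+v. h v \<partial>M) = (\<integral>\<^sup>+v. h v \<partial>N)"
  shows "M = N"
proof (rule measure_eqI)
  show "sets M = sets N" using assms(1,2) by (simp add: borel_probsD(3))
  fix A assume A: "A \<in> sets M"
  then have [measurable]: "A \<in> sets borel" using assms(1) by (simp add: borel_probsD(3))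
  show "emeasure M A = emeasure N A"
    using assms(3)[of "indicator A"] assms(1,2) A by (simp add: borel_probsD(3))
qed

lemma measurable_linear:
  fixes f :: "real ^ 'd \<Rightarrow> real ^ 'd"
  assumes "linear f" shows "f \<in> borel_measurable borel"
  using linear_continuous_on[of f UNIV] assms
  by (auto intro: borel_measurable_continuous_onI simp: linear_conv_bounded_linear)

lemma distr_linear_in_borel_probs:
  fixes \<rho> :: "(real ^ 'd) measure" and f :: "real ^ 'd \<Rightarrow> real ^ 'd"
  assumes "\<rho> \<in> borel_probs" "linear f"
  shows "distr \<rho> borel f \<in> borel_probs"
  using borel_probsD[OF assms(1)] measurable_linear[OF assms(2)]
  by (intro distr_in_borel_probs) (auto simp: measurable_cong_sets[OF borel_probsD(3)[OF assms(1)] refl])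

lemma distr_convolution:
  fixes M N :: "(real ^ 'd) measure" and f :: "real ^ 'd \<Rightarrow> real ^ 'd"
  assumes M: "M \<in> borel_probs" and N: "N \<in> borel_probs" and f: "linear f"
  shows "distr (M \<star> N) borel f = (distr M borel f \<star> distr N borel f)"
proof (rule borel_probs_eqI)
  note [measurable_cong] = borel_probsD(3)[OF M] borel_probsD(3)[OF N]
  have [measurable]: "f \<in> borel_measurable borel" by (rule measurable_linear[OF f])
  note D = distr_linear_in_borel_probs[OF _ f]
  show "distr (M \<star> N) borel f \<in> borel_probs" "(distr M borel f \<star> distr N borel f) \<in> borel_probs"
    using M N by (auto intro: D convolution_in_borel_probs)
  fix h :: "real ^ 'd \<Rightarrow> ennreal" assume [measurable]: "h \<in> borel_measurable borel"
  have [measurable]: "(\<lambda>x. \<integral>\<^sup>+y. h (x + y) \<partial>distr N borel f) \<in> borel_measurable borel"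
    using borel_probsD[OF D[OF N]] by (intro sigma_finite_measure.borel_measurable_nn_integral)
      (auto intro: prob_space_imp_sigma_finite)
  have "(\<integral>\<^sup>+v. h v \<partial>distr (M \<star> N) borel f) = (\<integral>\<^sup>+v. h (f v) \<partial>(M \<star> N))"
    by (rule nn_integral_distr) simp_all
  also have "\<dots> = (\<integral>\<^sup>+x. \<integral>\<^sup>+y. h (f (x + y)) \<partial>N \<partial>M)"
    using borel_probsD[OF M] borel_probsD[OF N] by (intro nn_integral_convolution) auto
  also have "\<dots> = (\<integral>\<^sup>+x. \<integral>\<^sup>+y. h (f x + y) \<partial>distr N borel f \<partial>M)"
    by (simp add: nn_integral_distr linear_add[OF f])
  also have "\<dots> = (\<integral>\<^sup>+x. \<integral>\<^sup>+y. h (x + y) \<partial>distr N borel f \<partial>distr M borel f)"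
    by (rule nn_integral_distr[symmetric]) simp_all
  also have "\<dots> = (\<integral>\<^sup>+v. h v \<partial>(distr M borel f \<star> distr N borel f))"
    using borel_probsD[OF D[OF M]] borel_probsD[OF D[OF N]] by (intro nn_integral_convolution[symmetric]) auto
  finally show "(\<integral>\<^sup>+v. h v \<partial>distr (M \<star> N) borel f) = (\<integral>\<^sup>+v. h v \<partial>(distr M borel f \<star> distr N borel f))" .
qed

lemma return_0_convolution:
  fixes M :: "(real ^ 'd) measure"
  assumes M: "M \<in> borel_probs"
  shows "(return borel 0 \<star> M) = M"
proof (rule borel_probs_eqI)
  note [measurable_cong] = borel_probsD(3)[OF M]
  fix h :: "real ^ 'd \<Rightarrow> ennreal" assume [measurable]: "h \<in> borel_measurable borel"
  have [measurable]: "(\<lambda>x. \<integral>\<^sup>+y. h (x + y) \<partial>M) \<in> borel_measurable borel"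
    using borel_probsD[OF M] by (intro sigma_finite_measure.borel_measurable_nn_integral)
      (auto intro: prob_space_imp_sigma_finite)
  show "(\<integral>\<^sup>+v. h v \<partial>(return borel 0 \<star> M)) = (\<integral>\<^sup>+v. h v \<partial>M)"
    using borel_probsD[OF M] borel_probsD[OF return_in_borel_probs[of "0 :: real ^ 'd"]]
    by (simp add: nn_integral_convolution nn_integral_return)
qed (auto intro: M convolution_in_borel_probs return_in_borel_probs)

text \<open>The index \<open>k\<close> may already belong to \<open>I\<close>; its old value is then
  overwritten and integrated out. With \<open>I = UNIV\<close> this is the resampling of one
  coordinate, the form in which independence is used below.\<close>

lemma nn_integral_PiM_insert:
  fixes m :: "'i \<Rightarrow> 'a measure"
  assumes m: "\<And>i. prob_space (m i)" and [measurable]: "F \<in> borel_measurable (PiM (insert k I) m)"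
  shows "(\<integral>\<^sup>+w. F w \<partial>PiM (insert k I) m) = (\<integral>\<^sup>+x. \<integral>\<^sup>+w. F (w(k := x)) \<partial>PiM I m \<partial>m k)"
proof -
  interpret P: prob_space "PiM I m" by (intro prob_space_PiM m)
  have 1[measurable]: "(\<lambda>(x, w). w(k := x)) \<in> m k \<Otimes>\<^sub>M PiM I m \<rightarrow>\<^sub>M PiM (insert k I) m"
    unfolding case_prod_beta by (rule measurable_fun_upd[where J = I]) auto
  have "(\<integral>\<^sup>+w. F w \<partial>PiM (insert k I) m) =
      (\<integral>\<^sup>+w. F w \<partial>distr (m k \<Otimes>\<^sub>M PiM I m) (PiM (insert k I) m) (\<lambda>(x, w). w(k := x)))"
    using distr_pair_PiM_eq_PiM[of I m k] m by simp
  also have "\<dots> = (\<integral>\<^sup>+x. \<integral>\<^sup>+w. F (w(k := x)) \<partial>PiM I m \<partial>m k)"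
    by (subst nn_integral_distr) (auto simp: P.nn_integral_fst[symmetric])
  finally show ?thesis .
qed

lemma nn_integral_PiM_fun_upd:
  fixes m :: "'i \<Rightarrow> 'a measure"
  assumes "\<And>i. prob_space (m i)" "F \<in> borel_measurable (PiM UNIV m)"
  shows "(\<integral>\<^sup>+w. F w \<partial>PiM UNIV m) = (\<integral>\<^sup>+x. \<integral>\<^sup>+w. F (w(k := x)) \<partial>PiM UNIV m \<partial>m k)"
  using nn_integral_PiM_insert[of m F k UNIV] assms by simp

lemma nn_integral_PiM_component:
  fixes m :: "'i \<Rightarrow> 'a measure"
  assumes m: "\<And>i. prob_space (m i)" and [measurable]: "h \<in> borel_measurable (m k)"
  shows "(\<integral>\<^sup>+v. h v \<partial>m k) = (\<integral>\<^sup>+w. h (w k) \<partial>PiM UNIV m)"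
proof -
  have "(\<integral>\<^sup>+w. h (w k) \<partial>PiM UNIV m) = (\<integral>\<^sup>+v. h v \<partial>distr (PiM UNIV m) (m k) (\<lambda>w. w k))"
    by (subst nn_integral_distr) auto
  then show ?thesis using distr_PiM_component[of UNIV m k] m by simp
qed

lemma distr_PiM_coordinate:
  fixes m :: "'i \<Rightarrow> (real ^ 'd) measure"
  assumes m: "\<And>i. m i \<in> borel_probs"
  shows "distr (PiM UNIV m) borel (\<lambda>w. w k) = m k"
proof -
  have "distr (PiM UNIV m) borel (\<lambda>w. w k) = distr (PiM UNIV m) (m k) (\<lambda>w. w k)"
    using borel_probsD(3)[OF m] by (intro distr_cong) auto
  then show ?thesis using distr_PiM_component[of UNIV m k] borel_probsD(1)[OF m] by simp
qed

text \<open>Invariance of \<open>g\<close> under overwriting coordinate \<open>k\<close> expresses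
  that \<open>g\<close> is independent of it; resampling this coordinate then produces the
  convolution.\<close>

lemma distr_PiM_add_independent:
  fixes m :: "int \<Rightarrow> (real ^ 'd) measure"
  assumes m: "\<And>i. m i \<in> borel_probs" and g[measurable]: "g \<in> borel_measurable (PiM UNIV m)"
    and inv: "\<And>w x. g (w(k := x)) = g w"
  shows "distr (PiM UNIV m) borel (\<lambda>w. w k + g w) = (m k \<star> distr (PiM UNIV m) borel g)"
proof (rule borel_probs_eqI)
  note [measurable_cong] = borel_probsD(3)[OF m]
  interpret P: prob_space "PiM UNIV m" by (intro prob_space_PiM borel_probsD(1) m)
  have [measurable]: "(\<lambda>w. w k + g w) \<in> borel_measurable (PiM UNIV m)" by measurable
  have dg: "distr (PiM UNIV m) borel g \<in> borel_probs" by (intro distr_in_borel_probs) (auto intro: P.prob_space_axioms)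
  then show "(m k \<star> distr (PiM UNIV m) borel g) \<in> borel_probs" by (intro convolution_in_borel_probs m)
  show "distr (PiM UNIV m) borel (\<lambda>w. w k + g w) \<in> borel_probs"
    by (intro distr_in_borel_probs P.prob_space_axioms) measurable
  fix h :: "real ^ 'd \<Rightarrow> ennreal" assume [measurable]: "h \<in> borel_measurable borel"
  have "(\<integral>\<^sup>+v. h v \<partial>distr (PiM UNIV m) borel (\<lambda>w. w k + g w)) = (\<integral>\<^sup>+w. h (w k + g w) \<partial>PiM UNIV m)"
    by (simp add: nn_integral_distr)
  also have "\<dots> = (\<integral>\<^sup>+x. \<integral>\<^sup>+w. h (x + g w) \<partial>PiM UNIV m \<partial>m k)"
    by (subst nn_integral_PiM_fun_upd[where k = k]) (auto simp: inv borel_probsD(1)[OF m])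
  also have "\<dots> = (\<integral>\<^sup>+v. h v \<partial>(m k \<star> distr (PiM UNIV m) borel g))"
    using borel_probsD[OF m] borel_probsD[OF dg]
    by (simp add: nn_integral_convolution nn_integral_distr)
  finally show "(\<integral>\<^sup>+v. h v \<partial>distr (PiM UNIV m) borel (\<lambda>w. w k + g w)) = (\<integral>\<^sup>+v. h v \<partial>(m k \<star> distr (PiM UNIV m) borel g))" .
qed

text \<open>For linear \<open>f\<close>, the state at time \<open>k\<close> of the recursion driven
  by \<open>w\<close> and started with the value 0 at time \<open>k - n\<close>.\<close>

definition orbit_sum :: "('a \<Rightarrow> 'a) \<Rightarrow> (int \<Rightarrow> 'a) \<Rightarrow> int \<Rightarrow> nat \<Rightarrow> 'a::real_vector"
  where "orbit_sum f w k n = (\<Sum>i<n. (f ^^ i) (w (k - int i)))"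

lemma orbit_sum_0 [simp]: "orbit_sum f w k 0 = 0"
  by (simp add: orbit_sum_def)

lemma orbit_sum_Suc:
  assumes "linear f"
  shows "orbit_sum f w k (Suc n) = w k + f (orbit_sum f w (k - 1) n)"
  unfolding orbit_sum_def
  by (subst sum.lessThan_Suc_shift) (simp add: linear_sum[OF assms] algebra_simps)

lemma orbit_sum_fun_upd: "j < k \<Longrightarrow> orbit_sum f (w(k := x)) j n = orbit_sum f w j n"
  by (simp add: orbit_sum_def)

lemma measurable_orbit_sum:
  fixes m :: "int \<Rightarrow> (real ^ 'd) measure"
  assumes m: "\<And>i. m i \<in> borel_probs" and f: "linear f"
  shows "(\<lambda>w. orbit_sum f w k n) \<in> borel_measurable (PiM UNIV m)"
proof -
  note [measurable_cong] = borel_probsD(3)[OF m]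
  have [measurable]: "(f ^^ i) \<in> borel_measurable borel" for i by (intro measurable_linear linear_funpow f)
  show ?thesis unfolding orbit_sum_def by measurable
qed

lemma distr_orbit_sum_Suc:
  fixes m :: "int \<Rightarrow> (real ^ 'd) measure"
  assumes m: "\<And>i. m i \<in> borel_probs" and f: "linear f"
  shows "distr (PiM UNIV m) borel (\<lambda>w. orbit_sum f w k (Suc n)) =
    (m k \<star> distr (distr (PiM UNIV m) borel (\<lambda>w. orbit_sum f w (k - 1) n)) borel f)"
proof -
  note [measurable] = measurable_orbit_sum[OF m f] measurable_linear[OF f]
  have "distr (PiM UNIV m) borel (\<lambda>w. w k + f (orbit_sum f w (k - 1) n)) =
      (m k \<star> distr (PiM UNIV m) borel (\<lambda>w. f (orbit_sum f w (k - 1) n)))"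
    by (intro distr_PiM_add_independent m) (auto simp: orbit_sum_fun_upd)
  then show ?thesis by (simp add: orbit_sum_Suc[OF f] distr_distr o_def)
qed

text \<open>Separates the last \<open>n\<close> noise terms from the law at time
  \<open>k - n\<close> without any joint process. It lets one freeze the noise part when supports
  are studied, and let \<open>n\<close> grow when a solution is compared with the orbit
  limits.\<close>

lemma convolution_recursion_unroll:
  fixes m l :: "int \<Rightarrow> (real ^ 'd) measure"
  assumes m: "\<And>i. m i \<in> borel_probs" and f: "linear f" and l: "\<And>i. l i \<in> borel_probs"
    and rec: "\<And>k. l k = (m k \<star> distr (l (k - 1)) borel f)"
  shows "l k = (distr (PiM UNIV m) borel (\<lambda>w. orbit_sum f w k n) \<star> distr (l (k - int n)) borel (f ^^ n))"
proof (induction n arbitrary: k)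
  interpret P: prob_space "PiM UNIV m" by (intro prob_space_PiM borel_probsD(1) m)
  note D = distr_linear_in_borel_probs
  have O: "distr (PiM UNIV m) borel (\<lambda>w. orbit_sum f w k n) \<in> borel_probs" for k n
    by (intro distr_in_borel_probs P.prob_space_axioms measurable_orbit_sum m f)
  {
    case 0
    have "distr (PiM UNIV m) borel (\<lambda>w. 0 :: real ^ 'd) = return borel 0"
      by (rule P.distr_const) simp
    then show ?case using distr_id2[of borel "l k"] borel_probsD(3)[OF l]
      by (simp add: return_0_convolution[OF l] id_def)
  next
    case (Suc n)
    let ?O = "\<lambda>k n. distr (PiM UNIV m) borel (\<lambda>w. orbit_sum f w k n)"
    have [simp]: "k - 1 - int n = k - (1 + int n)" by simp
    have mf: "f \<in> borel_measurable borel" "f ^^ n \<in> borel_measurable borel"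
      by (auto intro: measurable_linear linear_funpow f)
    have "l k = (m k \<star> distr (?O (k - 1) n \<star> distr (l (k - 1 - int n)) borel (f ^^ n)) borel f)"
      by (subst rec) (subst Suc, rule refl)
    also have "\<dots> = (m k \<star> (distr (?O (k - 1) n) borel f \<star> distr (distr (l (k - 1 - int n)) borel (f ^^ n)) borel f))"
      by (subst distr_convolution) (auto intro: O D l f linear_funpow)
    also have "distr (distr (l (k - 1 - int n)) borel (f ^^ n)) borel f = distr (l (k - int (Suc n))) borel (f ^^ Suc n)"
      using mf by (simp add: distr_distr measurable_cong_sets[OF borel_probsD(3)[OF l] refl])
    also have "(m k \<star> (distr (?O (k - 1) n) borel f \<star> \<dots>)) = ((m k \<star> distr (?O (k - 1) n) borel f) \<star> \<dots>)"
      using borel_probsD[OF m] borel_probsD[OF D[OF O f]] borel_probsD[OF D[OF l linear_funpow[OF f]]]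
      by (intro convolution_associative) (auto simp del: funpow.simps)
    also have "(m k \<star> distr (?O (k - 1) n) borel f) = ?O k (Suc n)"
      by (rule distr_orbit_sum_Suc[OF m f, symmetric])
    finally show ?case .
  }
qed

text \<open>A single big jump: on the events ``only \<open>w k\<close> is bad'', which are disjoint for distinct \<open>k\<close>,
  the function \<open>F\<close> sees \<open>f k (w k)\<close>, and the other coordinates are good with probability at least \<open>1/2\<close>.\<close>

lemma isolate_bound:
  fixes m :: "'i \<Rightarrow> 'a measure" and f :: "'i \<Rightarrow> 'a \<Rightarrow> ennreal"
  assumes m: "\<And>i. prob_space (m i)" and J: "finite J"
    and f[measurable]: "\<And>j. f j \<in> borel_measurable (m j)" and B[measurable]: "\<And>j. B j \<in> sets (m j)"
    and F[measurable]: "F \<in> borel_measurable (PiM UNIV m)"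
    and zero: "\<And>j v. v \<notin> B j \<Longrightarrow> f j v = 0"
    and small: "(\<Sum>j\<in>J. emeasure (m j) (B j)) \<le> ennreal (1 / 2)"
    and dom: "\<And>w k. k \<in> J \<Longrightarrow> (\<And>j. j \<in> J \<Longrightarrow> j \<noteq> k \<Longrightarrow> w j \<notin> B j) \<Longrightarrow> f k (w k) \<le> F w"
  shows "(\<Sum>k\<in>J. \<integral>\<^sup>+v. f k v \<partial>m k) \<le> 2 * (\<integral>\<^sup>+w. F w \<partial>PiM UNIV m)"
proof -
  interpret P: prob_space "PiM UNIV m" by (intro prob_space_PiM m)
  define A where "A k = {w \<in> space (PiM UNIV m). \<forall>j\<in>J - {k}. w j \<notin> B j}" for k
  have A[measurable]: "A k \<in> sets (PiM UNIV m)" for k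
    unfolding A_def using J by (intro sets.sets_Collect_finite_All sets.sets_Collect_neg) auto
  \<comment> \<open>At most one summand is nonzero: if \<open>w k\<close> is bad, then
    \<open>w\<close> lies in no \<open>A j\<close> with \<open>j \<noteq> k\<close>, and good values
    contribute 0 by \<open>zero\<close>.\<close>
  have "(\<Sum>k\<in>J. f k (w k) * indicator (A k) w) \<le> F w" for w
  proof (cases "\<exists>k\<in>J. w k \<in> B k")
    case True
    then obtain k where k: "k \<in> J" "w k \<in> B k" by blast
    have "(\<Sum>k\<in>J. f k (w k) * indicator (A k) w) = f k (w k) * indicator (A k) w"
      using k J by (subst sum.remove[of _ k]) (auto intro!: sum.neutral simp: A_def split: split_indicator)
    also have "\<dots> \<le> F w" using k by (auto split: split_indicator simp: A_def intro!: dom)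
    finally show ?thesis .
  qed (simp add: zero)
  then have "(\<integral>\<^sup>+w. (\<Sum>k\<in>J. f k (w k) * indicator (A k) w) \<partial>PiM UNIV m) \<le> (\<integral>\<^sup>+w. F w \<partial>PiM UNIV m)"
    by (intro nn_integral_mono)
  also have "(\<integral>\<^sup>+w. (\<Sum>k\<in>J. f k (w k) * indicator (A k) w) \<partial>PiM UNIV m)
      = (\<Sum>k\<in>J. \<integral>\<^sup>+w. f k (w k) * indicator (A k) w \<partial>PiM UNIV m)"
    by (rule nn_integral_sum) measurable
  \<comment> \<open>The event \<open>A k\<close> puts no condition on coordinate \<open>k\<close>,
    so resampling that coordinate factorizes the integral.\<close>
  also have "\<dots> = (\<Sum>k\<in>J. (\<integral>\<^sup>+v. f k v \<partial>m k) * emeasure (PiM UNIV m) (A k))"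
  proof (rule sum.cong[OF refl])
    fix k
    have "(\<integral>\<^sup>+w. f k (w k) * indicator (A k) w \<partial>PiM UNIV m)
        = (\<integral>\<^sup>+x. \<integral>\<^sup>+w. f k ((w(k := x)) k) * indicator (A k) (w(k := x)) \<partial>PiM UNIV m \<partial>m k)"
      by (rule nn_integral_PiM_fun_upd[OF m]) measurable
    also have "\<dots> = (\<integral>\<^sup>+x. \<integral>\<^sup>+w. f k x * indicator (A k) w \<partial>PiM UNIV m \<partial>m k)"
      by (intro nn_integral_cong) (auto simp: A_def space_PiM PiE_iff split: split_indicator)
    also have "\<dots> = (\<integral>\<^sup>+v. f k v \<partial>m k) * emeasure (PiM UNIV m) (A k)"
      by (simp add: nn_integral_cmult nn_integral_multc)
    finally show "(\<integral>\<^sup>+w. f k (w k) * indicator (A k) w \<partial>PiM UNIV m) = (\<integral>\<^sup>+v. f k v \<partial>m k) * emeasure (PiM UNIV m) (A k)" .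
  qed
  finally have upper: "(\<Sum>k\<in>J. (\<integral>\<^sup>+v. f k v \<partial>m k) * emeasure (PiM UNIV m) (A k)) \<le> (\<integral>\<^sup>+w. F w \<partial>PiM UNIV m)" .
  have "(\<Sum>k\<in>J. (\<integral>\<^sup>+v. f k v \<partial>m k) * ennreal (1 / 2)) \<le>
      (\<Sum>k\<in>J. (\<integral>\<^sup>+v. f k v \<partial>m k) * emeasure (PiM UNIV m) (A k))"
  proof (intro sum_mono mult_left_mono)
    fix k
    define E where "E j = {w \<in> space (PiM UNIV m). w j \<in> B j}" for j
    have E: "E j \<in> sets (PiM UNIV m)" for j unfolding E_def by measurable
    have Ej: "emeasure (PiM UNIV m) (E j) = emeasure (m j) (B j)" for j
    proof -
      have "emeasure (PiM UNIV m) (E j) = emeasure (distr (PiM UNIV m) (m j) (\<lambda>w. w j)) (B j)"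
        by (subst emeasure_distr) (auto simp: E_def vimage_def Int_def conj_commute intro!: arg_cong[where f = "emeasure (PiM UNIV m)"])
      then show ?thesis using distr_PiM_component[of UNIV m j] m by simp
    qed
    have "1 = emeasure (PiM UNIV m) (space (PiM UNIV m))" by (simp add: P.emeasure_space_1)
    also have "\<dots> \<le> emeasure (PiM UNIV m) (A k \<union> (\<Union>j\<in>J. E j))"
    proof (rule emeasure_mono)
      show "space (PiM UNIV m) \<subseteq> A k \<union> (\<Union>j\<in>J. E j)" by (auto simp: A_def E_def)
    qed (intro sets.Un sets.finite_UN A E J)
    also have "\<dots> \<le> emeasure (PiM UNIV m) (A k) + emeasure (PiM UNIV m) (\<Union>j\<in>J. E j)"
      using A E J by (intro emeasure_subadditive) auto
    also have "emeasure (PiM UNIV m) (\<Union>j\<in>J. E j) \<le> (\<Sum>j\<in>J. emeasure (PiM UNIV m) (E j))"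
      using E J by (intro emeasure_subadditive_finite) auto
    also have "\<dots> \<le> ennreal (1 / 2)" using small by (simp add: Ej)
    finally have "1 \<le> emeasure (PiM UNIV m) (A k) + ennreal (1 / 2)" by (simp add: add_left_mono)
    then show "ennreal (1 / 2) \<le> emeasure (PiM UNIV m) (A k)"
      unfolding P.emeasure_eq_measure
      by (subst (asm) ennreal_plus[symmetric], simp, simp, subst (asm) ennreal_1[symmetric], subst (asm) ennreal_le_iff, simp, intro ennreal_leI, simp)
  qed simp
  also note upper
  finally have "ennreal (1 / 2) * (\<Sum>k\<in>J. \<integral>\<^sup>+v. f k v \<partial>m k) \<le> (\<integral>\<^sup>+w. F w \<partial>PiM UNIV m)"
    by (simp add: sum_distrib_left mult.commute)
  then have "2 * (ennreal (1 / 2) * (\<Sum>k\<in>J. \<integral>\<^sup>+v. f k v \<partial>m k)) \<le> 2 * (\<integral>\<^sup>+w. F w \<partial>PiM UNIV m)"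
    by (rule mult_left_mono) simp
  also have "2 * (ennreal (1 / 2) * (\<Sum>k\<in>J. \<integral>\<^sup>+v. f k v \<partial>m k)) = (\<Sum>k\<in>J. \<integral>\<^sup>+v. f k v \<partial>m k)"
  proof -
    have "(2 :: ennreal) * ennreal (1 / 2) = ennreal (2 * (1 / 2))" by (subst ennreal_mult) auto
    then show ?thesis by (simp add: mult.assoc[symmetric])
  qed
  finally show ?thesis .
qed

section \<open>Almost sure summability and shifts\<close>

lemma nn_integral_count_space_leI:
  fixes f :: "'k :: countable \<Rightarrow> ennreal"
  assumes "\<And>J. finite J \<Longrightarrow> sum f J \<le> C"
  shows "(\<integral>\<^sup>+k. f k \<partial>count_space UNIV) \<le> C"
proof -
  define A where "A n = {k :: 'k. to_nat k < n}" for n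
  have fin: "finite (A n)" for n
    unfolding A_def by (rule finite_imageD[of to_nat]) (auto intro: finite_subset[of _ "{..<n}"] inj_on_subset[OF inj_to_nat])
  have "(\<integral>\<^sup>+k. f k \<partial>count_space UNIV) = (\<integral>\<^sup>+k. (SUP n. f k * indicator (A n) k) \<partial>count_space UNIV)"
  proof (intro nn_integral_cong antisym)
    fix k
    have "f k * indicator (A (Suc (to_nat k))) k \<le> (SUP n. f k * indicator (A n) k)" by (rule SUP_upper) simp
    then show "f k \<le> (SUP n. f k * indicator (A n) k)" by (simp add: A_def)
    show "(SUP n. f k * indicator (A n) k) \<le> f k" by (rule SUP_least) (simp split: split_indicator)
  qed
  also have "\<dots> = (SUP n. \<integral>\<^sup>+k. f k * indicator (A n) k \<partial>count_space UNIV)"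
    by (rule nn_integral_monotone_convergence_SUP)
      (auto simp: incseq_def le_fun_def A_def split: split_indicator)
  also have "\<dots> \<le> C"
  proof (rule SUP_least)
    fix n
    have "(\<integral>\<^sup>+k. f k * indicator (A n) k \<partial>count_space UNIV) = sum f (A n)"
      using fin by (simp add: nn_integral_count_space_indicator[symmetric] nn_integral_count_space_finite)
    then show "(\<integral>\<^sup>+k. f k * indicator (A n) k \<partial>count_space UNIV) \<le> C" using assms fin by simp
  qed
  finally show ?thesis .
qed

lemma sum_le_nn_integral_count_space:
  fixes f :: "'k \<Rightarrow> ennreal"
  assumes "finite J"
  shows "sum f J \<le> (\<integral>\<^sup>+k. f k \<partial>count_space UNIV)"
proof -
  have "sum f J = (\<integral>\<^sup>+k. f k * indicator J k \<partial>count_space UNIV)"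
    using assms by (simp add: nn_integral_count_space_indicator[symmetric] nn_integral_count_space_finite)
  also have "\<dots> \<le> (\<integral>\<^sup>+k. f k \<partial>count_space UNIV)"
    by (intro nn_integral_mono) (simp split: split_indicator)
  finally show ?thesis .
qed

lemma lp_seqs_iff:
  fixes x :: "int \<Rightarrow> real ^ 'd"
  shows "x \<in> lp_seqs p \<longleftrightarrow> (\<integral>\<^sup>+k. ennreal (norm (x k) powr p) \<partial>count_space UNIV) < \<infinity>"
proof -
  have "x \<in> lp_seqs p \<longleftrightarrow> (\<lambda>k. norm (norm (x k) powr p)) summable_on UNIV"
    by (simp add: lp_seqs_def)
  also have "\<dots> \<longleftrightarrow> Infinite_Set_Sum.abs_summable_on (\<lambda>k. norm (x k) powr p) UNIV"
    by (rule abs_summable_equivalent)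
  also have "\<dots> \<longleftrightarrow> (\<integral>\<^sup>+k. ennreal (norm (x k) powr p) \<partial>count_space UNIV) < \<infinity>"
    by (simp add: abs_summable_on_def integrable_iff_bounded)
  finally show ?thesis .
qed

lemma lp_seqs_bounded:
  assumes "x \<in> lp_seqs p" "0 < p"
  obtains D where "0 \<le> D" "\<And>k. norm (x k) \<le> D"
proof -
  define S where "S = (\<integral>\<^sup>+k. ennreal (norm (x k) powr p) \<partial>count_space UNIV)"
  have S: "S < \<infinity>" using assms(1) by (simp add: lp_seqs_iff S_def)
  then obtain s where s: "S = ennreal s" "0 \<le> s" by (cases S) auto
  have "norm (x k) powr p \<le> s" for k
  proof -
    have "ennreal (norm (x k) powr p) \<le> S"
      unfolding S_def by (rule nn_integral_ge_point) simp
    then show ?thesis using s by simp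
  qed
  then have "norm (x k) \<le> s powr (1 / p)" for k
    using powr_mono2[of "1 / p" "norm (x k) powr p" s] assms(2) by (simp add: powr_powr)
  then show ?thesis by (intro that[of "s powr (1 / p)"]) auto
qed

text \<open>Independent variables with laws \<open>\<rho> k\<close> have almost surely \<open>p\<close>-summable paths iff the truncated
  cost is finite; the logarithmic cost is the additive counterpart of the logarithmic moment.\<close>

definition total_cost :: "(real \<Rightarrow> real) \<Rightarrow> real \<Rightarrow> (int \<Rightarrow> (real ^ 'd) measure) \<Rightarrow> ennreal"
  where "total_cost g p \<rho> = (\<integral>\<^sup>+k. \<integral>\<^sup>+v. ennreal (g (norm v powr p)) \<partial>\<rho> k \<partial>count_space UNIV)"

abbreviation trunc_moment :: "real \<Rightarrow> 'a::real_normed_vector measure \<Rightarrow> ennreal"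
  where "trunc_moment p \<rho> \<equiv> \<integral>\<^sup>+v. ennreal (min 1 (norm v powr p)) \<partial>\<rho>"

abbreviation "trunc_cost \<equiv> total_cost (min 1)"
abbreviation "log_cost \<equiv> total_cost (\<lambda>t. ln (1 + t))"

lemma exp_minus_le:
  fixes v :: real
  assumes "0 \<le> v" "v \<le> 1"
  shows "exp (- v) \<le> 1 - v / 2"
proof -
  have "1 + v \<le> exp v" by (rule exp_ge_add_one_self)
  then have "exp (- v) \<le> 1 / (1 + v)" using assms by (simp add: exp_minus field_simps)
  also have "\<dots> \<le> 1 - v / 2"
  proof -
    have "v * v \<le> v" using assms by (simp add: mult_left_le)
    then show ?thesis using assms by (simp add: field_simps)
  qed
  finally show ?thesis .
qed

text \<open>A Laplace transform argument. The truncated sum \<open>S\<close> is almost surely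
  finite, so \<open>exp (- S)\<close> has positive mean \<open>d\<close>. By independence
  \<open>d\<close> is at most a product of means, each bounded through \<open>exp_minus_le\<close>;
  taking logarithms bounds all finite sums of truncated moments by
  \<open>- 2 * ln d\<close>.\<close>

lemma trunc_cost_finite_if_independent_lp_paths:
  fixes \<rho> :: "int \<Rightarrow> (real ^ 'd) measure"
  assumes "independent_lp_paths p \<rho>"
  shows "trunc_cost p \<rho> < \<infinity>"
proof -
  obtain P and Y :: "int \<Rightarrow> (int \<Rightarrow> real ^ 'd) \<Rightarrow> real ^ 'd" where P: "prob_space P"
    and ind: "prob_space.indep_vars P (\<lambda>_. borel) Y UNIV"
    and law: "\<And>k. distr P borel (Y k) = \<rho> k" and AE: "AE \<omega> in P. (\<lambda>k. Y k \<omega>) \<in> lp_seqs p"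
    using assms unfolding independent_lp_paths_def by blast
  interpret P: prob_space P by fact
  have [measurable]: "Y k \<in> borel_measurable P" for k using ind unfolding P.indep_vars_def by auto
  define V where "V k \<omega> = min 1 (norm (Y k \<omega>) powr p)" for k \<omega>
  have V[measurable]: "V k \<in> borel_measurable P" for k unfolding V_def by measurable
  have V01: "0 \<le> V k \<omega>" "V k \<omega> \<le> 1" for k \<omega> by (auto simp: V_def)
  define S where "S \<omega> = (\<integral>\<^sup>+k. ennreal (V k \<omega>) \<partial>count_space UNIV)" for \<omega>
  have [measurable]: "S \<in> borel_measurable P"
    unfolding S_def by (intro sigma_finite_measure.borel_measurable_nn_integral sigma_finite_measure_count_space) measurable
  have fin: "AE \<omega> in P. S \<omega> < \<infinity>"
    using AE
  proof eventually_elim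
    case (elim \<omega>)
    have "S \<omega> \<le> (\<integral>\<^sup>+k. ennreal (norm (Y k \<omega>) powr p) \<partial>count_space UNIV)"
      unfolding S_def V_def by (intro nn_integral_mono ennreal_leI) auto
    also have "\<dots> < \<infinity>" using elim by (simp add: lp_seqs_iff)
    finally show ?case .
  qed
  \<comment> \<open>\<open>enn2real\<close> maps infinity to 0, so the case distinction is what
    gives \<open>exp (- S)\<close> its proper value 0 where \<open>S\<close> is infinite.\<close>
  define d where "d = (\<integral>\<omega>. (if S \<omega> = \<infinity> then 0 else exp (- enn2real (S \<omega>))) \<partial>P)"
  have int_d: "integrable P (\<lambda>\<omega>. if S \<omega> = \<infinity> then 0 else exp (- enn2real (S \<omega>)))"
    by (intro P.integrable_const_bound[of _ 1]) (auto simp: enn2real_nonneg)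
  have d: "0 < d"
  proof -
    have "0 \<le> d" unfolding d_def by (intro integral_nonneg_AE) auto
    moreover have "d \<noteq> 0"
    proof
      assume "d = 0"
      then have "AE \<omega> in P. (if S \<omega> = \<infinity> then 0 else exp (- enn2real (S \<omega>))) = 0"
        unfolding d_def using int_d by (subst (asm) integral_nonneg_eq_0_iff_AE) auto
      with fin have "AE \<omega> in P. False" by eventually_elim (auto split: if_splits)
      then show False using P.AE_False by simp
    qed
    ultimately show ?thesis by simp
  qed
  have key: "(\<Sum>k\<in>J. \<integral>\<omega>. V k \<omega> \<partial>P) \<le> - 2 * ln d" if J: "finite J" for J
  proof -
    have intV: "integrable P (V k)" for k
      using V01 by (intro P.integrable_const_bound[of _ 1]) auto
    have "d \<le> (\<integral>\<omega>. (\<Prod>k\<in>J. exp (- V k \<omega>)) \<partial>P)"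
      unfolding d_def
    proof (rule integral_mono[OF int_d])
      show "integrable P (\<lambda>\<omega>. \<Prod>k\<in>J. exp (- V k \<omega>))"
        using V01 J by (intro P.integrable_const_bound[of _ 1]) (auto simp: prod_nonneg intro!: prod_le_1)
      fix \<omega>
      show "(if S \<omega> = \<infinity> then 0 else exp (- enn2real (S \<omega>))) \<le> (\<Prod>k\<in>J. exp (- V k \<omega>))"
      proof (cases "S \<omega> = \<infinity>")
        case False
        have "ennreal (\<Sum>k\<in>J. V k \<omega>) \<le> S \<omega>"
          unfolding S_def sum_ennreal[OF V01(1), symmetric] by (rule sum_le_nn_integral_count_space[OF J])
        then have "(\<Sum>k\<in>J. V k \<omega>) \<le> enn2real (S \<omega>)" using False V01
          by (cases "S \<omega>") auto
        then show ?thesis using False J by (simp add: exp_sum[symmetric] sum_negf)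
      qed (simp add: prod_nonneg)
    qed
    also have "\<dots> = (\<Prod>k\<in>J. \<integral>\<omega>. exp (- V k \<omega>) \<partial>P)"
    proof (rule P.indep_vars_lebesgue_integral[OF J])
      have "P.indep_vars (\<lambda>_. borel) (\<lambda>k. (\<lambda>y. exp (- min 1 (norm y powr p))) \<circ> Y k) UNIV"
        by (rule P.indep_vars_compose[OF ind]) measurable
      then show "P.indep_vars (\<lambda>_. borel) (\<lambda>k \<omega>. exp (- V k \<omega>)) J"
        by (auto simp: o_def V_def intro: P.indep_vars_subset)
      show "integrable P (\<lambda>\<omega>. exp (- V i \<omega>))" for i
        using V01 by (intro P.integrable_const_bound[of _ 1]) auto
    qed
    also have "\<dots> \<le> (\<Prod>k\<in>J. exp (- (\<integral>\<omega>. V k \<omega> \<partial>P) / 2))"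
    proof (intro prod_mono conjI)
      fix k
      have "(\<integral>\<omega>. exp (- V k \<omega>) \<partial>P) \<le> (\<integral>\<omega>. 1 - V k \<omega> / 2 \<partial>P)"
        using V01 intV by (intro integral_mono exp_minus_le P.integrable_const_bound[of _ 1]
            Bochner_Integration.integrable_diff Bochner_Integration.integrable_divide_zero)
          (auto simp: P.integrable_const_bound)
      also have "\<dots> = 1 + (- (\<integral>\<omega>. V k \<omega> \<partial>P) / 2)"
        using intV by (simp add: P.prob_space)
      also have "\<dots> \<le> exp (- (\<integral>\<omega>. V k \<omega> \<partial>P) / 2)" by (rule exp_ge_add_one_self)
      finally show "(\<integral>\<omega>. exp (- V k \<omega>) \<partial>P) \<le> exp (- (\<integral>\<omega>. V k \<omega> \<partial>P) / 2)" .
    qed (auto intro!: integral_nonneg_AE)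
    also have "\<dots> = exp (- (\<Sum>k\<in>J. \<integral>\<omega>. V k \<omega> \<partial>P) / 2)"
      using J by (simp add: exp_sum[symmetric] sum_negf sum_divide_distrib)
    finally have "ln d \<le> - (\<Sum>k\<in>J. \<integral>\<omega>. V k \<omega> \<partial>P) / 2"
      using d ln_mono[of d "exp (- (\<Sum>k\<in>J. \<integral>\<omega>. V k \<omega> \<partial>P) / 2)"] by simp
    then show ?thesis by simp
  qed
  have "trunc_cost p \<rho> = (\<integral>\<^sup>+k. ennreal (\<integral>\<omega>. V k \<omega> \<partial>P) \<partial>count_space UNIV)"
    unfolding total_cost_def
  proof (intro nn_integral_cong)
    fix k
    have "trunc_moment p (\<rho> k) = (\<integral>\<^sup>+\<omega>. ennreal (V k \<omega>) \<partial>P)"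
      unfolding law[symmetric] V_def by (subst nn_integral_distr) auto
    also have "\<dots> = ennreal (\<integral>\<omega>. V k \<omega> \<partial>P)"
      using V01 by (intro nn_integral_eq_integral P.integrable_const_bound[of _ 1]) auto
    finally show "trunc_moment p (\<rho> k) = ennreal (\<integral>\<omega>. V k \<omega> \<partial>P)" .
  qed
  also have "\<dots> \<le> ennreal (- 2 * ln d)"
  proof (rule nn_integral_count_space_leI)
    fix J :: "int set" assume "finite J"
    then show "(\<Sum>k\<in>J. ennreal (\<integral>\<omega>. V k \<omega> \<partial>P)) \<le> ennreal (- 2 * ln d)"
      using key[of J] V01 by (subst sum_ennreal) (auto intro!: integral_nonneg_AE ennreal_leI)
  qed
  finally show ?thesis by (rule le_less_trans) simp
qed

text \<open>Every term that is at least 1 contributes 1 to the truncated sum, so there are only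
  finitely many of them, and finitely many real terms cannot spoil finiteness.\<close>

lemma nn_integral_finite_if_truncated_finite:
  fixes t :: "'k :: countable \<Rightarrow> real"
  assumes t: "\<And>k. 0 \<le> t k" and fin: "(\<integral>\<^sup>+k. ennreal (min 1 (t k)) \<partial>count_space UNIV) < \<infinity>"
  shows "(\<integral>\<^sup>+k. ennreal (t k) \<partial>count_space UNIV) < \<infinity>"
proof -
  define S where "S = (\<integral>\<^sup>+k. ennreal (min 1 (t k)) \<partial>count_space UNIV)"
  obtain s where s: "S = ennreal s" "0 \<le> s" using fin unfolding S_def by (cases S; simp add: S_def)
  define J where "J = {k. 1 \<le> t k}"
  have "finite J"
  proof (rule ccontr)
    assume "infinite J"
    then obtain I where I: "I \<subseteq> J" "finite I" "card I = nat \<lceil>s\<rceil> + 1"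
      using infinite_arbitrarily_large by blast
    have "ennreal (real (card I)) = (\<Sum>k\<in>I. ennreal (min 1 (t k)))"
      using I by (subst sum_ennreal) (auto simp: t J_def subset_eq min_def intro!: arg_cong[where f = ennreal])
    also have "\<dots> \<le> S" unfolding S_def by (rule sum_le_nn_integral_count_space[OF I(2)])
    finally have "real (card I) \<le> s" using s by simp
    then show False using I(3) s(2) by linarith
  qed
  have "(\<integral>\<^sup>+k. ennreal (t k) \<partial>count_space UNIV) \<le>
      (\<integral>\<^sup>+k. ennreal (min 1 (t k)) + ennreal (t k) * indicator J k \<partial>count_space UNIV)"
    by (intro nn_integral_mono) (auto simp: J_def min_def split: split_indicator)
  also have "\<dots> = S + (\<integral>\<^sup>+k. ennreal (t k) * indicator J k \<partial>count_space UNIV)"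
    unfolding S_def by (rule nn_integral_add) auto
  also have "(\<integral>\<^sup>+k. ennreal (t k) * indicator J k \<partial>count_space UNIV) = (\<Sum>k\<in>J. ennreal (t k))"
    using \<open>finite J\<close> by (simp add: nn_integral_count_space_indicator[symmetric] nn_integral_count_space_finite)
  also have "S + \<dots> < \<infinity>" using fin \<open>finite J\<close> t by (simp add: S_def sum_ennreal)
  finally show ?thesis .
qed

text \<open>Tonelli makes the truncated sum integrable, hence almost surely finite; removing the
  truncation is then a deterministic matter.\<close>

lemma AE_PiM_in_lp_seqs:
  fixes \<rho> :: "int \<Rightarrow> (real ^ 'd) measure"
  assumes \<rho>: "\<And>k. \<rho> k \<in> borel_probs" and fin: "trunc_cost p \<rho> < \<infinity>"
  shows "AE w in PiM UNIV \<rho>. w \<in> lp_seqs p"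
proof -
  note [measurable_cong] = borel_probsD(3)[OF \<rho>]
  have "(\<integral>\<^sup>+w. \<integral>\<^sup>+k. ennreal (min 1 (norm (w k) powr p)) \<partial>count_space UNIV \<partial>PiM UNIV \<rho>)
      = (\<integral>\<^sup>+k. \<integral>\<^sup>+w. ennreal (min 1 (norm (w k) powr p)) \<partial>PiM UNIV \<rho> \<partial>count_space UNIV)"
    by (rule nn_integral_count_space_nn_integral) auto
  also have "\<dots> = trunc_cost p \<rho>"
    unfolding total_cost_def
  proof (intro nn_integral_cong)
    fix k
    show "(\<integral>\<^sup>+w. ennreal (min 1 (norm (w k) powr p)) \<partial>PiM UNIV \<rho>) = trunc_moment p (\<rho> k)"
      by (rule nn_integral_PiM_component[symmetric, OF borel_probsD(1)[OF \<rho>]]) measurable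
  qed
  finally have "(\<integral>\<^sup>+w. \<integral>\<^sup>+k. ennreal (min 1 (norm (w k) powr p)) \<partial>count_space UNIV \<partial>PiM UNIV \<rho>) \<noteq> \<infinity>"
    using fin by simp
  moreover have "(\<lambda>w. \<integral>\<^sup>+k. ennreal (min 1 (norm (w k) powr p)) \<partial>count_space UNIV) \<in> borel_measurable (PiM UNIV \<rho>)"
    by (intro sigma_finite_measure.borel_measurable_nn_integral sigma_finite_measure_count_space) measurable
  ultimately have "AE w in PiM UNIV \<rho>. (\<integral>\<^sup>+k. ennreal (min 1 (norm (w k) powr p)) \<partial>count_space UNIV) \<noteq> \<infinity>"
    by (intro nn_integral_noteq_infinite)
  then show ?thesis
  proof eventually_elim
    case (elim w)
    then show ?case
      unfolding lp_seqs_iff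
      using nn_integral_finite_if_truncated_finite[of "\<lambda>k. norm (w k) powr p"] by (auto simp: top.not_eq_extremum)
  qed
qed

lemma independent_lp_paths_if_trunc_cost_finite:
  fixes \<rho> :: "int \<Rightarrow> (real ^ 'd) measure"
  assumes \<rho>: "\<And>k. \<rho> k \<in> borel_probs" and fin: "trunc_cost p \<rho> < \<infinity>"
  shows "independent_lp_paths p \<rho>"
  unfolding independent_lp_paths_def
proof (intro exI conjI allI)
  note [measurable_cong] = borel_probsD(3)[OF \<rho>]
  show P: "prob_space (PiM UNIV \<rho>)" by (intro prob_space_PiM borel_probsD(1) \<rho>)
  interpret P: prob_space "PiM UNIV \<rho>" by (rule P)
  show law: "distr (PiM UNIV \<rho>) borel (\<lambda>w. w k) = \<rho> k" for k
    by (rule distr_PiM_coordinate[where m = \<rho>, OF \<rho>])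
  show "P.indep_vars (\<lambda>_. borel) (\<lambda>k w. w k) UNIV"
  proof (subst P.indep_vars_iff_distr_eq_PiM)
    show "distr (PiM UNIV \<rho>) (\<Pi>\<^sub>M i\<in>UNIV. borel) (\<lambda>x. \<lambda>i\<in>UNIV. x i) = (\<Pi>\<^sub>M i\<in>UNIV. distr (PiM UNIV \<rho>) borel (\<lambda>w. w i))"
      unfolding law restrict_UNIV
      by (rule distr_id2) (intro sets_PiM_cong refl borel_probsD(3)[OF \<rho>, symmetric])
  qed auto
  show "AE w in PiM UNIV \<rho>. (\<lambda>k. w k) \<in> lp_seqs p"
    using AE_PiM_in_lp_seqs[OF assms] by simp
qed

section \<open>Translated laws and cost functions\<close>

lemma nn_integral_convolution_return:
  fixes M :: "(real ^ 'd) measure"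
  assumes M: "M \<in> borel_probs" and [measurable]: "h \<in> borel_measurable borel"
  shows "(\<integral>\<^sup>+v. h v \<partial>(M \<star> return borel x)) = (\<integral>\<^sup>+v. h (v + x) \<partial>M)"
  using borel_probsD[OF M] borel_probsD[OF return_in_borel_probs[of x]]
  by (subst nn_integral_convolution) (auto simp: nn_integral_return)

lemma powr_add_le:
  fixes a b p :: real
  assumes "0 \<le> a" "0 \<le> b" "0 \<le> p"
  shows "(a + b) powr p \<le> 2 powr p * (a powr p + b powr p)"
proof -
  have "(a + b) powr p \<le> (2 * max a b) powr p" using assms by (intro powr_mono2) auto
  also have "\<dots> = 2 powr p * max a b powr p" using assms by (simp add: powr_mult)
  also have "\<dots> \<le> 2 powr p * (a powr p + b powr p)" by (intro mult_left_mono) (auto simp: max_def)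
  finally show ?thesis .
qed

text \<open>Collects what truncation and \<open>ln (1 + t)\<close> have in common, so that
  translations are treated once for both costs. The scaling inequality absorbs the factor
  \<open>2 powr p\<close> of the triangle inequality for p-th powers.\<close>

definition cost_function :: "(real \<Rightarrow> real) \<Rightarrow> bool"
  where "cost_function g \<longleftrightarrow> g \<in> borel_measurable borel \<and>
    (\<forall>s\<ge>0. 0 \<le> g s \<and> g s \<le> s) \<and> (\<forall>s\<ge>0. \<forall>t\<ge>s. g s \<le> g t) \<and>
    (\<forall>s\<ge>0. \<forall>t\<ge>0. g (s + t) \<le> g s + g t) \<and> (\<forall>c\<ge>1. \<forall>s\<ge>0. g (c * s) \<le> c * g s)"

lemma cost_function_min: "cost_function (min 1)"
proof -
  have "min 1 (c * s) \<le> c * min 1 s" if "1 \<le> c" "0 \<le> s" for c s :: real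
    using that by (cases "s \<le> 1") auto
  then show ?thesis unfolding cost_function_def by auto
qed

lemma cost_function_ln: "cost_function (\<lambda>t. ln (1 + t))"
proof -
  have "ln (1 + (s + t)) \<le> ln (1 + s) + ln (1 + t)" if "0 \<le> s" "0 \<le> t" for s t :: real
  proof -
    have "ln (1 + (s + t)) \<le> ln ((1 + s) * (1 + t))"
      using that by (intro ln_mono) (auto simp: algebra_simps add_pos_nonneg)
    then show ?thesis using that by (simp add: ln_mult)
  qed
  moreover have "ln (1 + c * s) \<le> c * ln (1 + s)" if "1 \<le> c" "0 \<le> s" for c s :: real
  proof -
    \<comment> \<open>The point \<open>1 + s\<close> is the convex combination of \<open>1\<close>
      and \<open>1 + c * s\<close> with weight \<open>1 / c\<close> on the latter.\<close>
    have "(1 - 1 / c) * ln 1 + (1 / c) * ln (1 + c * s) \<le> ln ((1 - 1 / c) *\<^sub>R 1 + (1 / c) *\<^sub>R (1 + c * s))"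
      using that by (intro concave_onD[OF ln_concave]) (auto simp: add_pos_nonneg)
    also have "(1 - 1 / c) *\<^sub>R 1 + (1 / c) *\<^sub>R (1 + c * s) = 1 + s" using that by (simp add: field_simps)
    finally show ?thesis using that by (simp add: field_simps)
  qed
  ultimately show ?thesis
    unfolding cost_function_def by (auto intro: ln_add_one_self_le_self)
qed

lemma cost_functionD:
  assumes "cost_function g"
  shows "g \<in> borel_measurable borel" "\<And>s. 0 \<le> s \<Longrightarrow> 0 \<le> g s" "\<And>s. 0 \<le> s \<Longrightarrow> g s \<le> s"
    "\<And>s t. 0 \<le> s \<Longrightarrow> s \<le> t \<Longrightarrow> g s \<le> g t" "\<And>s t. 0 \<le> s \<Longrightarrow> 0 \<le> t \<Longrightarrow> g (s + t) \<le> g s + g t"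
    "\<And>c s. 1 \<le> c \<Longrightarrow> 0 \<le> s \<Longrightarrow> g (c * s) \<le> c * g s"
  using assms unfolding cost_function_def by auto

lemma cost_function_norm_add:
  fixes v x :: "'a :: real_normed_vector"
  assumes g: "cost_function g" and p: "0 \<le> p"
  shows "g (norm (v + x) powr p) \<le> 2 powr p * (g (norm v powr p) + g (norm x powr p))"
proof -
  have "g (norm (v + x) powr p) \<le> g ((norm v + norm x) powr p)"
    using p by (intro cost_functionD(4)[OF g] powr_mono2 norm_triangle_ineq) auto
  also have "\<dots> \<le> g (2 powr p * (norm v powr p + norm x powr p))"
    using p by (intro cost_functionD(4)[OF g] powr_add_le) auto
  also have "\<dots> \<le> 2 powr p * g (norm v powr p + norm x powr p)"
    using p by (intro cost_functionD(6)[OF g]) (auto intro: ge_one_powr_ge_zero)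
  also have "\<dots> \<le> 2 powr p * (g (norm v powr p) + g (norm x powr p))"
    by (intro mult_left_mono cost_functionD(5)[OF g]) auto
  finally show ?thesis .
qed

text \<open>Because \<open>g s \<le> s\<close>, a translation adds at most a multiple of the l_p sum
  of \<open>x\<close>. Translating by the negative sequence gives the way back.\<close>

lemma total_cost_shift_finite:
  fixes \<rho> :: "int \<Rightarrow> (real ^ 'd) measure"
  assumes g: "cost_function g" and p: "0 \<le> p" and \<rho>: "\<And>k. \<rho> k \<in> borel_probs"
    and x: "x \<in> lp_seqs p" and fin: "total_cost g p \<rho> < \<infinity>"
  shows "total_cost g p (\<lambda>k. \<rho> k \<star> return borel (x k)) < \<infinity>"
proof -
  note [measurable_cong] = borel_probsD(3)[OF \<rho>]
  note [measurable] = cost_functionD(1)[OF g]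
  have "total_cost g p (\<lambda>k. \<rho> k \<star> return borel (x k)) =
      (\<integral>\<^sup>+k. \<integral>\<^sup>+v. ennreal (g (norm (v + x k) powr p)) \<partial>\<rho> k \<partial>count_space UNIV)"
    unfolding total_cost_def by (intro nn_integral_cong nn_integral_convolution_return \<rho>) measurable
  also have "\<dots> \<le> (\<integral>\<^sup>+k. \<integral>\<^sup>+v. ennreal (2 powr p) * (ennreal (g (norm v powr p)) + ennreal (norm (x k) powr p)) \<partial>\<rho> k \<partial>count_space UNIV)"
  proof (intro nn_integral_mono)
    fix k v
    have "g (norm (v + x k) powr p) \<le> 2 powr p * (g (norm v powr p) + g (norm (x k) powr p))"
      by (rule cost_function_norm_add[OF g p])
    also have "\<dots> \<le> 2 powr p * (g (norm v powr p) + norm (x k) powr p)"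
      by (intro mult_left_mono add_left_mono cost_functionD(3)[OF g]) auto
    finally show "ennreal (g (norm (v + x k) powr p)) \<le> ennreal (2 powr p) * (ennreal (g (norm v powr p)) + ennreal (norm (x k) powr p))"
      using cost_functionD(2)[OF g, of "norm v powr p"] by (simp add: ennreal_mult[symmetric] ennreal_plus[symmetric] ennreal_leI del: ennreal_plus)
  qed
  also have "\<dots> = (\<integral>\<^sup>+k. ennreal (2 powr p) * ((\<integral>\<^sup>+v. ennreal (g (norm v powr p)) \<partial>\<rho> k) + ennreal (norm (x k) powr p)) \<partial>count_space UNIV)"
    using prob_space.emeasure_space_1[OF borel_probsD(1)[OF \<rho>]]
    by (intro nn_integral_cong) (simp add: nn_integral_cmult nn_integral_add)
  also have "\<dots> = ennreal (2 powr p) * (total_cost g p \<rho> + (\<integral>\<^sup>+k. ennreal (norm (x k) powr p) \<partial>count_space UNIV))"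
    by (simp add: nn_integral_cmult nn_integral_add total_cost_def)
  also have "\<dots> < \<infinity>" using fin x by (simp add: lp_seqs_iff ennreal_mult_less_top)
  finally show ?thesis .
qed

text \<open>Dominated convergence over all times at once, with the truncated moments as majorant. It
  yields one truncation level for the whole bi-sequence, beyond which values are rare enough for
  \<open>isolate_bound\<close>.\<close>

lemma eventually_tail_mass_le:
  fixes \<rho> :: "int \<Rightarrow> (real ^ 'd) measure"
  assumes \<rho>: "\<And>k. \<rho> k \<in> borel_probs" and fin: "trunc_cost p \<rho> < \<infinity>" and p: "0 \<le> p" and e: "0 < e"
  shows "\<forall>\<^sub>F n in sequentially. (\<integral>\<^sup>+k. emeasure (\<rho> k) {v. real n < norm v} \<partial>count_space UNIV) < ennreal e"
proof -
  note [measurable_cong] = borel_probsD(3)[OF \<rho>]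
  have sets[measurable]: "{v. real n < norm v} \<in> sets (\<rho> k)" for n k
    by (simp add: borel_probsD(3)[OF \<rho>])
  have le: "emeasure (\<rho> k) {v. real n < norm v} \<le> trunc_moment p (\<rho> k)" if "1 \<le> n" for n k
  proof -
    have "emeasure (\<rho> k) {v. real n < norm v} = (\<integral>\<^sup>+v. indicator {v. real n < norm v} v \<partial>\<rho> k)" by simp
    also have "\<dots> \<le> trunc_moment p (\<rho> k)"
      using that p by (intro nn_integral_mono) (auto simp: min_def ge_one_powr_ge_zero split: split_indicator)
    finally show ?thesis .
  qed
  \<comment> \<open>The index is \<open>Suc n\<close> because the majorant dominates only for
    thresholds of at least 1.\<close>
  have "(\<lambda>n. \<integral>\<^sup>+k. emeasure (\<rho> k) {v. real (Suc n) < norm v} \<partial>count_space UNIV) \<longlonglongrightarrow> (\<integral>\<^sup>+k. 0 \<partial>(count_space UNIV :: int measure))"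
  proof (rule nn_integral_dominated_convergence[where w = "\<lambda>k. trunc_moment p (\<rho> k)"])
    show "AE k in count_space UNIV. (\<lambda>n. emeasure (\<rho> k) {v. real (Suc n) < norm v}) \<longlonglongrightarrow> 0"
    proof (intro AE_I2)
      fix k
      interpret prob_space "\<rho> k" by (rule borel_probsD(1)[OF \<rho>])
      have "(\<lambda>n. emeasure (\<rho> k) {v. real (Suc n) < norm v}) \<longlonglongrightarrow> emeasure (\<rho> k) (\<Inter>n. {v. real (Suc n) < norm v})"
        using sets[of "Suc _" k] by (intro Lim_emeasure_decseq) (auto simp: decseq_def)
      also have "(\<Inter>n. {v. real (Suc n) < norm v}) = ({} :: (real ^ 'd) set)"
      proof -
        have "\<exists>n. \<not> real (Suc n) < norm v" for v :: "real ^ 'd"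
        proof -
          obtain n where "norm v \<le> real n" using real_arch_simple by blast
          then show ?thesis by (intro exI[of _ n]) simp
        qed
        then show ?thesis by auto
      qed
      finally show "(\<lambda>n. emeasure (\<rho> k) {v. real (Suc n) < norm v}) \<longlonglongrightarrow> 0" by simp
    qed
    show "AE k in count_space UNIV. emeasure (\<rho> k) {v. real (Suc n) < norm v} \<le> trunc_moment p (\<rho> k)" for n
      by (intro AE_I2 le) simp
    show "(\<integral>\<^sup>+k. trunc_moment p (\<rho> k) \<partial>count_space UNIV) < \<infinity>"
      using fin by (simp add: total_cost_def)
  qed auto
  then have "\<forall>\<^sub>F n in sequentially. (\<integral>\<^sup>+k. emeasure (\<rho> k) {v. real (Suc n) < norm v} \<partial>count_space UNIV) < ennreal e"
    using e by (intro order_tendstoD(2)[of _ 0]) auto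
  then show ?thesis
    by (subst (asm) eventually_sequentially_Suc[of "\<lambda>n. (\<integral>\<^sup>+k. emeasure (\<rho> k) {v. real n < norm v} \<partial>count_space UNIV) < ennreal e"])
qed

section \<open>The logarithmic moment\<close>

text \<open>Placing all windows on one infinite product makes the integrands comparable pointwise,
  so their integrals increase and the limit becomes a supremum.\<close>

lemma log_moment_eq_SUP:
  fixes \<rho> :: "int \<Rightarrow> (real ^ 'd) measure"
  assumes \<rho>: "\<And>k. \<rho> k \<in> borel_probs" and p: "1 \<le> p"
  shows "log_moment p \<rho> = (SUP n. \<integral>\<^sup>+w. ennreal (ln ((\<Sum>k\<in>{- int n..int n}. norm (w k) powr p) powr (1 / p) + 1)) \<partial>PiM UNIV \<rho>)"
proof -
  note [measurable_cong] = borel_probsD(3)[OF \<rho>]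
  interpret product_prob_space \<rho> UNIV
    using borel_probsD(1)[OF \<rho>]
    by (auto simp: product_prob_space_def product_prob_space_axioms_def product_sigma_finite_def prob_space_imp_sigma_finite)
  let ?F = "\<lambda>n w. ennreal (ln ((\<Sum>k\<in>{- int n..int n}. norm (w k) powr p) powr (1 / p) + 1))"
  have "(\<integral>\<^sup>+w. ?F n w \<partial>PiM {- int n..int n} \<rho>) = (\<integral>\<^sup>+w. ?F n w \<partial>PiM UNIV \<rho>)" for n
  proof -
    have "(\<integral>\<^sup>+w. ?F n w \<partial>PiM {- int n..int n} \<rho>) =
      (\<integral>\<^sup>+w. ?F n w \<partial>distr (PiM UNIV \<rho>) (PiM {- int n..int n} \<rho>) (\<lambda>w. restrict w {- int n..int n}))"
      by (simp add: distr_PiM_restrict_finite)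
    also have "\<dots> = (\<integral>\<^sup>+w. ?F n (restrict w {- int n..int n}) \<partial>PiM UNIV \<rho>)"
      by (intro nn_integral_distr) measurable
    also have "\<dots> = (\<integral>\<^sup>+w. ?F n w \<partial>PiM UNIV \<rho>)"
      by (intro nn_integral_cong arg_cong[where f = ennreal] arg_cong[where f = ln] arg_cong2[where f = "(+)"]
          arg_cong2[where f = "(powr)"] sum.cong) auto
    finally show ?thesis .
  qed
  moreover have "incseq (\<lambda>n. \<integral>\<^sup>+w. ?F n w \<partial>PiM UNIV \<rho>)"
    using p by (intro monoI nn_integral_mono ennreal_leI ln_mono add_right_mono powr_mono2 sum_mono2) (auto simp: add_nonneg_pos sum_nonneg)
  ultimately show ?thesis
    unfolding log_moment_def using LIMSEQ_SUP[THEN limI] by simp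
qed

text \<open>The root is discarded because \<open>1 / p \<le> 1\<close>; the bound
  \<open>s powr (1 / p) + 1 \<le> 2 * (1 + s)\<close> produces the \<open>ln 2\<close>, and
  subadditivity of \<open>ln (1 + t)\<close> does the rest.\<close>

lemma log_moment_finite_if_log_cost_finite:
  fixes \<rho> :: "int \<Rightarrow> (real ^ 'd) measure"
  assumes \<rho>: "\<And>k. \<rho> k \<in> borel_probs" and p: "1 \<le> p" and fin: "log_cost p \<rho> < \<infinity>"
  shows "log_moment p \<rho> < \<infinity>"
proof -
  note [measurable_cong] = borel_probsD(3)[OF \<rho>]
  interpret P: prob_space "PiM UNIV \<rho>" by (intro prob_space_PiM borel_probsD(1) \<rho>)
  have "log_moment p \<rho> \<le> ennreal (ln 2) + log_cost p \<rho>"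
    unfolding log_moment_eq_SUP[OF \<rho> p]
  proof (rule SUP_least)
    fix n
    let ?J = "{- int n..int n}"
    have ptw: "ln ((\<Sum>k\<in>J. t k) powr (1 / p) + 1) \<le> ln 2 + (\<Sum>k\<in>J. ln (1 + t k))"
      if J: "finite J" and t: "\<And>k. 0 \<le> t k" for J and t :: "int \<Rightarrow> real"
    proof -
      have s0: "0 \<le> (\<Sum>k\<in>J. t k)" using t by (simp add: sum_nonneg)
      have "(\<Sum>k\<in>J. t k) powr (1 / p) \<le> (1 + (\<Sum>k\<in>J. t k)) powr (1 / p)"
        using s0 p by (intro powr_mono2) auto
      also have "\<dots> \<le> (1 + (\<Sum>k\<in>J. t k)) powr 1" using s0 p by (intro powr_mono) auto
      finally have "(\<Sum>k\<in>J. t k) powr (1 / p) + 1 \<le> 2 * (1 + (\<Sum>k\<in>J. t k))" using s0 by simp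
      then have "ln ((\<Sum>k\<in>J. t k) powr (1 / p) + 1) \<le> ln (2 * (1 + (\<Sum>k\<in>J. t k)))"
        by (intro ln_mono) (auto simp: add_nonneg_pos)
      also have "\<dots> = ln 2 + ln (1 + (\<Sum>k\<in>J. t k))" using s0 by (simp add: ln_mult del: distrib_left_numeral)
      also have "ln (1 + (\<Sum>k\<in>J. t k)) \<le> (\<Sum>k\<in>J. ln (1 + t k))"
        using J
      proof (induction J)
        case (insert x J)
        then have "ln (1 + (t x + sum t J)) \<le> ln (1 + t x) + ln (1 + sum t J)"
          using cost_functionD(5)[OF cost_function_ln, of "t x" "sum t J"] t by (simp add: sum_nonneg)
        then show ?case using insert by simp
      qed simp
      finally show ?thesis by simp
    qed
    have "(\<integral>\<^sup>+w. ennreal (ln ((\<Sum>k\<in>?J. norm (w k) powr p) powr (1 / p) + 1)) \<partial>PiM UNIV \<rho>)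
        \<le> (\<integral>\<^sup>+w. ennreal (ln 2) + (\<Sum>k\<in>?J. ennreal (ln (1 + norm (w k) powr p))) \<partial>PiM UNIV \<rho>)"
      using ptw[of ?J] by (intro nn_integral_mono) (simp add: sum_ennreal sum_nonneg ennreal_plus[symmetric] ennreal_leI del: ennreal_plus)
    also have "\<dots> = ennreal (ln 2) + (\<Sum>k\<in>?J. \<integral>\<^sup>+w. ennreal (ln (1 + norm (w k) powr p)) \<partial>PiM UNIV \<rho>)"
      by (simp add: nn_integral_add nn_integral_sum P.emeasure_space_1 del: sum_ennreal)
    also have "(\<Sum>k\<in>?J. \<integral>\<^sup>+w. ennreal (ln (1 + norm (w k) powr p)) \<partial>PiM UNIV \<rho>) =
        (\<Sum>k\<in>?J. \<integral>\<^sup>+v. ennreal (ln (1 + norm v powr p)) \<partial>\<rho> k)"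
    proof (rule sum.cong[OF refl])
      fix k
      show "(\<integral>\<^sup>+w. ennreal (ln (1 + norm (w k) powr p)) \<partial>PiM UNIV \<rho>) = (\<integral>\<^sup>+v. ennreal (ln (1 + norm v powr p)) \<partial>\<rho> k)"
        by (rule nn_integral_PiM_component[symmetric, OF borel_probsD(1)[OF \<rho>]]) measurable
    qed
    also have "\<dots> \<le> log_cost p \<rho>"
      unfolding total_cost_def by (rule sum_le_nn_integral_count_space) simp
    finally show "(\<integral>\<^sup>+w. ennreal (ln ((\<Sum>k\<in>?J. norm (w k) powr p) powr (1 / p) + 1)) \<partial>PiM UNIV \<rho>)
        \<le> ennreal (ln 2) + log_cost p \<rho>" by (simp add: add_left_mono)
  qed
  also have "\<dots> < \<infinity>" using fin by simp
  finally show ?thesis .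
qed

lemma powr_le_truncated:
  fixes t p R :: real
  assumes "0 \<le> t" "t \<le> R" "1 \<le> R" "0 \<le> p"
  shows "t powr p \<le> R powr p * min 1 (t powr p)"
proof -
  have "t powr p \<le> R powr p" "1 \<le> R powr p" using assms by (auto intro: powr_mono2 ge_one_powr_ge_zero)
  then show ?thesis by (cases "t powr p \<le> 1") (auto simp: mult_le_cancel_right1 intro: order_trans)
qed

text \<open>Reduces the logarithmic cost to large values: up to norm \<open>R\<close> the logarithm
  is at most the p-th power, which is at most \<open>R powr p\<close> times its truncation.\<close>

lemma log_cost_le:
  fixes \<rho> :: "int \<Rightarrow> (real ^ 'd) measure" and h :: "real ^ 'd \<Rightarrow> ennreal"
  assumes \<rho>: "\<And>k. \<rho> k \<in> borel_probs" and p: "0 \<le> p" and R: "1 \<le> R"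
    and h[measurable]: "h \<in> borel_measurable borel"
    and le: "\<And>v. R < norm v \<Longrightarrow> ennreal (ln (1 + norm v powr p)) \<le> ennreal c * h v"
    and hI: "(\<integral>\<^sup>+k. \<integral>\<^sup>+v. h v \<partial>\<rho> k \<partial>count_space UNIV) < \<infinity>" and fin: "trunc_cost p \<rho> < \<infinity>"
  shows "log_cost p \<rho> < \<infinity>"
proof -
  note [measurable_cong] = borel_probsD(3)[OF \<rho>]
  have "log_cost p \<rho> \<le> (\<integral>\<^sup>+k. \<integral>\<^sup>+v. ennreal c * h v + ennreal (R powr p) * ennreal (min 1 (norm v powr p)) \<partial>\<rho> k \<partial>count_space UNIV)"
    unfolding total_cost_def
  proof (intro nn_integral_mono)
    fix k v
    show "ennreal (ln (1 + norm v powr p)) \<le> ennreal c * h v + ennreal (R powr p) * ennreal (min 1 (norm v powr p))"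
    proof (cases "R < norm v")
      case False
      have "ln (1 + norm v powr p) \<le> norm v powr p" by (intro ln_add_one_self_le_self) simp
      also have "\<dots> \<le> R powr p * min 1 (norm v powr p)" using False R p by (intro powr_le_truncated) auto
      finally show ?thesis
        by (simp add: ennreal_mult[symmetric] ennreal_leI add_increasing)
    qed (use le[of v] in \<open>auto intro: order_trans\<close>)
  qed
  also have "\<dots> = ennreal c * (\<integral>\<^sup>+k. \<integral>\<^sup>+v. h v \<partial>\<rho> k \<partial>count_space UNIV) + ennreal (R powr p) * trunc_cost p \<rho>"
    by (simp add: total_cost_def nn_integral_add nn_integral_cmult)
  also have "\<dots> < \<infinity>" using hI fin by (simp add: ennreal_mult_less_top)
  finally show ?thesis .
qed

text \<open>The logarithm of a sum essentially sees the largest term only, so several large terms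
  could hide one another. Beyond a level that is exceeded at any time with total probability below
  \<open>1 / 2\<close>, \<open>isolate_bound\<close> separates their contributions.\<close>

lemma log_cost_finite_if_log_moment_finite:
  fixes \<rho> :: "int \<Rightarrow> (real ^ 'd) measure"
  assumes \<rho>: "\<And>k. \<rho> k \<in> borel_probs" and p: "1 \<le> p"
    and trunc: "trunc_cost p \<rho> < \<infinity>" and fin: "log_moment p \<rho> < \<infinity>"
  shows "log_cost p \<rho> < \<infinity>"
proof -
  note [measurable_cong] = borel_probsD(3)[OF \<rho>]
  have "\<forall>\<^sub>F n in sequentially. (\<integral>\<^sup>+k. emeasure (\<rho> k) {v. real n < norm v} \<partial>count_space UNIV) < ennreal (1 / 2)"
    using p by (intro eventually_tail_mass_le[OF \<rho> trunc]) auto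
  then obtain n where n: "1 \<le> n" "(\<integral>\<^sup>+k. emeasure (\<rho> k) {v. real n < norm v} \<partial>count_space UNIV) < ennreal (1 / 2)"
    unfolding eventually_sequentially by (meson nat_le_linear order_refl)
  define B where "B = {v :: real ^ 'd. real n < norm v}"
  define h where "h v = ennreal (ln (norm v + 1)) * indicator B v" for v :: "real ^ 'd"
  have [measurable]: "B \<in> sets borel" unfolding B_def by measurable
  have [measurable]: "h \<in> borel_measurable borel" unfolding h_def by measurable
  have "(\<integral>\<^sup>+k. \<integral>\<^sup>+v. h v \<partial>\<rho> k \<partial>count_space UNIV) \<le> 2 * log_moment p \<rho>"
  proof (rule nn_integral_count_space_leI)
    fix J :: "int set" assume J: "finite J"
    obtain N :: nat where N: "\<And>j. j \<in> J \<Longrightarrow> \<bar>j\<bar> \<le> int N"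
    proof -
      obtain N where "\<And>j. j \<in> J \<Longrightarrow> nat \<bar>j\<bar> \<le> N"
        using J finite_nat_set_iff_bounded_le[of "(\<lambda>j. nat \<bar>j\<bar>) ` J"] by auto
      then show ?thesis by (intro that[of N]) (simp add: nat_le_iff)
    qed
    let ?F = "\<lambda>w. ennreal (ln ((\<Sum>k\<in>{- int N..int N}. norm (w k) powr p) powr (1 / p) + 1))"
    have "(\<Sum>k\<in>J. \<integral>\<^sup>+v. h v \<partial>\<rho> k) \<le> 2 * (\<integral>\<^sup>+w. ?F w \<partial>PiM UNIV \<rho>)"
    proof (rule isolate_bound[where B = "\<lambda>_. B"])
      show "(\<Sum>j\<in>J. emeasure (\<rho> j) B) \<le> ennreal (1 / 2)"
        using n(2) sum_le_nn_integral_count_space[OF J, of "\<lambda>k. emeasure (\<rho> k) B"] by (simp add: B_def)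
      fix w :: "int \<Rightarrow> real ^ 'd" and k assume k: "k \<in> J"
      have "norm (w k) = (norm (w k) powr p) powr (1 / p)" using p by (simp add: powr_powr)
      also have "\<dots> \<le> (\<Sum>k\<in>{- int N..int N}. norm (w k) powr p) powr (1 / p)"
        using p N[OF k] by (intro powr_mono2 member_le_sum) auto
      finally have "ln (norm (w k) + 1) \<le> ln ((\<Sum>k\<in>{- int N..int N}. norm (w k) powr p) powr (1 / p) + 1)"
        by (intro ln_mono) (auto simp: add_nonneg_pos)
      then show "h (w k) \<le> ?F w" by (auto simp: h_def ennreal_leI split: split_indicator)
    qed (use J borel_probsD[OF \<rho>] in \<open>auto simp: h_def\<close>)
    also have "(\<integral>\<^sup>+w. ?F w \<partial>PiM UNIV \<rho>) \<le> log_moment p \<rho>"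
      unfolding log_moment_eq_SUP[OF \<rho> p] by (rule SUP_upper) simp
    finally show "(\<Sum>k\<in>J. \<integral>\<^sup>+v. h v \<partial>\<rho> k) \<le> 2 * log_moment p \<rho>" by (simp add: mult_left_mono)
  qed
  also have "\<dots> < \<infinity>" using fin by (simp add: ennreal_mult_less_top)
  finally have hI: "(\<integral>\<^sup>+k. \<integral>\<^sup>+v. h v \<partial>\<rho> k \<partial>count_space UNIV) < \<infinity>" .
  show ?thesis
  proof (rule log_cost_le[OF \<rho> _ _ _ _ hI trunc, where R = "real n" and c = p])
    fix v :: "real ^ 'd" assume v: "real n < norm v"
    have "1 \<le> norm v" using v n by linarith
    \<comment> \<open>Superadditivity of p-th powers for \<open>p \<ge> 1\<close>; taking logarithms
      explains the constant \<open>c = p\<close>.\<close>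
    then have "1 + norm v powr p \<le> (norm v + 1) powr p"
    proof -
      have "1 + norm v powr p \<le> (norm v + 1) powr (p - 1) + norm v * (norm v + 1) powr (p - 1)"
      proof (rule add_mono)
        show "1 \<le> (norm v + 1) powr (p - 1)" using p by (intro ge_one_powr_ge_zero) auto
        have "norm v powr p = norm v * norm v powr (p - 1)"
          using \<open>1 \<le> norm v\<close> by (simp add: powr_diff)
        also have "\<dots> \<le> norm v * (norm v + 1) powr (p - 1)" using p by (intro mult_left_mono powr_mono2) auto
        finally show "norm v powr p \<le> norm v * (norm v + 1) powr (p - 1)" .
      qed
      also have "\<dots> = (norm v + 1) * (norm v + 1) powr (p - 1)" by (simp add: algebra_simps)
      also have "\<dots> = (norm v + 1) powr p" using \<open>1 \<le> norm v\<close> by (simp add: powr_diff)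
      finally show ?thesis .
    qed
    then have "ln (1 + norm v powr p) \<le> ln ((norm v + 1) powr p)"
      by (intro ln_mono) (auto simp: add_pos_nonneg)
    also have "\<dots> = p * ln (norm v + 1)" using \<open>1 \<le> norm v\<close> by (simp add: ln_powr)
    finally show "ennreal (ln (1 + norm v powr p)) \<le> ennreal p * h v"
      using v p by (simp add: h_def B_def ennreal_mult[symmetric] ennreal_leI)
  qed (use n p in auto)
qed

section \<open>Supports of solutions\<close>

lemma subspace_contraction_subspace:
  assumes f: "linear f"
  shows "subspace (contraction_subspace f)"
proof -
  have fn: "linear (f ^^ n)" for n by (rule linear_funpow[OF f])
  show ?thesis
    unfolding contraction_subspace_def
    by (auto intro!: subspaceI simp: linear_0[OF fn] linear_add[OF fn] linear_scale[OF fn]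
        intro: tendsto_add_zero tendsto_scaleR[OF tendsto_const, of _ 0, simplified])
qed

lemma sets_contraction_subspace: "linear f \<Longrightarrow> contraction_subspace f \<in> sets borel"
  by (intro borel_closed closed_subspace subspace_contraction_subspace)

lemma contraction_subspace_image: "v \<in> contraction_subspace f \<Longrightarrow> f v \<in> contraction_subspace f"
  unfolding contraction_subspace_def using LIMSEQ_Suc[of "\<lambda>n. (f ^^ n) v" 0] by (simp add: funpow_swap1)

lemma AE_convolutionD:
  fixes M N :: "(real ^ 'd) measure"
  assumes M: "M \<in> borel_probs" and N: "N \<in> borel_probs" and AE: "AE v in (M \<star> N). v \<in> A" and A: "A \<in> sets borel"
  shows "AE v in M. AE u in N. v + u \<in> A"
proof -
  note [measurable_cong] = borel_probsD(3)[OF M] borel_probsD(3)[OF N]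
  interpret M: prob_space M by (rule borel_probsD(1)[OF M])
  interpret N: prob_space N by (rule borel_probsD(1)[OF N])
  interpret pair_prob_space M N ..
  have "AE x in M \<Otimes>\<^sub>M N. (\<lambda>(v, u). v + u \<in> A) x"
    using AE A unfolding convolution_def by (subst (asm) AE_distr_iff) (auto simp: case_prod_beta)
  then show ?thesis using AE_pair by fastforce
qed

lemma nn_integral_prob_exists_le:
  assumes "prob_space M" "g \<in> borel_measurable M" "(\<integral>\<^sup>+x. g x \<partial>M) < c"
  shows "\<exists>x\<in>space M. g x \<le> c"
proof (rule ccontr)
  interpret prob_space M by fact
  assume "\<not> ?thesis"
  then have "(\<integral>\<^sup>+x. c \<partial>M) \<le> (\<integral>\<^sup>+x. g x \<partial>M)" by (intro nn_integral_mono) (auto simp: not_le less_imp_le)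
  then show False using assms(3) by (simp add: emeasure_space_1)
qed

text \<open>After unrolling, \<open>l (k + int n)\<close> is the law of an independent sum of noise
  and \<open>(f ^^ n) v\<close> with \<open>v\<close> of law \<open>l k\<close>. The noise part is
  frozen at a value \<open>x n\<close> that is hardly worse than average. The probability that the
  shifted orbit is large is then at most \<open>bad (k + int n)\<close> plus a geometric term, and
  Borel-Cantelli applies.\<close>

lemma AE_eventually_shifted_orbit_small:
  fixes m l :: "int \<Rightarrow> (real ^ 'd) measure"
  assumes m: "\<And>i. m i \<in> borel_probs" and f: "linear f" and l: "\<And>i. l i \<in> borel_probs"
    and rec: "\<And>k. l k = (m k \<star> distr (l (k - 1)) borel f)"
    and fin: "trunc_cost p l < \<infinity>" and p: "0 < p" and e: "0 < e"
  shows "\<exists>x. AE v in l k. \<forall>\<^sub>F n in sequentially. norm (x n + (f ^^ n) v) < e"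
proof -
  note [measurable_cong] = borel_probsD(3)[OF l]
  interpret P: prob_space "PiM UNIV m" by (intro prob_space_PiM borel_probsD(1) m)
  interpret L: prob_space "l k" by (rule borel_probsD(1)[OF l])
  have [measurable]: "(f ^^ n) \<in> borel_measurable borel" for n by (intro measurable_linear linear_funpow f)
  define bad where "bad j = emeasure (l j) {v. e \<le> norm v}" for j
  \<comment> \<open>The constant of a Markov inequality for the truncated power at level
    \<open>e\<close>.\<close>
  define d where "d = min 1 (e powr p)"
  have d: "0 < d" using e by (simp add: d_def)
  have bad_le: "ennreal d * bad j \<le> trunc_moment p (l j)" for j
  proof -
    have "ennreal d * bad j = (\<integral>\<^sup>+v. ennreal d * indicator {v. e \<le> norm v} v \<partial>l j)"
      unfolding bad_def by (subst nn_integral_cmult_indicator) (auto simp: borel_probsD(3)[OF l])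
    also have "\<dots> \<le> trunc_moment p (l j)"
    proof (intro nn_integral_mono)
      fix v
      have "d \<le> min 1 (norm v powr p)" if "e \<le> norm v"
        unfolding d_def using e p that by (intro min.mono powr_mono2) auto
      then show "ennreal d * indicator {v. e \<le> norm v} v \<le> ennreal (min 1 (norm v powr p))"
        by (auto split: split_indicator intro: ennreal_leI)
    qed
    finally show ?thesis .
  qed
  have "ennreal d * (\<integral>\<^sup>+j. bad j \<partial>count_space UNIV) \<le> trunc_cost p l"
    unfolding total_cost_def by (subst nn_integral_cmult[symmetric]) (auto intro!: nn_integral_mono bad_le)
  then have bad_fin: "(\<integral>\<^sup>+j. bad j \<partial>count_space UNIV) < \<infinity>"
    using fin d by (cases "(\<integral>\<^sup>+j. bad j \<partial>count_space UNIV) = \<infinity>") (auto simp: ennreal_mult_top top.not_eq_extremum)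
  have bad_sum: "(\<Sum>n. bad (k + int n)) \<le> (\<integral>\<^sup>+j. bad j \<partial>count_space UNIV)"
  proof (rule suminf_le_const)
    fix N
    have "(\<Sum>n<N. bad (k + int n)) = (\<Sum>j\<in>(\<lambda>n. k + int n) ` {..<N}. bad j)"
      by (subst sum.reindex) (auto simp: inj_on_def)
    also have "\<dots> \<le> (\<integral>\<^sup>+j. bad j \<partial>count_space UNIV)" by (rule sum_le_nn_integral_count_space) simp
    finally show "(\<Sum>n<N. bad (k + int n)) \<le> (\<integral>\<^sup>+j. bad j \<partial>count_space UNIV)" .
  qed auto
  have "\<exists>x. emeasure (l k) {v. e \<le> norm (x + (f ^^ n) v)} \<le> bad (k + int n) + ennreal ((1 / 2) ^ n)" for n
  proof -
    let ?O = "distr (PiM UNIV m) borel (\<lambda>w. orbit_sum f w (k + int n) n)"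
    let ?D = "distr (l k) borel (f ^^ n)"
    have O: "?O \<in> borel_probs" by (intro distr_in_borel_probs P.prob_space_axioms measurable_orbit_sum m f)
    have D: "?D \<in> borel_probs" by (intro distr_linear_in_borel_probs l linear_funpow f)
    have ind: "(\<integral>\<^sup>+v. indicator {v. e \<le> norm v} (x + (f ^^ n) v) \<partial>l k) = emeasure (l k) {v. e \<le> norm (x + (f ^^ n) v)}" for x
    proof -
      have "(\<integral>\<^sup>+v. indicator {v. e \<le> norm v} (x + (f ^^ n) v) \<partial>l k) = (\<integral>\<^sup>+v. indicator {v. e \<le> norm (x + (f ^^ n) v)} v \<partial>l k)"
        by (intro nn_integral_cong) (auto split: split_indicator)
      also have "\<dots> = emeasure (l k) {v. e \<le> norm (x + (f ^^ n) v)}"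
        by (rule nn_integral_indicator) (simp add: borel_probsD(3)[OF l])
      finally show ?thesis .
    qed
    have "l (k + int n) = (?O \<star> ?D)"
      using convolution_recursion_unroll[where m = m and f = f and l = l, OF m f l rec, of "k + int n" n] by simp
    then have "bad (k + int n) = (\<integral>\<^sup>+v. indicator {v. e \<le> norm v} v \<partial>(?O \<star> ?D))"
      unfolding bad_def by simp
    also have "\<dots> = (\<integral>\<^sup>+x. \<integral>\<^sup>+y. indicator {v. e \<le> norm v} (x + y) \<partial>?D \<partial>?O)"
      using borel_probsD[OF O] borel_probsD[OF D] by (intro nn_integral_convolution) auto
    also have "\<dots> = (\<integral>\<^sup>+x. \<integral>\<^sup>+v. indicator {v. e \<le> norm v} (x + (f ^^ n) v) \<partial>l k \<partial>?O)"
      by (intro nn_integral_cong nn_integral_distr) measurable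
    also have "\<dots> = (\<integral>\<^sup>+x. emeasure (l k) {v. e \<le> norm (x + (f ^^ n) v)} \<partial>?O)"
      by (simp only: ind)
    finally have chain: "bad (k + int n) = (\<integral>\<^sup>+x. emeasure (l k) {v. e \<le> norm (x + (f ^^ n) v)} \<partial>?O)" .
    have [measurable]: "(\<lambda>x. emeasure (l k) {v. e \<le> norm (x + (f ^^ n) v)}) \<in> borel_measurable borel"
      unfolding ind[symmetric] by measurable
    from chain have eq: "bad (k + int n) = (\<integral>\<^sup>+x. emeasure (l k) {v. e \<le> norm (x + (f ^^ n) v)} \<partial>?O)" .
    have "bad (k + int n) < \<infinity>"
      using finite_measure.emeasure_finite[OF borel_probsD(2)[OF l]] unfolding bad_def by (simp add: less_top)
    \<comment> \<open>The summable excess makes the bound strict, as required for selecting a point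
      where the integrand does not exceed it.\<close>
    then have "bad (k + int n) < bad (k + int n) + ennreal ((1 / 2) ^ n)"
      by (cases "bad (k + int n)") (auto simp: ennreal_less_iff simp flip: ennreal_plus)
    then have "\<exists>x\<in>space ?O. emeasure (l k) {v. e \<le> norm (x + (f ^^ n) v)} \<le> bad (k + int n) + ennreal ((1 / 2) ^ n)"
      unfolding eq
      by (intro nn_integral_prob_exists_le borel_probsD(1)[OF O]) simp_all
    then show ?thesis by blast
  qed
  then obtain x where x: "\<And>n. emeasure (l k) {v. e \<le> norm (x n + (f ^^ n) v)} \<le> bad (k + int n) + ennreal ((1 / 2) ^ n)"
    by metis
  let ?A = "\<lambda>n. {v. e \<le> norm (x n + (f ^^ n) v)}"
  have A[measurable]: "?A n \<in> sets (l k)" for n by (simp add: borel_probsD(3)[OF l])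
  have "(\<Sum>n. emeasure (l k) (?A n)) \<le> (\<Sum>n. bad (k + int n) + ennreal ((1 / 2) ^ n))"
    by (intro suminf_le x) auto
  also have "\<dots> = (\<Sum>n. bad (k + int n)) + (\<Sum>n. ennreal ((1 / 2) ^ n))" by (rule suminf_add[symmetric]) auto
  also have "(\<Sum>n. ennreal ((1 / 2) ^ n)) = ennreal 2"
    by (subst suminf_ennreal2) (auto simp: suminf_geometric summable_geometric)
  also have "(\<Sum>n. bad (k + int n)) + ennreal 2 < \<infinity>" using order_le_less_trans[OF bad_sum bad_fin] by simp
  finally have "(\<Sum>n. emeasure (l k) (?A n)) < \<infinity>" .
  then have "summable (\<lambda>n. measure (l k) (?A n))"
    unfolding L.emeasure_eq_measure by (intro summable_suminf_not_top) auto
  then have "AE v in l k. \<forall>\<^sub>F n in sequentially. v \<in> space (l k) - ?A n"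
    by (intro borel_cantelli_AE1) (auto simp: L.emeasure_eq_measure)
  then have "AE v in l k. \<forall>\<^sub>F n in sequentially. norm (x n + (f ^^ n) v) < e"
    by eventually_elim (auto elim!: eventually_mono)
  then show ?thesis by blast
qed

text \<open>Two points whose shifted orbits are both eventually small differ by a contracted vector, so it
  suffices to subtract one typical sample path.\<close>

lemma solution_supported_on_lp_cosets:
  fixes m l :: "int \<Rightarrow> (real ^ 'd) measure"
  assumes m: "\<And>i. m i \<in> borel_probs" and f: "linear f" and l: "\<And>i. l i \<in> borel_probs"
    and rec: "\<And>k. l k = (m k \<star> distr (l (k - 1)) borel f)"
    and fin: "trunc_cost p l < \<infinity>" and p: "0 < p"
  obtains c where "c \<in> lp_seqs p" "\<And>k. AE v in l k. v - c k \<in> contraction_subspace f"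
proof -
  have fn: "linear (f ^^ n)" for n by (rule linear_funpow[OF f])
  have "\<exists>x. AE v in l k. \<forall>\<^sub>F n in sequentially. norm (x n + (f ^^ n) v) < inverse (real (Suc j))" for k j
    by (rule AE_eventually_shifted_orbit_small[where m = m and f = f and l = l, OF m f l rec fin p]) simp
  then have "\<forall>k j. \<exists>x. AE v in l k. \<forall>\<^sub>F n in sequentially. norm (x n + (f ^^ n) v) < inverse (real (Suc j))" by blast
  then obtain x where x: "\<And>k j. AE v in l k. \<forall>\<^sub>F n in sequentially. norm (x k j n + (f ^^ n) v) < inverse (real (Suc j))"
    unfolding choice_iff by blast
  define Q where "Q k v \<longleftrightarrow> (\<forall>j. \<forall>\<^sub>F n in sequentially. norm (x k j n + (f ^^ n) v) < inverse (real (Suc j)))" for k v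
  have Q: "AE v in l k. Q k v" for k unfolding Q_def AE_all_countable using x by blast
  have diff: "v - u \<in> contraction_subspace f" if "Q k v" "Q k u" for k u v
    unfolding contraction_subspace_def mem_Collect_eq
  proof (rule tendstoI)
    fix e :: real assume "0 < e"
    then obtain j where j: "inverse (real (Suc j)) < e / 2" using reals_Archimedean[of "e / 2"] by auto
    have "\<forall>\<^sub>F n in sequentially. norm (x k j n + (f ^^ n) v) < inverse (real (Suc j))"
      "\<forall>\<^sub>F n in sequentially. norm (x k j n + (f ^^ n) u) < inverse (real (Suc j))"
      using that by (auto simp: Q_def)
    then show "\<forall>\<^sub>F n in sequentially. dist ((f ^^ n) (v - u)) 0 < e"
    proof eventually_elim
      case (elim n)
      have "(f ^^ n) (v - u) = (x k j n + (f ^^ n) v) - (x k j n + (f ^^ n) u)" by (simp add: linear_diff[OF fn])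
      then have "norm ((f ^^ n) (v - u)) \<le> norm (x k j n + (f ^^ n) v) + norm (x k j n + (f ^^ n) u)"
        by (metis norm_triangle_ineq4)
      then show ?case using elim j by simp
    qed
  qed
  interpret P: prob_space "PiM UNIV l" by (intro prob_space_PiM borel_probsD(1) l)
  have "AE w in PiM UNIV l. \<forall>k. Q k (w k)"
    unfolding AE_all_countable by (intro allI AE_PiM_component[OF borel_probsD(1)[OF l] UNIV_I Q])
  then have ae: "AE w in PiM UNIV l. w \<in> lp_seqs p \<and> (\<forall>k. Q k (w k))"
    using AE_PiM_in_lp_seqs[OF l fin] by eventually_elim simp
  have "\<exists>w. w \<in> lp_seqs p \<and> (\<forall>k. Q k (w k))"
  proof (rule ccontr)
    assume none: "\<not> ?thesis"
    from ae have "AE w in PiM UNIV l. False" by eventually_elim (use none in blast)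
    then show False using P.AE_False by simp
  qed
  then obtain w where w: "w \<in> lp_seqs p" "\<And>k. Q k (w k)" by blast
  show ?thesis
  proof (rule that[OF w(1)])
    show "AE v in l k. v - w k \<in> contraction_subspace f" for k
      using Q[of k] by eventually_elim (rule diff[OF _ w(2)])
  qed
qed

text \<open>For typical \<open>v\<close> and \<open>u\<close>, both \<open>v + f u - c k\<close> and
  \<open>u - c (k - 1)\<close> are contracted. Subtracting the image of the latter removes
  \<open>u\<close>, so the resulting condition on \<open>v\<close> holds outright.\<close>

lemma AE_noise_in_coset:
  fixes m l :: "int \<Rightarrow> (real ^ 'd) measure"
  assumes m: "m k \<in> borel_probs" and f: "linear f" and l: "l (k - 1) \<in> borel_probs"
    and rec: "l k = (m k \<star> distr (l (k - 1)) borel f)"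
    and c: "\<And>k. AE v in l k. v - c k \<in> contraction_subspace f"
  shows "AE v in m k. v - (c k - f (c (k - 1))) \<in> contraction_subspace f"
proof -
  note [measurable_cong] = borel_probsD(3)[OF l]
  have mf[measurable]: "f \<in> borel_measurable borel" by (rule measurable_linear[OF f])
  let ?C = "contraction_subspace f"
  have A[measurable]: "(\<lambda>v. v - c k) -` ?C \<in> sets borel"
    by (rule measurable_sets_borel[OF _ sets_contraction_subspace[OF f]]) measurable
  interpret L: prob_space "l (k - 1)" by (rule borel_probsD(1)[OF l])
  have "AE v in (m k \<star> distr (l (k - 1)) borel f). v \<in> (\<lambda>v. v - c k) -` ?C"
    using c[of k] unfolding rec by simp
  from AE_convolutionD[OF m distr_linear_in_borel_probs[OF l f] this A]
  show ?thesis
  proof eventually_elim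
    case (elim v)
    moreover have "(\<lambda>u. v + u) -` ((\<lambda>v. v - c k) -` ?C) \<in> sets borel"
      by (rule measurable_sets_borel[OF _ A]) measurable
    ultimately have "AE u in l (k - 1). v + f u - c k \<in> ?C"
      by (subst (asm) AE_distr_iff) (auto simp: vimage_def)
    with c[of "k - 1"] have "AE u in l (k - 1). v - (c k - f (c (k - 1))) \<in> ?C"
    proof eventually_elim
      case (elim u)
      have "v - (c k - f (c (k - 1))) = (v + f u - c k) - f (u - c (k - 1))"
        by (simp add: linear_diff[OF f])
      moreover have "\<dots> \<in> ?C"
        by (rule subspace_diff[OF subspace_contraction_subspace[OF f] elim(2) contraction_subspace_image[OF elim(1)]])
      ultimately show ?case by (simp only:)
    qed
    then show ?case by (simp add: L.AE_const)
  qed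
qed

section \<open>The logarithmic cost of the noise of a solution\<close>

text \<open>The contraction rate combined with the dominant term, for use in both directions.
  Boundedness of \<open>u\<close> yields convergence, while \<open>C\<close> and \<open>r\<close>
  are fixed before \<open>u\<close> and \<open>D\<close>; this uniformity is essential because
  \<open>u\<close> will be a random path.\<close>

lemma orbit_norm_le_term:
  fixes f :: "real ^ 'd \<Rightarrow> real ^ 'd"
  assumes f: "linear f" and p: "1 \<le> p"
  obtains C r where "1 \<le> C" "0 < r" "r < 1"
    "\<And>u z k D. (\<And>j :: int. u j \<in> contraction_subspace f) \<Longrightarrow> (\<And>j. norm (u j) \<le> D) \<Longrightarrow>
      norm (z :: real ^ 'd) \<le> (\<Sum>n. norm ((f ^^ n) (u (k - int n)))) \<Longrightarrow>
      \<exists>n. norm z powr p \<le> C * r ^ n * norm (u (k - int n)) powr p"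
    "\<And>u k D. (\<And>j :: int. u j \<in> contraction_subspace f) \<Longrightarrow> (\<And>j. norm (u j) \<le> D) \<Longrightarrow>
      summable (\<lambda>n. norm ((f ^^ n) (u (k - int n))))"
proof -
  obtain a K where a: "0 < a" "a < 1" and K: "1 \<le> K"
    and bd: "\<And>v n. (\<lambda>n. (f ^^ n) v) \<longlonglongrightarrow> 0 \<Longrightarrow> norm ((f ^^ n) v) \<le> K * a ^ n * norm v"
  proof (rule contraction_bound[OF f], goal_cases)
    case (1 K a)
    show ?case by (rule 1(1)[OF 1(2-)])
  qed
  obtain C r where C: "1 \<le> C" and r: "0 < r" "r < 1" and trm: "\<And>z u. 0 \<le> z \<Longrightarrow> (\<And>n. 0 \<le> u n) \<Longrightarrow>
      summable (\<lambda>n. a ^ n * u n) \<Longrightarrow> z \<le> K * (\<Sum>n. a ^ n * u n) \<Longrightarrow> \<exists>n. z powr p \<le> C * r ^ n * u n powr p"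
  proof (rule weighted_sum_powr_le_term[OF a _ p, of K], goal_cases)
    case (2 C r)
    show ?case by (rule 2(1)[OF 2(2-)])
  qed (use K in linarith)
  have main: "summable (\<lambda>n. norm ((f ^^ n) (u (k - int n))))"
      "norm z \<le> (\<Sum>n. norm ((f ^^ n) (u (k - int n)))) \<Longrightarrow>
        \<exists>n. norm z powr p \<le> C * r ^ n * norm (u (k - int n)) powr p"
    if uC: "\<And>j. u j \<in> contraction_subspace f" and uD: "\<And>j. norm (u j) \<le> D"
    for u :: "int \<Rightarrow> real ^ 'd" and z :: "real ^ 'd" and k D
  proof -
    have le: "norm ((f ^^ n) (u j)) \<le> K * (a ^ n * norm (u j))" for n j
      using bd[of "u j" n] uC[of j] by (simp add: contraction_subspace_def mult.assoc)
    have sm: "summable (\<lambda>n. a ^ n * norm (u (k - int n)))"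
    proof (rule summable_comparison_test')
      show "summable (\<lambda>n. a ^ n * D)" using a by (intro summable_mult2 summable_geometric) auto
      show "norm (a ^ n * norm (u (k - int n))) \<le> a ^ n * D" for n
        using a uD by (simp add: abs_mult mult_left_mono)
    qed
    show sm': "summable (\<lambda>n. norm ((f ^^ n) (u (k - int n))))"
      by (rule summable_comparison_test'[OF summable_mult[OF sm, of K]]) (simp add: le)
    assume z: "norm z \<le> (\<Sum>n. norm ((f ^^ n) (u (k - int n))))"
    also have "\<dots> \<le> (\<Sum>n. K * (a ^ n * norm (u (k - int n))))"
      by (intro suminf_le le sm' summable_mult sm)
    also have "\<dots> = K * (\<Sum>n. a ^ n * norm (u (k - int n)))" by (rule suminf_mult[OF sm])
    finally show "\<exists>n. norm z powr p \<le> C * r ^ n * norm (u (k - int n)) powr p"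
      by (intro trm[of "norm z" "\<lambda>n. norm (u (k - int n))"] sm) auto
  qed
  show ?thesis
  proof (rule that)
    show "1 \<le> C" "0 < r" "r < 1" by (fact C r)+
    fix u :: "int \<Rightarrow> real ^ 'd" and z :: "real ^ 'd" and k D
    assume u: "\<And>j. u j \<in> contraction_subspace f" "\<And>j. norm (u j) \<le> D"
    show "summable (\<lambda>n. norm ((f ^^ n) (u (k - int n))))"
      by (rule main(1)[where u = u and D = D, OF u])
    assume "norm z \<le> (\<Sum>n. norm ((f ^^ n) (u (k - int n))))"
    then show "\<exists>n. norm z powr p \<le> C * r ^ n * norm (u (k - int n)) powr p"
      by (rule main(2)[where u = u and D = D, OF u])
  qed
qed

text \<open>Translation invariance of the counting measure: summing over observation times the
  effects of all earlier noise equals summing over noise times their effects on all later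
  times.\<close>

lemma nn_integral_count_space_shift:
  fixes h :: "nat \<Rightarrow> int \<Rightarrow> ennreal"
  shows "(\<integral>\<^sup>+k. (\<Sum>n. h n (k - int n)) \<partial>count_space UNIV) = (\<integral>\<^sup>+j. (\<Sum>n. h n j) \<partial>count_space UNIV)"
proof -
  have "(\<integral>\<^sup>+k. h n (k - int n) \<partial>count_space UNIV) = (\<integral>\<^sup>+j. h n j \<partial>count_space UNIV)" for n
    by (rule nn_integral_bij_count_space[where g = "\<lambda>k. k - int n"]) (auto intro: bij_betwI[where g = "\<lambda>k. k + int n"])
  then show ?thesis by (simp add: nn_integral_suminf)
qed

lemma orbit_sum_norm_le:
  assumes f: "linear f" and sm: "summable (\<lambda>i. norm ((f ^^ i) (u (k - int i))))"
  shows "norm (orbit_sum f u k n) \<le> (\<Sum>i. norm ((f ^^ i) (u (k - int i))))"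
  unfolding orbit_sum_def
proof (rule order_trans[OF norm_sum])
  show "(\<Sum>i<n. norm ((f ^^ i) (u (k - int i)))) \<le> (\<Sum>i. norm ((f ^^ i) (u (k - int i))))"
    by (rule sum_le_suminf[OF sm]) simp_all
qed

text \<open>A large noise value \<open>v\<close> at time \<open>k\<close> keeps \<open>f\<^sup>n v\<close> above \<open>1\<close> for about \<open>ln \<bar>v\<bar>\<close> steps. Since small
  noise contributes a summable amount, the truncated cost of the solution dominates the expected number of
  such steps.\<close>

lemma log_cost_finite_if_solution_trunc_cost_finite:
  fixes m l :: "int \<Rightarrow> (real ^ 'd) measure"
  assumes m: "\<And>i. m i \<in> borel_probs" and f: "linear f" "inj f" and l: "\<And>i. l i \<in> borel_probs"
    and rec: "\<And>k. l k = (m k \<star> distr (l (k - 1)) borel f)"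
    and mC: "\<And>k. AE v in m k. v \<in> contraction_subspace f" and lC: "\<And>k. AE v in l k. v \<in> contraction_subspace f"
    and mt: "trunc_cost p m < \<infinity>" and lt: "trunc_cost p l < \<infinity>" and p: "1 \<le> p"
  shows "log_cost p m < \<infinity>"
proof -
  note [measurable_cong] = borel_probsD(3)[OF m] borel_probsD(3)[OF l]
  have [measurable]: "(f ^^ n) \<in> borel_measurable borel" for n by (intro measurable_linear linear_funpow f)
  have p0: "0 \<le> p" using p by simp
  let ?C = "contraction_subspace f"
  have Cs[measurable]: "?C \<in> sets borel" by (rule sets_contraction_subspace[OF f(1)])
  have C0: "0 \<in> ?C" by (rule subspace_0[OF subspace_contraction_subspace[OF f(1)]])
  have fn: "linear (f ^^ n)" for n by (rule linear_funpow[OF f(1)])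
  obtain C r where C: "1 \<le> C" and r: "0 < r" "r < 1"
    and trm: "\<And>u z k D. (\<And>j :: int. u j \<in> ?C) \<Longrightarrow> (\<And>j. norm (u j) \<le> D) \<Longrightarrow>
      norm (z :: real ^ 'd) \<le> (\<Sum>n. norm ((f ^^ n) (u (k - int n)))) \<Longrightarrow>
      \<exists>n. norm z powr p \<le> C * r ^ n * norm (u (k - int n)) powr p"
    and smb: "\<And>u k D. (\<And>j :: int. u j \<in> ?C) \<Longrightarrow> (\<And>j. norm (u j) \<le> D) \<Longrightarrow>
      summable (\<lambda>n. norm ((f ^^ n) (u (k - int n))))"
  proof (rule orbit_norm_le_term[OF f(1) p], goal_cases)
    case (1 C r)
    show ?case by (rule 1(1)[OF 1(2-)])
  qed
  obtain b where b: "0 < b" "b < 1" and lower: "\<And>v n. b ^ n * norm v \<le> norm ((f ^^ n) v)"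
  proof (rule injective_linear_funpow_lower_bound[OF f], goal_cases)
    case (1 b)
    show ?case by (rule 1(1)[OF 1(2-)])
  qed
  have "\<forall>\<^sub>F n in sequentially. (\<integral>\<^sup>+k. emeasure (m k) {v. real n < norm v} \<partial>count_space UNIV) < ennreal (1 / 4)
      \<and> (\<integral>\<^sup>+k. emeasure (l k) {v. real n < norm v} \<partial>count_space UNIV) < ennreal (1 / 4)"
    by (intro eventually_conj eventually_tail_mass_le[OF m mt p0] eventually_tail_mass_le[OF l lt p0]) auto
  \<comment> \<open>The level must serve \<open>m\<close> and \<open>l\<close> together, because one
    law of the noise will be replaced by a law of the solution; the two quarters add up to the
    \<open>1 / 2\<close> of \<open>isolate_bound\<close>.\<close>
  then obtain N0 where N0: "1 \<le> N0" "(\<integral>\<^sup>+k. emeasure (m k) {v. real N0 < norm v} \<partial>count_space UNIV) < ennreal (1 / 4)"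
    "(\<integral>\<^sup>+k. emeasure (l k) {v. real N0 < norm v} \<partial>count_space UNIV) < ennreal (1 / 4)"
    unfolding eventually_sequentially by (meson nat_le_linear order_refl)
  define R where "R = real N0"
  have R: "1 \<le> R" using N0 by (simp add: R_def)
  \<comment> \<open>The null set outside the contraction subspace is counted as bad, so that noise
    with its bad values erased lies in the subspace everywhere and the deterministic orbit bounds
    apply to it.\<close>
  define B where "B = {v. R < norm v} \<union> - ?C"
  have [measurable]: "B \<in> sets borel" unfolding B_def by measurable
  have B_m: "emeasure (m k) B = emeasure (m k) {v. real N0 < norm v}" for k
    using mC[of k] by (intro emeasure_eq_AE) (auto simp: B_def R_def elim: eventually_mono)
  have B_l: "emeasure (l k) B = emeasure (l k) {v. real N0 < norm v}" for k
    using lC[of k] by (intro emeasure_eq_AE) (auto simp: B_def R_def elim: eventually_mono)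
  define e where "e n v = ennreal (min 1 (norm ((f ^^ n) v) powr p))" for n and v :: "real ^ 'd"
  have [measurable]: "e n \<in> borel_measurable borel" for n unfolding e_def by measurable
  define small where "small v = (if v \<in> B then 0 else v)" for v
  have [measurable]: "small \<in> borel_measurable borel" unfolding small_def by measurable
  have small: "small v \<in> ?C" "norm (small v) \<le> R" for v
    using C0 R by (auto simp: small_def B_def)
  \<comment> \<open>A bound independent of the window: \<open>2 powr p\<close> comes from the
    triangle inequality, \<open>C / (1 - r)\<close> from summing the effects of small noise over
    time, and \<open>R powr p\<close> from removing the truncation of values of norm at most
    \<open>R\<close>.\<close>
  define A where "A = ennreal (2 powr p) * (trunc_cost p l + ennreal (C / (1 - r) * R powr p) * (trunc_cost p m + trunc_cost p l))"
  have window: "(\<Sum>k\<in>{a0..b0}. \<integral>\<^sup>+v. indicator B v * (\<Sum>n\<le>nat (b0 - k). e n v) \<partial>(m(a0 := l a0)) k) \<le> 2 * A"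
    if ab: "a0 \<le> b0" for a0 b0
  proof -
    define J where "J = {a0..b0}"
    \<comment> \<open>Starting the noise at time \<open>a0\<close> with the solution itself makes finite orbit sums have the laws \<open>l k\<close>.\<close>
    define m' where "m' = m(a0 := l a0)"
    have m': "m' k \<in> borel_probs" for k using m l by (simp add: m'_def)
    note [measurable_cong] = borel_probsD(3)[OF m']
    \<comment> \<open>The \<open>k - a0 + 1\<close> terms reach back exactly to time
      \<open>a0\<close>, where the noise is the initial state.\<close>
    define S where "S w k = orbit_sum f w k (nat (k - a0 + 1))" for w k
    have S_meas[measurable]: "(\<lambda>w. S w k) \<in> borel_measurable (PiM UNIV m')" for k
      unfolding S_def by (rule measurable_orbit_sum[OF m' f(1)])
    have S_law: "distr (PiM UNIV m') borel (\<lambda>w. S w (a0 + int n)) = l (a0 + int n)" for n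
    proof (induction n)
      case 0
      have "S w a0 = w a0" for w by (simp add: S_def orbit_sum_def)
      moreover have "m' a0 = l a0" by (simp add: m'_def)
      ultimately show ?case using distr_PiM_coordinate[where m = m' and k = a0, OF m'] by simp
    next
      case (Suc n)
      have [simp]: "nat (int (Suc n) + 1) = Suc (Suc n)" "nat (int n + 1) = Suc n" by auto
      have "distr (PiM UNIV m') borel (\<lambda>w. S w (a0 + int (Suc n))) =
          (m' (a0 + int (Suc n)) \<star> distr (distr (PiM UNIV m') borel (\<lambda>w. S w (a0 + int n))) borel f)"
        using distr_orbit_sum_Suc[where m = m' and k = "a0 + int (Suc n)" and n = "Suc n", OF m' f(1)] by (simp add: S_def del: of_nat_Suc) (simp add: algebra_simps)
      also have "\<dots> = l (a0 + int (Suc n))"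
        unfolding Suc using rec[of "a0 + int (Suc n)"] by (simp add: m'_def)
      finally show ?case .
    qed
    \<comment> \<open>The noise of the window with bad values erased, extended by 0.\<close>
    define u where "u w j = (if j \<in> J then small (w j) else 0)" for w j
    have u: "u w j \<in> ?C" "norm (u w j) \<le> R" for w j using small C0 R by (auto simp: u_def)
    have u_meas[measurable]: "(\<lambda>w. u w j) \<in> borel_measurable (PiM UNIV m')" for j unfolding u_def by measurable
    have Su_meas[measurable]: "(\<lambda>w. S (u w) k) \<in> borel_measurable (PiM UNIV m')" for k
      unfolding S_def orbit_sum_def by measurable
    define F where "F w = ennreal (2 powr p) * ((\<Sum>k\<in>J. ennreal (min 1 (norm (S w k) powr p))) + (\<Sum>k\<in>J. ennreal (norm (S (u w) k) powr p)))" for w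
    have [measurable]: "F \<in> borel_measurable (PiM UNIV m')" unfolding F_def by measurable
    have "(\<Sum>k\<in>J. \<integral>\<^sup>+v. indicator B v * (\<Sum>n\<le>nat (b0 - k). e n v) \<partial>m' k) \<le> 2 * (\<integral>\<^sup>+w. F w \<partial>PiM UNIV m')"
    proof (rule isolate_bound[where B = "\<lambda>_. B"])
      show "finite J" by (simp add: J_def)
      show "(\<Sum>j\<in>J. emeasure (m' j) B) \<le> ennreal (1 / 2)"
      proof -
        have "(\<Sum>j\<in>J. emeasure (m' j) B) \<le> (\<Sum>j\<in>J. emeasure (m j) {v. real N0 < norm v} + emeasure (l j) {v. real N0 < norm v})"
          by (intro sum_mono) (auto simp: m'_def B_m B_l)
        also have "\<dots> \<le> (\<integral>\<^sup>+k. emeasure (m k) {v. real N0 < norm v} \<partial>count_space UNIV) + (\<integral>\<^sup>+k. emeasure (l k) {v. real N0 < norm v} \<partial>count_space UNIV)"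
          unfolding sum.distrib by (intro add_mono sum_le_nn_integral_count_space) (auto simp: J_def)
        also have "\<dots> \<le> ennreal (1 / 4) + ennreal (1 / 4)" using N0 by (intro add_mono) auto
        also have "\<dots> = ennreal (1 / 2)" by (subst ennreal_plus[symmetric]) auto
        finally show ?thesis .
      qed
      fix w :: "int \<Rightarrow> real ^ 'd" and k assume k: "k \<in> J" and good: "\<And>j. j \<in> J \<Longrightarrow> j \<noteq> k \<Longrightarrow> w j \<notin> B"
      show "indicator B (w k) * (\<Sum>n\<le>nat (b0 - k). e n (w k)) \<le> F w"
      proof (cases "w k \<in> B")
        case True
        \<comment> \<open>By linearity, the states driven by \<open>w\<close> and by its small part
          differ at time \<open>k + int n\<close> exactly by the effect of the only bad value
          \<open>w k\<close>.\<close>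
        have diff: "(f ^^ n) (w k) = S w (k + int n) - S (u w) (k + int n)" if n: "n \<le> nat (b0 - k)" for n
        proof -
          have "S w (k + int n) - S (u w) (k + int n) =
              (\<Sum>i<nat (k + int n - a0 + 1). (f ^^ i) (w (k + int n - int i) - u w (k + int n - int i)))"
            by (simp add: S_def orbit_sum_def linear_diff[OF fn] sum_subtractf)
          also have "\<dots> = (\<Sum>i<nat (k + int n - a0 + 1). if i = n then (f ^^ n) (w k) else 0)"
          proof (rule sum.cong[OF refl])
            fix i assume "i \<in> {..<nat (k + int n - a0 + 1)}"
            then have "k + int n - int i \<in> J" using k n by (auto simp: J_def)
            then show "(f ^^ i) (w (k + int n - int i) - u w (k + int n - int i)) = (if i = n then (f ^^ n) (w k) else 0)"
              using good[of "k + int n - int i"] True by (auto simp: u_def small_def linear_0[OF fn])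
          qed
          also have "\<dots> = (f ^^ n) (w k)" using k by (subst sum.delta) (auto simp: J_def)
          finally show ?thesis by simp
        qed
        have "(\<Sum>n\<le>nat (b0 - k). e n (w k)) \<le>
            (\<Sum>n\<le>nat (b0 - k). ennreal (2 powr p) * (ennreal (min 1 (norm (S w (k + int n)) powr p)) + ennreal (norm (S (u w) (k + int n)) powr p)))"
        proof (rule sum_mono)
          fix n assume n: "n \<in> {..nat (b0 - k)}"
          have "min 1 (norm (S w (k + int n) + - S (u w) (k + int n)) powr p)
            \<le> 2 powr p * (min 1 (norm (S w (k + int n)) powr p) + min 1 (norm (- S (u w) (k + int n)) powr p))"
            by (rule cost_function_norm_add[OF cost_function_min p0])
          also have "\<dots> \<le> 2 powr p * (min 1 (norm (S w (k + int n)) powr p) + norm (S (u w) (k + int n)) powr p)"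
            by (intro mult_left_mono add_left_mono) auto
          finally show "e n (w k) \<le> ennreal (2 powr p) * (ennreal (min 1 (norm (S w (k + int n)) powr p)) + ennreal (norm (S (u w) (k + int n)) powr p))"
            using n unfolding e_def by (simp add: diff ennreal_mult[symmetric] ennreal_plus[symmetric] ennreal_leI del: ennreal_plus)
        qed
        also have "\<dots> = (\<Sum>j\<in>(\<lambda>n. k + int n) ` {..nat (b0 - k)}. ennreal (2 powr p) * (ennreal (min 1 (norm (S w j) powr p)) + ennreal (norm (S (u w) j) powr p)))"
          by (subst sum.reindex) (auto simp: inj_on_def)
        also have "\<dots> \<le> (\<Sum>j\<in>J. ennreal (2 powr p) * (ennreal (min 1 (norm (S w j) powr p)) + ennreal (norm (S (u w) j) powr p)))"
          using k by (intro sum_mono2) (auto simp: J_def)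
        also have "\<dots> = F w" unfolding F_def by (simp add: sum_distrib_left[symmetric] sum.distrib del: sum_ennreal)
        finally show ?thesis using True by simp
      qed simp
    qed (use borel_probsD[OF m'] in auto)
    also have "(\<integral>\<^sup>+w. F w \<partial>PiM UNIV m') = ennreal (2 powr p) * ((\<Sum>k\<in>J. \<integral>\<^sup>+w. ennreal (min 1 (norm (S w k) powr p)) \<partial>PiM UNIV m')
        + (\<integral>\<^sup>+w. (\<Sum>k\<in>J. ennreal (norm (S (u w) k) powr p)) \<partial>PiM UNIV m'))"
      unfolding F_def by (simp add: nn_integral_cmult nn_integral_add nn_integral_sum del: sum_ennreal)
    also have "(\<Sum>k\<in>J. \<integral>\<^sup>+w. ennreal (min 1 (norm (S w k) powr p)) \<partial>PiM UNIV m') \<le> trunc_cost p l"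
    proof -
      have "(\<integral>\<^sup>+w. ennreal (min 1 (norm (S w k) powr p)) \<partial>PiM UNIV m') = trunc_moment p (l k)" if "k \<in> J" for k
      proof -
        have "l k = distr (PiM UNIV m') borel (\<lambda>w. S w k)" using S_law[of "nat (k - a0)"] that by (simp add: J_def)
        then show ?thesis by (simp add: nn_integral_distr)
      qed
      then show ?thesis
        unfolding total_cost_def using sum_le_nn_integral_count_space[of J "\<lambda>k. trunc_moment p (l k)"]
        by (simp add: J_def)
    qed
    also have "(\<integral>\<^sup>+w. (\<Sum>k\<in>J. ennreal (norm (S (u w) k) powr p)) \<partial>PiM UNIV m') \<le>
        (\<integral>\<^sup>+w. ennreal (C / (1 - r) * R powr p) * (\<Sum>j\<in>J. ennreal (min 1 (norm (w j) powr p))) \<partial>PiM UNIV m')"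
    proof (rule nn_integral_mono)
      fix w
      have "(\<Sum>k\<in>J. ennreal (norm (S (u w) k) powr p)) \<le> (\<integral>\<^sup>+k. ennreal (norm (S (u w) k) powr p) \<partial>count_space UNIV)"
        by (rule sum_le_nn_integral_count_space) (simp add: J_def)
      also have "\<dots> \<le> (\<integral>\<^sup>+k. (\<Sum>n. ennreal (C * r ^ n * norm (u w (k - int n)) powr p)) \<partial>count_space UNIV)"
      proof (rule nn_integral_mono)
        fix k
        have "norm (S (u w) k) \<le> (\<Sum>n. norm ((f ^^ n) (u w (k - int n))))"
          unfolding S_def by (rule orbit_sum_norm_le[OF f(1) smb[where u = "u w" and D = R, OF u]])
        \<comment> \<open>The dominant index is unknown, so its term is bounded by the whole series;
          after summation over time every \<open>u w j\<close> carries the total geometric weight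
          \<open>C / (1 - r)\<close>.\<close>
        from trm[where u = "u w" and D = R and k = k, OF u this] obtain n where "norm (S (u w) k) powr p \<le> C * r ^ n * norm (u w (k - int n)) powr p" by blast
        then have "ennreal (norm (S (u w) k) powr p) \<le> ennreal (C * r ^ n * norm (u w (k - int n)) powr p)" by (rule ennreal_leI)
        also have "\<dots> \<le> (\<Sum>n. ennreal (C * r ^ n * norm (u w (k - int n)) powr p))"
          using sum_le_suminf[of "\<lambda>n. ennreal (C * r ^ n * norm (u w (k - int n)) powr p)" "{n}"] by simp
        finally show "ennreal (norm (S (u w) k) powr p) \<le> (\<Sum>n. ennreal (C * r ^ n * norm (u w (k - int n)) powr p))" .
      qed
      also have "\<dots> = (\<integral>\<^sup>+j. (\<Sum>n. ennreal (C * r ^ n * norm (u w j) powr p)) \<partial>count_space UNIV)"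
        by (rule nn_integral_count_space_shift)
      also have "\<dots> = (\<integral>\<^sup>+j. ennreal (C / (1 - r) * norm (u w j) powr p) \<partial>count_space UNIV)"
      proof (intro nn_integral_cong)
        fix j
        have "(\<lambda>n. C * r ^ n * norm (u w j) powr p) sums (C * (1 / (1 - r)) * norm (u w j) powr p)"
          using r by (intro sums_mult sums_mult2 geometric_sums) auto
        then show "(\<Sum>n. ennreal (C * r ^ n * norm (u w j) powr p)) = ennreal (C / (1 - r) * norm (u w j) powr p)"
          using C r by (subst suminf_ennreal_eq) auto
      qed
      also have "\<dots> = (\<integral>\<^sup>+j. ennreal (C / (1 - r) * norm (u w j) powr p) * indicator J j \<partial>count_space UNIV)"
        by (intro nn_integral_cong) (auto simp: u_def split: split_indicator)
      also have "\<dots> = (\<Sum>j\<in>J. ennreal (C / (1 - r) * norm (u w j) powr p))"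
        by (simp add: nn_integral_count_space_indicator[symmetric] nn_integral_count_space_finite J_def)
      also have "\<dots> \<le> (\<Sum>j\<in>J. ennreal (C / (1 - r) * R powr p) * ennreal (min 1 (norm (w j) powr p)))"
      proof (rule sum_mono)
        fix j assume "j \<in> J"
        have "norm (u w j) powr p \<le> R powr p * min 1 (norm (u w j) powr p)"
          using u(2) R p0 by (intro powr_le_truncated) auto
        also have "\<dots> \<le> R powr p * min 1 (norm (w j) powr p)"
          using p by (intro mult_left_mono min.mono powr_mono2) (auto simp: u_def small_def)
        finally have "C / (1 - r) * norm (u w j) powr p \<le> C / (1 - r) * (R powr p * min 1 (norm (w j) powr p))"
          using C r by (intro mult_left_mono) auto
        then show "ennreal (C / (1 - r) * norm (u w j) powr p) \<le> ennreal (C / (1 - r) * R powr p) * ennreal (min 1 (norm (w j) powr p))"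
          using C r by (simp add: ennreal_mult[symmetric] mult.assoc ennreal_leI)
      qed
      finally show "(\<Sum>k\<in>J. ennreal (norm (S (u w) k) powr p)) \<le> ennreal (C / (1 - r) * R powr p) * (\<Sum>j\<in>J. ennreal (min 1 (norm (w j) powr p)))"
        by (simp only: sum_distrib_left)
    qed
    also have "\<dots> = ennreal (C / (1 - r) * R powr p) * (\<Sum>j\<in>J. trunc_moment p (m' j))"
    proof -
      have "trunc_moment p (m' j) = (\<integral>\<^sup>+w. ennreal (min 1 (norm (w j) powr p)) \<partial>PiM UNIV m')" for j
        by (rule nn_integral_PiM_component[OF borel_probsD(1)[OF m']]) measurable
      then show ?thesis by (simp add: nn_integral_cmult nn_integral_sum del: sum_ennreal)
    qed
    also have "(\<Sum>j\<in>J. trunc_moment p (m' j)) \<le> trunc_cost p m + trunc_cost p l"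
    proof -
      have "(\<Sum>j\<in>J. trunc_moment p (m' j)) \<le>
          (\<Sum>j\<in>J. trunc_moment p (m j) + trunc_moment p (l j))"
        by (intro sum_mono) (auto simp: m'_def)
      also have "\<dots> \<le> trunc_cost p m + trunc_cost p l"
        unfolding sum.distrib total_cost_def by (intro add_mono sum_le_nn_integral_count_space) (auto simp: J_def)
      finally show ?thesis .
    qed
    finally show ?thesis unfolding J_def m'_def A_def by (simp add: mult_left_mono add_mono)
  qed
  define h where "h v = indicator B v * (\<Sum>n. e n v)" for v :: "real ^ 'd"
  have [measurable]: "h \<in> borel_measurable borel" unfolding h_def by measurable
  have "(\<integral>\<^sup>+k. \<integral>\<^sup>+v. h v \<partial>m k \<partial>count_space UNIV) \<le> 2 * A"
  proof (rule nn_integral_count_space_leI)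
    fix I :: "int set" assume I: "finite I"
    have "(\<Sum>k\<in>I. \<integral>\<^sup>+v. h v \<partial>m k) = (\<Sum>k\<in>I. \<Sum>n. \<integral>\<^sup>+v. indicator B v * e n v \<partial>m k)"
      unfolding h_def by (intro sum.cong refl) (simp add: nn_integral_suminf[symmetric] ennreal_suminf_cmult)
    also have "\<dots> = (\<Sum>n. \<Sum>k\<in>I. \<integral>\<^sup>+v. indicator B v * e n v \<partial>m k)"
      by (rule suminf_sum[symmetric]) auto
    also have "\<dots> \<le> 2 * A"
    proof (rule suminf_le_const)
      fix N
      obtain D where D: "0 \<le> D" "\<And>k. k \<in> I \<Longrightarrow> \<bar>k\<bar> \<le> D"
      proof -
        have "\<bar>k\<bar> \<le> (\<Sum>k\<in>I. \<bar>k\<bar>)" if "k \<in> I" for k using I that by (intro member_le_sum) auto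
        then show ?thesis by (intro that[of "\<Sum>k\<in>I. \<bar>k\<bar>"]) (auto intro: sum_nonneg)
      qed
      \<comment> \<open>The window starts before all of \<open>I\<close>, since the law at
        \<open>a0\<close> itself is replaced, and ends late enough to contain \<open>N\<close>
        effects of each noise value.\<close>
      define a0 b0 where "a0 = - D - 1" and "b0 = D + int N"
      have "(\<Sum>n<N. \<Sum>k\<in>I. \<integral>\<^sup>+v. indicator B v * e n v \<partial>m k) = (\<Sum>k\<in>I. \<integral>\<^sup>+v. indicator B v * (\<Sum>n<N. e n v) \<partial>m k)"
        by (subst sum.swap) (simp add: nn_integral_sum[symmetric] sum_distrib_left)
      also have "\<dots> \<le> (\<Sum>k\<in>I. \<integral>\<^sup>+v. indicator B v * (\<Sum>n\<le>nat (b0 - k). e n v) \<partial>(m(a0 := l a0)) k)"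
      proof (rule sum_mono)
        fix k assume "k \<in> I"
        then have "N \<le> nat (b0 - k)" "k \<noteq> a0" using D(2)[of k] by (auto simp: b0_def a0_def)
        then show "(\<integral>\<^sup>+v. indicator B v * (\<Sum>n<N. e n v) \<partial>m k) \<le> (\<integral>\<^sup>+v. indicator B v * (\<Sum>n\<le>nat (b0 - k). e n v) \<partial>(m(a0 := l a0)) k)"
          by (auto intro!: nn_integral_mono mult_left_mono sum_mono2)
      qed
      also have "\<dots> \<le> (\<Sum>k\<in>{a0..b0}. \<integral>\<^sup>+v. indicator B v * (\<Sum>n\<le>nat (b0 - k). e n v) \<partial>(m(a0 := l a0)) k)"
      proof (rule sum_mono2)
        show "I \<subseteq> {a0..b0}" using D(2) by (fastforce simp: a0_def b0_def)
      qed auto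
      also have "\<dots> \<le> 2 * A" using D by (intro window) (simp add: a0_def b0_def)
      finally show "(\<Sum>n<N. \<Sum>k\<in>I. \<integral>\<^sup>+v. indicator B v * e n v \<partial>m k) \<le> 2 * A" .
    qed auto
    finally show "(\<Sum>k\<in>I. \<integral>\<^sup>+v. h v \<partial>m k) \<le> 2 * A" .
  qed
  also have "\<dots> < \<infinity>" using mt lt by (simp add: A_def ennreal_mult_less_top)
  finally have hI: "(\<integral>\<^sup>+k. \<integral>\<^sup>+v. h v \<partial>m k \<partial>count_space UNIV) < \<infinity>" .
  have bp: "0 < b powr p" "b powr p < 1" using b p powr_less_mono2[of p b 1] by auto
  show ?thesis
  proof (rule log_cost_le[OF m p0 R _ _ hI mt])
    fix v :: "real ^ 'd" assume v: "R < norm v"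
    \<comment> \<open>Injectivity enters here: \<open>f ^^ n\<close> shrinks no faster than
      \<open>b ^ n\<close>, so the truncated effects of \<open>v\<close> control its logarithm from
      above.\<close>
    have "ennreal (ln (1 + norm v powr p)) \<le> ennreal (1 / b powr p) * (\<Sum>n. ennreal (min 1 ((b powr p) ^ n * norm v powr p)))"
      by (rule ln_le_sum_min_geometric[OF bp]) simp
    also have "\<dots> \<le> ennreal (1 / b powr p) * (\<Sum>n. e n v)"
    proof (intro mult_left_mono suminf_le)
      fix n
      have "(b powr p) ^ n * norm v powr p = (b ^ n * norm v) powr p"
        using b by (simp add: powr_mult powr_power[symmetric] flip: powr_realpow) (simp add: powr_powr mult.commute)
      also have "\<dots> \<le> norm ((f ^^ n) v) powr p" using b p lower by (intro powr_mono2) auto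
      finally show "ennreal (min 1 ((b powr p) ^ n * norm v powr p)) \<le> e n v"
        unfolding e_def by (intro ennreal_leI min.mono) auto
    qed auto
    finally show "ennreal (ln (1 + norm v powr p)) \<le> ennreal (1 / b powr p) * h v"
      using v by (simp add: h_def B_def)
  qed simp
qed

section \<open>Existence of solutions\<close>

text \<open>The state of the recursion started in the infinitely remote past. The series converges
  almost surely under the hypotheses below; elsewhere the value is arbitrary.\<close>

definition orbit_limit :: "(real ^ 'd \<Rightarrow> real ^ 'd) \<Rightarrow> (int \<Rightarrow> real ^ 'd) \<Rightarrow> int \<Rightarrow> real ^ 'd"
  where "orbit_limit f w k = (\<Sum>n. (f ^^ n) (w (k - int n)))"

lemma measurable_orbit_limit:
  fixes m :: "int \<Rightarrow> (real ^ 'd) measure"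
  assumes m: "\<And>i. m i \<in> borel_probs" and f: "linear f"
  shows "(\<lambda>w. orbit_limit f w k) \<in> borel_measurable (PiM UNIV m)"
proof -
  note [measurable_cong] = borel_probsD(3)[OF m]
  have [measurable]: "(f ^^ i) \<in> borel_measurable borel" for i by (intro measurable_linear linear_funpow f)
  show ?thesis unfolding orbit_limit_def by measurable
qed

lemma AE_PiM_bounded_in_contraction_subspace:
  fixes m :: "int \<Rightarrow> (real ^ 'd) measure"
  assumes m: "\<And>i. m i \<in> borel_probs" and mt: "trunc_cost p m < \<infinity>" and p: "0 < p"
    and mC: "\<And>k. AE v in m k. v \<in> contraction_subspace f"
  shows "AE w in PiM UNIV m. (\<forall>j. w j \<in> contraction_subspace f) \<and> (\<exists>D. \<forall>j. norm (w j) \<le> D)"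
proof -
  have "AE w in PiM UNIV m. w j \<in> contraction_subspace f" for j
    by (rule AE_PiM_component[where P = "\<lambda>v. v \<in> contraction_subspace f" and M = m and i = j, OF borel_probsD(1)[OF m] UNIV_I mC])
  then have "AE w in PiM UNIV m. \<forall>j. w j \<in> contraction_subspace f" by (simp add: AE_all_countable)
  then show ?thesis
    using AE_PiM_in_lp_seqs[OF m mt]
  proof eventually_elim
    case (elim w)
    then show ?case using lp_seqs_bounded[OF elim(2) p] by blast
  qed
qed

context
  fixes m :: "int \<Rightarrow> (real ^ 'd) measure" and f :: "real ^ 'd \<Rightarrow> real ^ 'd" and p :: real
  assumes m: "\<And>i. m i \<in> borel_probs" and f: "linear f" and p: "1 \<le> p"
    and mC: "\<And>k. AE v in m k. v \<in> contraction_subspace f" and mt: "trunc_cost p m < \<infinity>"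
begin

lemma AE_orbit_sums:
  "AE w in PiM UNIV m. \<forall>k. (\<lambda>n. (f ^^ n) (w (k - int n))) sums orbit_limit f w k"
proof -
  have "AE w in PiM UNIV m. (\<forall>j. w j \<in> contraction_subspace f) \<and> (\<exists>D. \<forall>j. norm (w j) \<le> D)"
    using p by (intro AE_PiM_bounded_in_contraction_subspace[where m = m and p = p, OF m mt _ mC]) auto
  then show ?thesis
  proof eventually_elim
    case (elim w)
    then obtain D where w: "\<And>j. w j \<in> contraction_subspace f" "\<And>j. norm (w j) \<le> D" by blast
    have sm: "summable (\<lambda>n. norm ((f ^^ n) (w (k - int n))))" for k
    proof (rule orbit_norm_le_term[OF f p], goal_cases)
      case (1 C r)
      show ?case by (rule 1(5)[where u = w and D = D, OF w])
    qed
    show ?case unfolding orbit_limit_def by (intro allI summable_sums summable_norm_cancel[OF sm])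
  qed
qed

lemma orbit_limit_law_in_borel_probs: "distr (PiM UNIV m) borel (\<lambda>w. orbit_limit f w k) \<in> borel_probs"
  by (intro distr_in_borel_probs prob_space_PiM borel_probsD(1) m measurable_orbit_limit f)

lemma orbit_limit_law_recursion:
  "distr (PiM UNIV m) borel (\<lambda>w. orbit_limit f w k) =
    (m k \<star> distr (distr (PiM UNIV m) borel (\<lambda>w. orbit_limit f w (k - 1))) borel f)"
proof -
  note [measurable] = measurable_orbit_limit[OF m f] measurable_linear[OF f]
  note [measurable_cong] = borel_probsD(3)[OF m]
  have bl: "bounded_linear f" using f by (simp add: linear_conv_bounded_linear)
  have "distr (PiM UNIV m) borel (\<lambda>w. orbit_limit f w k) =
      distr (PiM UNIV m) borel (\<lambda>w. w k + f (orbit_limit f w (k - 1)))"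
  proof (rule distr_cong_AE)
    show "AE w in PiM UNIV m. orbit_limit f w k = w k + f (orbit_limit f w (k - 1))"
      using AE_orbit_sums
    proof eventually_elim
      case (elim w)
      have "(\<lambda>n. f ((f ^^ n) (w (k - 1 - int n)))) sums f (orbit_limit f w (k - 1))"
        by (rule bounded_linear.sums[OF bl elim[rule_format]])
      then have "(\<lambda>n. (f ^^ Suc n) (w (k - int (Suc n)))) sums f (orbit_limit f w (k - 1))"
        by (simp add: algebra_simps)
      then have "(\<lambda>n. (f ^^ n) (w (k - int n))) sums (f (orbit_limit f w (k - 1)) + (f ^^ 0) (w (k - int 0)))"
        by (rule sums_Suc[of "\<lambda>n. (f ^^ n) (w (k - int n))"])
      from sums_unique2[OF elim[rule_format] this] show ?case by (simp add: add.commute)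
    qed
  qed simp_all
  also have "\<dots> = (m k \<star> distr (PiM UNIV m) borel (\<lambda>w. f (orbit_limit f w (k - 1))))"
    by (intro distr_PiM_add_independent m) (measurable, simp add: orbit_limit_def)
  finally show ?thesis by (simp add: distr_distr o_def)
qed

text \<open>The dominant term bounds the truncated power of the limit by a sum of truncated terms.
  Regrouped by noise times, a value \<open>v\<close> contributes
  \<open>\<Sum>n. min 1 (C * r ^ n * norm v powr p)\<close>, which is of the order of
  \<open>ln (1 + norm v powr p)\<close>.\<close>

lemma orbit_limit_trunc_cost_finite:
  assumes ml: "log_cost p m < \<infinity>"
  shows "trunc_cost p (\<lambda>k. distr (PiM UNIV m) borel (\<lambda>w. orbit_limit f w k)) < \<infinity>"
proof -
  note [measurable] = measurable_orbit_limit[OF m f]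
  note [measurable_cong] = borel_probsD(3)[OF m]
  obtain C r where C: "1 \<le> C" and r: "0 < r" "r < 1"
    and trm: "\<And>u z k D. (\<And>j :: int. u j \<in> contraction_subspace f) \<Longrightarrow> (\<And>j. norm (u j) \<le> D) \<Longrightarrow>
      norm (z :: real ^ 'd) \<le> (\<Sum>n. norm ((f ^^ n) (u (k - int n)))) \<Longrightarrow>
      \<exists>n. norm z powr p \<le> C * r ^ n * norm (u (k - int n)) powr p"
    and smb: "\<And>u k D. (\<And>j :: int. u j \<in> contraction_subspace f) \<Longrightarrow> (\<And>j. norm (u j) \<le> D) \<Longrightarrow>
      summable (\<lambda>n. norm ((f ^^ n) (u (k - int n))))"
  proof (rule orbit_norm_le_term[OF f p], goal_cases)
    case (1 C r)
    show ?case by (rule 1(1)[OF 1(2-)])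
  qed
  define h where "h n v = ennreal (min 1 (C * r ^ n * norm v powr p))" for n and v :: "real ^ 'd"
  have [measurable]: "h n \<in> borel_measurable borel" for n unfolding h_def by measurable
  have "AE w in PiM UNIV m. (\<forall>j. w j \<in> contraction_subspace f) \<and> (\<exists>D. \<forall>j. norm (w j) \<le> D)"
    using p by (intro AE_PiM_bounded_in_contraction_subspace[where m = m and p = p, OF m mt _ mC]) auto
  then have le: "AE w in PiM UNIV m. \<forall>k. ennreal (min 1 (norm (orbit_limit f w k) powr p)) \<le> (\<Sum>n. h n (w (k - int n)))"
  proof eventually_elim
    case (elim w)
    then obtain D where w: "\<And>j. w j \<in> contraction_subspace f" "\<And>j. norm (w j) \<le> D" by blast
    show ?case
    proof
      fix k
      have "norm (orbit_limit f w k) \<le> (\<Sum>n. norm ((f ^^ n) (w (k - int n))))"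
        unfolding orbit_limit_def by (rule summable_norm[OF smb[where u = w and D = D, OF w]])
      from trm[where u = w and D = D, OF w this]
      obtain n where "norm (orbit_limit f w k) powr p \<le> C * r ^ n * norm (w (k - int n)) powr p" by blast
      then have "ennreal (min 1 (norm (orbit_limit f w k) powr p)) \<le> h n (w (k - int n))"
        unfolding h_def by (intro ennreal_leI min.mono) auto
      also have "\<dots> \<le> (\<Sum>n. h n (w (k - int n)))"
        using sum_le_suminf[of "\<lambda>n. h n (w (k - int n))" "{n}"] by simp
      finally show "ennreal (min 1 (norm (orbit_limit f w k) powr p)) \<le> (\<Sum>n. h n (w (k - int n)))" .
    qed
  qed
  have "trunc_cost p (\<lambda>k. distr (PiM UNIV m) borel (\<lambda>w. orbit_limit f w k)) =
      (\<integral>\<^sup>+k. \<integral>\<^sup>+w. ennreal (min 1 (norm (orbit_limit f w k) powr p)) \<partial>PiM UNIV m \<partial>count_space UNIV)"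
    unfolding total_cost_def by (simp add: nn_integral_distr)
  also have "\<dots> \<le> (\<integral>\<^sup>+k. \<integral>\<^sup>+w. (\<Sum>n. h n (w (k - int n))) \<partial>PiM UNIV m \<partial>count_space UNIV)"
  proof (rule nn_integral_mono)
    fix k
    show "(\<integral>\<^sup>+w. ennreal (min 1 (norm (orbit_limit f w k) powr p)) \<partial>PiM UNIV m) \<le> (\<integral>\<^sup>+w. (\<Sum>n. h n (w (k - int n))) \<partial>PiM UNIV m)"
      by (rule nn_integral_mono_AE) (use le in eventually_elim, rule spec)
  qed
  also have "\<dots> = (\<integral>\<^sup>+k. (\<Sum>n. \<integral>\<^sup>+v. h n v \<partial>m (k - int n)) \<partial>count_space UNIV)"
  proof (intro nn_integral_cong)
    fix k
    have "(\<integral>\<^sup>+v. h n v \<partial>m j) = (\<integral>\<^sup>+w. h n (w j) \<partial>PiM UNIV m)" for n j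
      by (rule nn_integral_PiM_component[OF borel_probsD(1)[OF m]]) measurable
    then show "(\<integral>\<^sup>+w. (\<Sum>n. h n (w (k - int n))) \<partial>PiM UNIV m) = (\<Sum>n. \<integral>\<^sup>+v. h n v \<partial>m (k - int n))"
      by (simp add: nn_integral_suminf)
  qed
  also have "\<dots> = (\<integral>\<^sup>+j. (\<Sum>n. \<integral>\<^sup>+v. h n v \<partial>m j) \<partial>count_space UNIV)"
    by (rule nn_integral_count_space_shift)
  also have "\<dots> = (\<integral>\<^sup>+j. \<integral>\<^sup>+v. (\<Sum>n. h n v) \<partial>m j \<partial>count_space UNIV)"
    by (simp add: nn_integral_suminf)
  also have "\<dots> \<le> (\<integral>\<^sup>+j. \<integral>\<^sup>+v. ennreal (2 * C / (1 - r)) * ennreal (ln (1 + norm v powr p)) \<partial>m j \<partial>count_space UNIV)"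
  proof (intro nn_integral_mono)
    fix j v
    have "(\<Sum>n. h n v) \<le> ennreal (2 * C / (1 - r) * ln (1 + norm v powr p))"
      unfolding h_def by (rule sum_min_geometric_le_ln[OF r _ C]) simp
    then show "(\<Sum>n. h n v) \<le> ennreal (2 * C / (1 - r)) * ennreal (ln (1 + norm v powr p))"
      using C r by (simp add: ennreal_mult[symmetric])
  qed
  also have "\<dots> = ennreal (2 * C / (1 - r)) * log_cost p m"
    by (simp add: total_cost_def nn_integral_cmult)
  also have "\<dots> < \<infinity>" using ml by (simp add: ennreal_mult_less_top)
  finally show ?thesis .
qed

end

section \<open>Tail processes and the fundamental property\<close>

text \<open>Fatou gives one inequality between the laws on open sets, and outer regularity extends
  it to Borel sets. Both are probability measures, so passing to complements gives equality.\<close>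

lemma distr_AE_limit_eq:
  fixes X :: "nat \<Rightarrow> 'a \<Rightarrow> 'b :: {second_countable_topology, complete_space}"
  assumes M: "prob_space M" and X[measurable]: "\<And>n. X n \<in> borel_measurable M" and Y[measurable]: "Y \<in> borel_measurable M"
    and lim: "AE \<omega> in M. (\<lambda>n. X n \<omega>) \<longlonglongrightarrow> Y \<omega>"
    and law: "\<forall>\<^sub>F n in sequentially. distr M borel (X n) = \<nu>"
  shows "distr M borel Y = \<nu>"
proof -
  interpret prob_space M by fact
  interpret Y: prob_space "distr M borel Y" by (rule prob_space_distr) simp
  obtain n0 where n0: "distr M borel (X n0) = \<nu>" using law by (auto simp: eventually_sequentially)
  interpret \<nu>: prob_space \<nu> unfolding n0[symmetric] by (rule prob_space_distr) simp
  have sets: "sets \<nu> = sets borel" unfolding n0[symmetric] by simp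
  have opn: "emeasure (distr M borel Y) G \<le> emeasure \<nu> G" if G: "open G" for G
  proof -
    have [measurable]: "G \<in> sets borel" using G by simp
    have "emeasure (distr M borel Y) G = (\<integral>\<^sup>+\<omega>. indicator G (Y \<omega>) \<partial>M)"
      by (subst nn_integral_indicator[symmetric], simp, subst nn_integral_distr) auto
    also have "\<dots> \<le> (\<integral>\<^sup>+\<omega>. liminf (\<lambda>n. indicator G (X n \<omega>)) \<partial>M)"
    proof (rule nn_integral_mono_AE)
      show "AE \<omega> in M. indicator G (Y \<omega>) \<le> liminf (\<lambda>n. indicator G (X n \<omega>) :: ennreal)"
        using lim
      proof eventually_elim
        case (elim \<omega>)
        show ?case
        proof (cases "Y \<omega> \<in> G")
          case True
          then have "\<forall>\<^sub>F n in sequentially. X n \<omega> \<in> G" using elim G topological_tendstoD by blast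
          then have "\<forall>\<^sub>F n in sequentially. (1 :: ennreal) \<le> indicator G (X n \<omega>)" by eventually_elim simp
          then have "(1 :: ennreal) \<le> liminf (\<lambda>n. indicator G (X n \<omega>))" by (rule Liminf_bounded)
          then show ?thesis using True by simp
        qed simp
      qed
    qed
    also have "\<dots> \<le> liminf (\<lambda>n. \<integral>\<^sup>+\<omega>. indicator G (X n \<omega>) \<partial>M)"
      by (rule nn_integral_liminf) measurable
    also have "\<dots> = liminf (\<lambda>n. emeasure \<nu> G)"
    proof (rule Liminf_eq)
      show "\<forall>\<^sub>F n in sequentially. (\<integral>\<^sup>+\<omega>. indicator G (X n \<omega>) \<partial>M) = emeasure \<nu> G"
        using law
      proof eventually_elim
        case (elim n)
        show ?case unfolding elim[symmetric]
          by (subst nn_integral_indicator[symmetric], simp, subst nn_integral_distr) auto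
      qed
    qed
    also have "\<dots> = emeasure \<nu> G" by (simp add: Liminf_const)
    finally show ?thesis .
  qed
  have le: "emeasure (distr M borel Y) B \<le> emeasure \<nu> B" if B: "B \<in> sets borel" for B
  proof -
    have "emeasure \<nu> B = (INF U\<in>{U. B \<subseteq> U \<and> open U}. emeasure \<nu> U)"
      using sets B \<nu>.emeasure_space_1 by (intro outer_regular) auto
    moreover have "emeasure (distr M borel Y) B \<le> (INF U\<in>{U. B \<subseteq> U \<and> open U}. emeasure \<nu> U)"
      by (rule INF_greatest) (auto intro: order_trans[OF emeasure_mono opn])
    ultimately show ?thesis by simp
  qed
  show ?thesis
  proof (rule measure_eqI)
    show "sets (distr M borel Y) = sets \<nu>" by (simp add: sets)
    fix B assume "B \<in> sets (distr M borel Y)"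
    then have B: "B \<in> sets borel" by simp
    have "Y.prob (- B) \<le> \<nu>.prob (- B)"
      using le[of "- B"] B by (auto simp: Y.emeasure_eq_measure \<nu>.emeasure_eq_measure)
    moreover have "Y.prob (- B) = 1 - Y.prob B" "\<nu>.prob (- B) = 1 - \<nu>.prob B"
      using Y.prob_compl[of B] \<nu>.prob_compl[of B] B sets sets_eq_imp_space_eq[OF sets] by (auto simp: Compl_eq_Diff_UNIV)
    moreover have "Y.prob B \<le> \<nu>.prob B"
      using le[OF B] by (auto simp: Y.emeasure_eq_measure \<nu>.emeasure_eq_measure)
    ultimately show "emeasure (distr M borel Y) B = emeasure \<nu> B"
      by (simp add: Y.emeasure_eq_measure \<nu>.emeasure_eq_measure)
  qed
qed

text \<open>The coordinates of the process built below are the tails \<open>D n = e n + e (n + 1) + \<dots>\<close> of a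
  formal series with independent terms \<open>e n\<close> of law \<open>\<eta> n\<close>: up to time \<open>N\<close> they are modelled by
  \<open>e n + \<dots> + e (N - 1) + d\<close> with \<open>d\<close> of law \<open>\<rho> N\<close>, and the recursion makes these models consistent.\<close>

context
  fixes \<rho> \<eta> :: "nat \<Rightarrow> (real ^ 'd) measure"
  assumes \<rho>: "\<And>n. \<rho> n \<in> borel_probs" and \<eta>: "\<And>n. \<eta> n \<in> borel_probs"
    and rec: "\<And>n. \<rho> n = (\<eta> n \<star> \<rho> (Suc n))"
begin

definition tail_noise :: "nat \<Rightarrow> nat \<Rightarrow> (real ^ 'd) measure"
  where "tail_noise N i = (if i < N then \<eta> i else \<rho> i)"

definition tail_map :: "nat \<Rightarrow> nat set \<Rightarrow> (nat \<Rightarrow> real ^ 'd) \<Rightarrow> nat \<Rightarrow> real ^ 'd"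
  where "tail_map N J v = (\<lambda>n\<in>J. \<Sum>i=n..N. v i)"

definition tail_law :: "nat \<Rightarrow> nat set \<Rightarrow> (nat \<Rightarrow> real ^ 'd) measure"
  where "tail_law N J = distr (PiM UNIV (tail_noise N)) (PiM J (\<lambda>_. borel)) (tail_map N J)"

lemma tail_noise_in_borel_probs: "tail_noise N i \<in> borel_probs"
  using \<rho> \<eta> by (simp add: tail_noise_def)

lemma measurable_tail_map [measurable]: "tail_map N J \<in> measurable (PiM UNIV (tail_noise N')) (PiM J (\<lambda>_. borel))"
proof -
  note [measurable_cong] = borel_probsD(3)[OF tail_noise_in_borel_probs]
  show ?thesis unfolding tail_map_def by (rule measurable_restrict) measurable
qed

lemma tail_law_Suc:
  assumes J: "J \<subseteq> {..N}"
  shows "tail_law (Suc N) J = tail_law N J"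
proof (rule measure_eqI)
  show "sets (tail_law (Suc N) J) = sets (tail_law N J)" by (simp add: tail_law_def)
  fix A assume "A \<in> sets (tail_law (Suc N) J)"
  then have A[measurable]: "A \<in> sets (PiM J (\<lambda>_. borel))" by (simp add: tail_law_def)
  \<comment> \<open>The two noise families differ only at coordinate \<open>N\<close>, with law
    \<open>\<rho> N\<close> in one and \<open>\<eta> N\<close> in the other.\<close>
  define I where "I = UNIV - {N}"
  have I: "insert N I = UNIV" "insert (Suc N) I = I" by (auto simp: I_def)
  note [measurable_cong] = borel_probsD(3)[OF tail_noise_in_borel_probs] borel_probsD(3)[OF \<rho>] borel_probsD(3)[OF \<eta>]
  note pr = borel_probsD(1)[OF tail_noise_in_borel_probs]
  have same: "PiM I (tail_noise N) = PiM I (tail_noise (Suc N))"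
    by (rule PiM_cong) (auto simp: I_def tail_noise_def)
  interpret I: prob_space "PiM I (tail_noise (Suc N))" by (intro prob_space_PiM pr)
  define F where "F w = (indicator A (tail_map N J w) :: ennreal)" for w
  have F[measurable]: "F \<in> borel_measurable (PiM UNIV (tail_noise N'))" for N' unfolding F_def by measurable
  have upd[measurable]: "(\<lambda>(y, w). w(N := y)) \<in> borel \<Otimes>\<^sub>M PiM I (tail_noise (Suc N)) \<rightarrow>\<^sub>M PiM UNIV (tail_noise (Suc N))"
    unfolding case_prod_beta
    by (rule measurable_fun_upd[where J = I]) (auto simp: I measurable_cong_sets[OF refl borel_probsD(3)[OF tail_noise_in_borel_probs]])
  have FF[measurable]: "(\<lambda>(y, w). F (w(N := y))) \<in> borel_measurable (borel \<Otimes>\<^sub>M PiM I (tail_noise (Suc N)))"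
    using measurable_compose[OF upd F] by (simp add: case_prod_beta')
  define H where "H y = (\<integral>\<^sup>+w. F (w(N := y)) \<partial>PiM I (tail_noise (Suc N)))" for y
  have H[measurable]: "H \<in> borel_measurable borel" unfolding H_def
    by (rule I.borel_measurable_nn_integral) (rule FF)
  have "emeasure (tail_law N J) A = (\<integral>\<^sup>+w. F w \<partial>PiM UNIV (tail_noise N))"
    unfolding tail_law_def F_def by (subst nn_integral_indicator[symmetric], simp, subst nn_integral_distr) auto
  also have "\<dots> = (\<integral>\<^sup>+y. H y \<partial>\<rho> N)"
    using nn_integral_PiM_insert[of "tail_noise N" F N I] pr F[of N]
    by (simp add: I H_def same) (simp add: tail_noise_def)
  also have "\<dots> = (\<integral>\<^sup>+a. \<integral>\<^sup>+b. H (a + b) \<partial>\<rho> (Suc N) \<partial>\<eta> N)"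
    unfolding rec[of N] using borel_probsD[OF \<rho>] borel_probsD[OF \<eta>] by (intro nn_integral_convolution) auto
  finally have right: "emeasure (tail_law N J) A = (\<integral>\<^sup>+a. \<integral>\<^sup>+b. H (a + b) \<partial>\<rho> (Suc N) \<partial>\<eta> N)" .
  define G where "G w = F (w(N := w N + w (Suc N)))" for w
  \<comment> \<open>The tails starting at or before \<open>N\<close> see the coordinates
    \<open>N\<close> and \<open>Suc N\<close> only through their sum; by the recursion this sum has
    law \<open>\<rho> N\<close>.\<close>
  have tm: "tail_map (Suc N) J w = tail_map N J (w(N := w N + w (Suc N)))" for w
  proof (rule ext)
    fix n
    show "tail_map (Suc N) J w n = tail_map N J (w(N := w N + w (Suc N))) n"
    proof (cases "n \<in> J")
      case True
      then have n: "n \<le> N" using J by auto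
      have "(\<Sum>i=n..N. (w(N := w N + w (Suc N))) i) = (\<Sum>i\<in>{n..N} - {N}. w i) + (w N + w (Suc N))"
        using n by (subst sum.remove[of _ N]) (auto intro!: sum.cong simp: add.commute)
      also have "\<dots> = (\<Sum>i=n..N. w i) + w (Suc N)"
        using n by (subst sum.remove[of "{n..N}" N]) (auto simp: algebra_simps)
      finally show ?thesis using True n by (simp add: tail_map_def)
    qed (simp add: tail_map_def)
  qed
  have G_eq: "G = (\<lambda>w. indicator A (tail_map (Suc N) J w))" by (simp add: G_def F_def tm fun_eq_iff)
  have G[measurable]: "G \<in> borel_measurable (PiM UNIV (tail_noise (Suc N)))" unfolding G_eq by measurable
  have "emeasure (tail_law (Suc N) J) A = (\<integral>\<^sup>+w. G w \<partial>PiM UNIV (tail_noise (Suc N)))"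
    unfolding tail_law_def G_eq by (subst nn_integral_indicator[symmetric], simp, subst nn_integral_distr) auto
  also have "\<dots> = (\<integral>\<^sup>+a. \<integral>\<^sup>+w. F (w(N := a + w (Suc N))) \<partial>PiM I (tail_noise (Suc N)) \<partial>\<eta> N)"
    using nn_integral_PiM_insert[of "tail_noise (Suc N)" G N I] pr G
    by (simp add: I G_def) (simp add: tail_noise_def)
  also have "\<dots> = (\<integral>\<^sup>+a. \<integral>\<^sup>+b. H (a + b) \<partial>\<rho> (Suc N) \<partial>\<eta> N)"
  proof (rule nn_integral_cong)
    fix a
    let ?g = "\<lambda>w. F (w(N := a + w (Suc N)))"
    have "(\<lambda>w. (a + w (Suc N), w)) \<in> PiM I (tail_noise (Suc N)) \<rightarrow>\<^sub>M borel \<Otimes>\<^sub>M PiM I (tail_noise (Suc N))"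
    proof (intro measurable_Pair borel_measurable_add)
      have "(\<lambda>w. w (Suc N)) \<in> PiM I (tail_noise (Suc N)) \<rightarrow>\<^sub>M tail_noise (Suc N) (Suc N)"
        by (rule measurable_component_singleton) (simp add: I_def)
      then show "(\<lambda>w. w (Suc N)) \<in> borel_measurable (PiM I (tail_noise (Suc N)))"
        by (simp add: measurable_cong_sets[OF refl borel_probsD(3)[OF tail_noise_in_borel_probs]])
    qed auto
    from measurable_compose[OF this FF]
    have g: "?g \<in> borel_measurable (PiM I (tail_noise (Suc N)))" by simp
    have "(\<integral>\<^sup>+w. ?g w \<partial>PiM I (tail_noise (Suc N))) =
        (\<integral>\<^sup>+b. \<integral>\<^sup>+w. ?g (w(Suc N := b)) \<partial>PiM I (tail_noise (Suc N)) \<partial>\<rho> (Suc N))"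
      using nn_integral_PiM_insert[of "tail_noise (Suc N)" ?g "Suc N" I] pr g
      by (simp only: I) (simp add: tail_noise_def)
    also have "\<dots> = (\<integral>\<^sup>+b. H (a + b) \<partial>\<rho> (Suc N))"
      unfolding H_def
    proof (intro nn_integral_cong)
      fix b w
      \<comment> \<open>\<open>J\<close> lies in \<open>{..N}\<close>, so the resampled coordinate
        \<open>Suc N\<close> enters only through \<open>a + b\<close>.\<close>
      have "tail_map N J (w(Suc N := b, N := a + b)) = tail_map N J (w(N := a + b))"
        using J by (auto simp: tail_map_def fun_eq_iff intro!: sum.cong)
      then show "?g (w(Suc N := b)) = F (w(N := a + b))" by (simp add: F_def)
    qed
    finally show "(\<integral>\<^sup>+w. ?g w \<partial>PiM I (tail_noise (Suc N))) = (\<integral>\<^sup>+b. H (a + b) \<partial>\<rho> (Suc N))" .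
  qed
  finally show "emeasure (tail_law (Suc N) J) A = emeasure (tail_law N J) A" by (simp only: right)
qed

lemma tail_law_eq:
  assumes "J \<subseteq> {..N}" "N \<le> N'"
  shows "tail_law N' J = tail_law N J"
  using assms(2)
proof (induction rule: dec_induct)
  case (step n)
  then show ?case using tail_law_Suc[of J n] assms(1) by fastforce
qed simp

lemma tail_law_restrict:
  assumes "J \<subseteq> H"
  shows "distr (tail_law N H) (PiM J (\<lambda>_. borel)) (\<lambda>\<omega>. restrict \<omega> J) = tail_law N J"
proof -
  have "(\<lambda>\<omega>. restrict \<omega> J) \<circ> tail_map N H = tail_map N J"
    using assms by (auto simp: tail_map_def fun_eq_iff)
  then show ?thesis
    unfolding tail_law_def using assms by (subst distr_distr) (auto intro: measurable_restrict_subset)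
qed

lemma prob_space_tail_law: "prob_space (tail_law N J)"
  unfolding tail_law_def
  by (intro prob_space.prob_space_distr prob_space_PiM borel_probsD(1)[OF tail_noise_in_borel_probs] measurable_tail_map)

text \<open>Kolmogorov extension of the consistent finite models. Only the laws of single
  coordinates and single increments are recorded: almost sure summability of the increments follows
  from their marginal laws.\<close>

lemma tail_process_exists:
  obtains P :: "(nat \<Rightarrow> real ^ 'd) measure" where "prob_space P" "sets P = sets (PiM UNIV (\<lambda>_. borel))"
    "\<And>n. distr P borel (\<lambda>\<omega>. \<omega> n) = \<rho> n" "\<And>n. distr P borel (\<lambda>\<omega>. \<omega> n - \<omega> (Suc n)) = \<eta> n"
proof -
  \<comment> \<open>Inserting 0 keeps \<open>Max\<close> meaningful for the empty index set; by
    consistency any larger bound gives the same law.\<close>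
  define Q where "Q J = tail_law (Max (insert 0 J)) J" for J
  have Q: "Q J = tail_law N J" if "finite J" "J \<subseteq> {..N}" for J N
    unfolding Q_def using that by (intro tail_law_eq[symmetric]) (auto simp: subset_eq)
  interpret polish_projective UNIV Q
    unfolding polish_projective_def projective_family_def
  proof (intro conjI allI impI, goal_cases)
    case that: (1 J H)
    show ?case
    proof -
      have "Q J = tail_law (Max (insert 0 H)) J"
        using that by (intro Q) (auto intro: finite_subset Max_ge)
      then show ?thesis using tail_law_restrict[OF that(1), of "Max (insert 0 H)"] by (simp add: Q_def)
    qed
  next
    case (2 J)
    show ?case unfolding Q_def by (rule prob_space_tail_law)
  qed
  note [measurable_cong] = borel_probsD(3)[OF tail_noise_in_borel_probs]
  have rm: "(\<lambda>\<omega>. restrict \<omega> J) \<in> lim \<rightarrow>\<^sub>M PiM J (\<lambda>_. borel)" for J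
    unfolding measurable_cong_sets[OF sets_lim refl] by (rule measurable_restrict_subset) simp
  have restr: "distr lim (PiM J (\<lambda>_. borel)) (\<lambda>\<omega>. restrict \<omega> J) = Q J" if "finite J" for J
  proof (rule measure_eqI)
    show "sets (distr lim (PiM J (\<lambda>_. borel)) (\<lambda>\<omega>. restrict \<omega> J)) = sets (Q J)" by (simp add: Q_def tail_law_def)
    fix A assume "A \<in> sets (distr lim (PiM J (\<lambda>_. borel)) (\<lambda>\<omega>. restrict \<omega> J))"
    then have A: "A \<in> sets (PiM J (\<lambda>_. borel))" by simp
    have "emeasure (distr lim (PiM J (\<lambda>_. borel)) (\<lambda>\<omega>. restrict \<omega> J)) A = emeasure lim (prod_emb UNIV (\<lambda>_. borel) J A)"
      using A by (subst emeasure_distr) (auto simp: prod_emb_def space_PiM rm)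
    also have "\<dots> = emeasure (Q J) A" using that A by (intro emeasure_lim_emb) auto
    finally show "emeasure (distr lim (PiM J (\<lambda>_. borel)) (\<lambda>\<omega>. restrict \<omega> J)) A = emeasure (Q J) A" .
  qed
  have law: "distr lim borel (\<lambda>\<omega>. g (restrict \<omega> J)) = distr (PiM UNIV (tail_noise N)) borel (\<lambda>v. g (tail_map N J v))"
    if "finite J" "J \<subseteq> {..N}" "g \<in> borel_measurable (PiM J (\<lambda>_. borel))" for J N and g :: "(nat \<Rightarrow> real ^ 'd) \<Rightarrow> real ^ 'd"
  proof -
    have "distr lim borel (\<lambda>\<omega>. g (restrict \<omega> J)) = distr (Q J) borel g"
      using that by (subst restr[symmetric], simp, subst distr_distr) (auto simp: o_def rm)
    also have "\<dots> = distr (PiM UNIV (tail_noise N)) borel (\<lambda>v. g (tail_map N J v))"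
      unfolding Q[OF that(1,2)] tail_law_def using that(3) by (subst distr_distr) (auto simp: o_def)
    finally show ?thesis .
  qed
  have comp: "distr (PiM UNIV (tail_noise N)) borel (\<lambda>v. v n) = tail_noise N n" for N n
    by (rule distr_PiM_coordinate) (rule tail_noise_in_borel_probs)
  show ?thesis
  proof (rule that[of lim])
    show "prob_space lim" by (rule P.prob_space_axioms)
    show "sets lim = sets (PiM UNIV (\<lambda>_. borel))" by simp
    fix n
    have "distr lim borel (\<lambda>\<omega>. \<omega> n) = distr (PiM UNIV (tail_noise n)) borel (\<lambda>v. v n)"
      using law[of "{n}" n "\<lambda>\<omega>. \<omega> n"] by (simp add: tail_map_def)
    then show "distr lim borel (\<lambda>\<omega>. \<omega> n) = \<rho> n" by (simp add: comp tail_noise_def)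
    \<comment> \<open>With horizon \<open>Suc n\<close> the tails at \<open>n\<close> and
      \<open>Suc n\<close> are \<open>v n + v (Suc n)\<close> and \<open>v (Suc n)\<close>, so the
      increment is the coordinate \<open>v n\<close>.\<close>
    have "distr lim borel (\<lambda>\<omega>. \<omega> n - \<omega> (Suc n)) = distr (PiM UNIV (tail_noise (Suc n))) borel (\<lambda>v. v n)"
      using law[of "{n, Suc n}" "Suc n" "\<lambda>\<omega>. \<omega> n - \<omega> (Suc n)"] by (simp add: tail_map_def)
    then show "distr lim borel (\<lambda>\<omega>. \<omega> n - \<omega> (Suc n)) = \<eta> n" by (simp add: comp tail_noise_def)
  qed
qed

end

section \<open>Products of two probability spaces and integer iterates\<close>

lemma distr_pair_add:
  fixes X :: "'a \<Rightarrow> real ^ 'd" and Y :: "'b \<Rightarrow> real ^ 'd"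
  assumes "prob_space M" "prob_space N" and [measurable]: "X \<in> borel_measurable M" "Y \<in> borel_measurable N"
  shows "distr (M \<Otimes>\<^sub>M N) borel (\<lambda>z. X (fst z) + Y (snd z)) = (distr M borel X \<star> distr N borel Y)"
proof -
  interpret Y: prob_space "distr N borel Y" using assms(2) by (rule prob_space.prob_space_distr) simp
  have "distr M borel X \<Otimes>\<^sub>M distr N borel Y = distr (M \<Otimes>\<^sub>M N) (borel \<Otimes>\<^sub>M borel) (\<lambda>(x, y). (X x, Y y))"
    by (rule pair_measure_distr) (auto intro: Y.sigma_finite_measure_axioms)
  then show ?thesis
    unfolding convolution_def by (simp add: distr_distr o_def case_prod_beta)
qed

lemma AE_pair_fst_snd:
  assumes M: "prob_space M" and N: "prob_space N" and P: "AE x in M. P x" and Q: "AE y in N. Q y"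
  shows "AE z in M \<Otimes>\<^sub>M N. P (fst z) \<and> Q (snd z)"
proof -
  interpret M: prob_space M by fact
  interpret N: prob_space N by fact
  have fst: "distr (M \<Otimes>\<^sub>M N) M fst = M"
  proof (rule measure_eqI)
    fix A assume A: "A \<in> sets (distr (M \<Otimes>\<^sub>M N) M fst)"
    then have "emeasure (distr (M \<Otimes>\<^sub>M N) M fst) A = emeasure (M \<Otimes>\<^sub>M N) (A \<times> space N)"
      by (subst emeasure_distr) (auto simp: space_pair_measure dest: sets.sets_into_space intro!: arg_cong[where f = "emeasure (M \<Otimes>\<^sub>M N)"])
    then show "emeasure (distr (M \<Otimes>\<^sub>M N) M fst) A = emeasure M A"
      using A by (simp add: N.emeasure_pair_measure_Times N.emeasure_space_1)
  qed simp
  have "AE x in distr (M \<Otimes>\<^sub>M N) M fst. P x" unfolding fst by (rule P)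
  then have 1: "AE z in M \<Otimes>\<^sub>M N. P (fst z)" by (rule AE_distrD[rotated]) simp
  have snd: "distr (M \<Otimes>\<^sub>M N) N snd = N"
  proof (rule measure_eqI)
    fix A assume A: "A \<in> sets (distr (M \<Otimes>\<^sub>M N) N snd)"
    then have "emeasure (distr (M \<Otimes>\<^sub>M N) N snd) A = emeasure (M \<Otimes>\<^sub>M N) (space M \<times> A)"
      by (subst emeasure_distr) (auto simp: space_pair_measure dest: sets.sets_into_space intro!: arg_cong[where f = "emeasure (M \<Otimes>\<^sub>M N)"])
    then show "emeasure (distr (M \<Otimes>\<^sub>M N) N snd) A = emeasure N A"
      using A by (simp add: N.emeasure_pair_measure_Times M.emeasure_space_1)
  qed simp
  have "AE y in distr (M \<Otimes>\<^sub>M N) N snd. Q y" unfolding snd by (rule Q)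
  then have "AE z in M \<Otimes>\<^sub>M N. Q (snd z)" by (rule AE_distrD[rotated]) simp
  with 1 show ?thesis by eventually_elim simp
qed

lemma distr_distr_linear:
  fixes \<rho> :: "(real ^ 'd) measure" and f g :: "real ^ 'd \<Rightarrow> real ^ 'd"
  assumes "\<rho> \<in> borel_probs" "linear f" "linear g"
  shows "distr (distr \<rho> borel f) borel g = distr \<rho> borel (\<lambda>v. g (f v))"
  using measurable_linear[OF assms(2)] measurable_linear[OF assms(3)]
  by (simp add: distr_distr o_def measurable_cong_sets[OF borel_probsD(3)[OF assms(1)] refl])

lemma linear_int_iterate:
  fixes f :: "real ^ 'd \<Rightarrow> real ^ 'd"
  assumes f: "linear f" and b: "bij f"
  shows "linear (int_iterate f k)"
proof -
  have "linear (inv f)" using f b by (simp add: bij_is_inj inj_linear_imp_inv_linear)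
  then show ?thesis using f by (simp add: int_iterate_def linear_funpow)
qed

text \<open>Covers negative \<open>k\<close> as well; it translates the past of time
  \<open>k\<close>, reached by \<open>N\<close> steps, into index \<open>N - k\<close> of the tail
  process, which is anchored at time 0.\<close>

lemma int_iterate_funpow:
  assumes b: "bij f" and k: "k \<le> int N"
  shows "int_iterate f k ((f ^^ nat (int N - k)) v) = (f ^^ N) v"
proof (cases "0 \<le> k")
  case True
  then have "N = nat k + nat (int N - k)" using k by simp
  then have "(f ^^ N) v = (f ^^ nat k) ((f ^^ nat (int N - k)) v)" by (metis funpow_add comp_apply)
  then show ?thesis using True by (simp add: int_iterate_def)
next
  case False
  then have "nat (int N - k) = nat (- k) + N" by simp
  then have "(f ^^ nat (int N - k)) v = (f ^^ nat (- k)) ((f ^^ N) v)" by (simp add: funpow_add)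
  moreover have "(inv f ^^ n) ((f ^^ n) u) = u" for n u
    using inv_fn_o_fn_is_id[OF b, of n] by (metis comp_apply)
  ultimately show ?thesis using False by (simp add: int_iterate_def)
qed

lemma AE_summable_norm_if_trunc_sum_finite:
  fixes e :: "nat \<Rightarrow> 'a \<Rightarrow> 'b :: {banach, second_countable_topology}"
  assumes [measurable]: "\<And>n. e n \<in> borel_measurable M"
    and fin: "(\<Sum>n. \<integral>\<^sup>+\<omega>. ennreal (min 1 (norm (e n \<omega>))) \<partial>M) < \<infinity>"
  shows "AE \<omega> in M. summable (\<lambda>n. norm (e n \<omega>))"
proof -
  have "(\<integral>\<^sup>+\<omega>. (\<Sum>n. ennreal (min 1 (norm (e n \<omega>)))) \<partial>M) \<noteq> \<infinity>"
    using fin by (simp add: nn_integral_suminf)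
  then have "AE \<omega> in M. (\<Sum>n. ennreal (min 1 (norm (e n \<omega>)))) \<noteq> \<infinity>"
    by (intro nn_integral_noteq_infinite) measurable
  then show ?thesis
  proof eventually_elim
    case (elim \<omega>)
    then have "(\<integral>\<^sup>+n. ennreal (min 1 (norm (e n \<omega>))) \<partial>count_space UNIV) < \<infinity>"
      by (simp add: nn_integral_count_space_nat top.not_eq_extremum)
    then have "(\<integral>\<^sup>+n. ennreal (norm (e n \<omega>)) \<partial>count_space UNIV) < \<infinity>"
      by (rule nn_integral_finite_if_truncated_finite[rotated]) simp
    then show ?case
      by (intro summable_suminf_not_top) (auto simp: nn_integral_count_space_nat)
  qed
qed

text \<open>Split at norm 1: smaller values contribute a geometric term by contraction, larger ones
  are dominated by the truncated moment, which equals 1 there. Each noise time occurs with a single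
  power of \<open>f\<close>, so the truncated cost suffices.\<close>

lemma sum_min_norm_funpow_finite:
  fixes m :: "int \<Rightarrow> (real ^ 'd) measure"
  assumes m: "\<And>i. m i \<in> borel_probs" and f: "linear f" and p: "0 \<le> p"
    and mC: "\<And>k. AE v in m k. v \<in> contraction_subspace f" and mt: "trunc_cost p m < \<infinity>"
  shows "(\<Sum>n. \<integral>\<^sup>+v. ennreal (min 1 (norm ((f ^^ n) v))) \<partial>m (- int n)) < \<infinity>"
proof -
  note [measurable_cong] = borel_probsD(3)[OF m]
  obtain a K where a: "0 < a" "a < 1" and K: "1 \<le> K"
    and bd: "\<And>v n. (\<lambda>n. (f ^^ n) v) \<longlonglongrightarrow> 0 \<Longrightarrow> norm ((f ^^ n) v) \<le> K * a ^ n * norm v"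
  proof (rule contraction_bound[OF f], goal_cases)
    case (1 K a)
    show ?case by (rule 1(1)[OF 1(2-)])
  qed
  have "(\<Sum>n. \<integral>\<^sup>+v. ennreal (min 1 (norm ((f ^^ n) v))) \<partial>m (- int n)) \<le>
      (\<Sum>n. ennreal (K * a ^ n) + trunc_moment p (m (- int n)))"
  proof (intro suminf_le)
    fix n
    have "(\<integral>\<^sup>+v. ennreal (min 1 (norm ((f ^^ n) v))) \<partial>m (- int n)) \<le>
        (\<integral>\<^sup>+v. ennreal (K * a ^ n) + ennreal (min 1 (norm v powr p)) \<partial>m (- int n))"
    proof (rule nn_integral_mono_AE)
      show "AE v in m (- int n). ennreal (min 1 (norm ((f ^^ n) v))) \<le> ennreal (K * a ^ n) + ennreal (min 1 (norm v powr p))"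
        using mC[of "- int n"]
      proof eventually_elim
        case (elim v)
        have "min 1 (norm ((f ^^ n) v)) \<le> K * a ^ n + min 1 (norm v powr p)"
        proof (cases "norm v \<le> 1")
          case True
          have "norm ((f ^^ n) v) \<le> K * a ^ n * norm v" using elim bd by (simp add: contraction_subspace_def)
          also have "\<dots> \<le> K * a ^ n" using True K a by (intro mult_left_le) auto
          finally show ?thesis by (simp add: add_increasing2 min.coboundedI2)
        next
          case False
          then have "1 \<le> norm v powr p" using p by (intro ge_one_powr_ge_zero) auto
          moreover have "0 \<le> K * a ^ n" using K a by simp
          ultimately show ?thesis by simp
        qed
        then show ?case using K a by (simp add: ennreal_plus[symmetric] ennreal_leI del: ennreal_plus)
      qed
    qed
    also have "\<dots> = ennreal (K * a ^ n) + trunc_moment p (m (- int n))"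
      by (simp add: nn_integral_add prob_space.emeasure_space_1[OF borel_probsD(1)[OF m]])
    finally show "(\<integral>\<^sup>+v. ennreal (min 1 (norm ((f ^^ n) v))) \<partial>m (- int n)) \<le>
        ennreal (K * a ^ n) + trunc_moment p (m (- int n))" .
  qed auto
  also have "\<dots> = (\<Sum>n. ennreal (K * a ^ n)) + (\<Sum>n. trunc_moment p (m (- int n)))"
    by (rule suminf_add[symmetric]) auto
  also have "(\<Sum>n. ennreal (K * a ^ n)) = ennreal (\<Sum>n. K * a ^ n)"
    using K a by (intro suminf_ennreal2 summable_mult summable_geometric) auto
  also have "(\<Sum>n. trunc_moment p (m (- int n))) \<le> trunc_cost p m"
  proof (rule suminf_le_const)
    fix N
    have "(\<Sum>n<N. trunc_moment p (m (- int n))) =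
        (\<Sum>j\<in>(\<lambda>n. - int n) ` {..<N}. trunc_moment p (m j))"
      by (subst sum.reindex) (auto simp: inj_on_def)
    also have "\<dots> \<le> trunc_cost p m"
      unfolding total_cost_def by (rule sum_le_nn_integral_count_space) simp
    finally show "(\<Sum>n<N. trunc_moment p (m (- int n))) \<le> trunc_cost p m" .
  qed auto
  finally show ?thesis using mt by (simp add: add_left_mono order_le_less_trans)
qed

text \<open>On a product space the noise and the tail process are independent, so unrolling
  \<open>N\<close> steps exhibits \<open>l k\<close> as the law of \<open>X N\<close> for every
  \<open>N \<ge> k\<close>. These laws are constant in \<open>N\<close> while \<open>X N\<close>
  converges almost surely, hence \<open>l k\<close> is also the law of the limit. The limit
  \<open>D\<close> is the contribution of the infinitely remote past, transported to time 0.\<close>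

lemma solution_eq_orbit_limit_convolution:
  fixes m l :: "int \<Rightarrow> (real ^ 'd) measure"
  assumes m: "\<And>i. m i \<in> borel_probs" and f: "linear f" and b: "bij f" and p: "1 \<le> p"
    and mC: "\<And>k. AE v in m k. v \<in> contraction_subspace f" and mt: "trunc_cost p m < \<infinity>"
    and l: "\<And>i. l i \<in> borel_probs" and rec: "\<And>k. l k = (m k \<star> distr (l (k - 1)) borel f)"
  obtains \<nu> where "\<nu> \<in> borel_probs"
    "\<And>k. l k = (distr (PiM UNIV m) borel (\<lambda>w. orbit_limit f w k) \<star> distr \<nu> borel (int_iterate f k))"
proof -
  have fn: "linear (f ^^ n)" for n by (rule linear_funpow[OF f])
  have it: "linear (int_iterate f k)" for k by (rule linear_int_iterate[OF f b])
  note [measurable] = measurable_linear[OF it] measurable_linear[OF fn]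
  interpret \<Omega>: prob_space "PiM UNIV m" by (intro prob_space_PiM borel_probsD(1) m)
  define \<rho> where "\<rho> n = distr (l (- int n)) borel (f ^^ n)" for n
  define \<eta> where "\<eta> n = distr (m (- int n)) borel (f ^^ n)" for n
  have \<rho>: "\<rho> n \<in> borel_probs" for n unfolding \<rho>_def by (intro distr_linear_in_borel_probs l fn)
  have \<eta>: "\<eta> n \<in> borel_probs" for n unfolding \<eta>_def by (intro distr_linear_in_borel_probs m fn)
  have "\<rho> n = (\<eta> n \<star> \<rho> (Suc n))" for n
  proof -
    have "\<rho> n = distr (m (- int n) \<star> distr (l (- int n - 1)) borel f) borel (f ^^ n)"
      unfolding \<rho>_def by (subst rec) (rule refl)
    also have "\<dots> = (\<eta> n \<star> distr (distr (l (- int n - 1)) borel f) borel (f ^^ n))"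
      unfolding \<eta>_def by (intro distr_convolution m distr_linear_in_borel_probs l f fn)
    also have "distr (distr (l (- int n - 1)) borel f) borel (f ^^ n) = \<rho> (Suc n)"
    proof -
      have "- int n - 1 = - int (Suc n)" by simp
      then show ?thesis by (simp only: distr_distr_linear[OF l f fn] \<rho>_def funpow_Suc_right o_def)
    qed
    finally show ?thesis .
  qed
  note \<rho>_rec = this
  obtain P :: "(nat \<Rightarrow> real ^ 'd) measure" where P: "prob_space P" and setsP: "sets P = sets (PiM UNIV (\<lambda>_. borel))"
    and law: "\<And>n. distr P borel (\<lambda>\<omega>. \<omega> n) = \<rho> n"
    and inc: "\<And>n. distr P borel (\<lambda>\<omega>. \<omega> n - \<omega> (Suc n)) = \<eta> n"
  proof (rule tail_process_exists[where \<rho> = \<rho> and \<eta> = \<eta>, OF \<rho> \<eta> \<rho>_rec], goal_cases)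
    case (1 P)
    show ?case by (rule 1(1)[OF 1(2-)])
  qed
  interpret PP: prob_space P by (rule P)
  note [measurable_cong] = setsP
  have coord[measurable]: "(\<lambda>\<omega>. \<omega> n) \<in> borel_measurable P" for n by measurable
  define e where "e n \<omega> = \<omega> n - \<omega> (Suc n)" for n and \<omega> :: "nat \<Rightarrow> real ^ 'd"
  have e[measurable]: "e n \<in> borel_measurable P" for n unfolding e_def by measurable
  have "AE \<omega> in P. summable (\<lambda>n. norm (e n \<omega>))"
  proof (rule AE_summable_norm_if_trunc_sum_finite[OF e])
    have "(\<integral>\<^sup>+\<omega>. ennreal (min 1 (norm (e n \<omega>))) \<partial>P) = (\<integral>\<^sup>+v. ennreal (min 1 (norm ((f ^^ n) v))) \<partial>m (- int n))" for n
    proof -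
      have "(\<integral>\<^sup>+\<omega>. ennreal (min 1 (norm (e n \<omega>))) \<partial>P) = (\<integral>\<^sup>+v. ennreal (min 1 (norm v)) \<partial>\<eta> n)"
        unfolding inc[symmetric] e_def by (subst nn_integral_distr) auto
      also have "\<dots> = (\<integral>\<^sup>+v. ennreal (min 1 (norm ((f ^^ n) v))) \<partial>m (- int n))"
        unfolding \<eta>_def by (subst nn_integral_distr) (auto simp: measurable_cong_sets[OF borel_probsD(3)[OF m] refl])
      finally show ?thesis .
    qed
    then show "(\<Sum>n. \<integral>\<^sup>+\<omega>. ennreal (min 1 (norm (e n \<omega>))) \<partial>P) < \<infinity>"
      using sum_min_norm_funpow_finite[where m = m and f = f and p = p, OF m f _ mC mt] p by simp
  qed
  define D where "D \<omega> = \<omega> 0 - (\<Sum>n. e n \<omega>)" for \<omega>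
  have D[measurable]: "D \<in> borel_measurable P" unfolding D_def by measurable
  have D_lim: "AE \<omega> in P. (\<lambda>n. \<omega> n) \<longlonglongrightarrow> D \<omega>"
    using \<open>AE \<omega> in P. summable (\<lambda>n. norm (e n \<omega>))\<close>
  proof eventually_elim
    case (elim \<omega>)
    have eq: "\<omega> 0 - (\<Sum>i<n. e i \<omega>) = \<omega> n" for n by (simp add: e_def sum_lessThan_telescope')
    have "(\<lambda>n. \<omega> 0 - (\<Sum>i<n. e i \<omega>)) \<longlonglongrightarrow> D \<omega>"
      unfolding D_def by (intro tendsto_intros summable_LIMSEQ summable_norm_cancel[OF elim])
    then show ?case unfolding eq .
  qed
  define \<nu> where "\<nu> = distr P borel D"
  have \<nu>: "\<nu> \<in> borel_probs" unfolding \<nu>_def by (intro distr_in_borel_probs P D)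
  have "l k = (distr (PiM UNIV m) borel (\<lambda>w. orbit_limit f w k) \<star> distr \<nu> borel (int_iterate f k))" for k
  proof -
    let ?M = "PiM UNIV m \<Otimes>\<^sub>M P"
    interpret pair_prob_space "PiM UNIV m" P ..
    \<comment> \<open>The state at time \<open>k - N\<close> sits at index \<open>N - k\<close> of
      the tail process, already carried by \<open>f\<close> to time 0;
      \<open>int_iterate f k\<close> carries it on to time \<open>k\<close>.\<close>
    define X where "X N z = orbit_sum f (fst z) k N + int_iterate f k (snd z (nat (int N - k)))"
      for N :: nat and z :: "(int \<Rightarrow> real ^ 'd) \<times> (nat \<Rightarrow> real ^ 'd)"
    define Y where "Y z = orbit_limit f (fst z) k + int_iterate f k (D (snd z))"
      for z :: "(int \<Rightarrow> real ^ 'd) \<times> (nat \<Rightarrow> real ^ 'd)"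
    note [measurable] = measurable_orbit_sum[where m = m, OF m f] measurable_orbit_limit[where m = m, OF m f]
    have itc: "(\<lambda>\<omega>. int_iterate f k (\<omega> n)) \<in> borel_measurable P" for n by measurable
    have itD: "(\<lambda>\<omega>. int_iterate f k (D \<omega>)) \<in> borel_measurable P" by measurable
    have "distr ?M borel Y = l k"
    proof (rule distr_AE_limit_eq)
      show "prob_space ?M" by (rule P.prob_space_axioms)
      show "X N \<in> borel_measurable ?M" for N unfolding X_def by measurable
      show "Y \<in> borel_measurable ?M" unfolding Y_def by measurable
      have "AE z in ?M. (\<forall>k. (\<lambda>n. (f ^^ n) (fst z (k - int n))) sums orbit_limit f (fst z) k) \<and> (\<lambda>n. snd z n) \<longlonglongrightarrow> D (snd z)"
        by (rule AE_pair_fst_snd[where P = "\<lambda>w. \<forall>k. (\<lambda>n. (f ^^ n) (w (k - int n))) sums orbit_limit f w k"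
              and Q = "\<lambda>\<omega>. (\<lambda>n. \<omega> n) \<longlonglongrightarrow> D \<omega>",
              OF \<Omega>.prob_space_axioms P AE_orbit_sums[where m = m and f = f and p = p, OF m f p mC mt] D_lim])
      then show "AE z in ?M. (\<lambda>N. X N z) \<longlonglongrightarrow> Y z"
      proof eventually_elim
        case (elim z)
        have "(\<lambda>N. orbit_sum f (fst z) k N) \<longlonglongrightarrow> orbit_limit f (fst z) k"
          using elim[THEN conjunct1, rule_format, of k] unfolding sums_def orbit_sum_def .
        moreover have filt: "filterlim (\<lambda>N. nat (int N - k)) sequentially sequentially"
        proof (rule filterlim_at_top_mono)
          show "filterlim (\<lambda>N. N - nat \<bar>k\<bar>) sequentially sequentially" by (rule filterlim_minus_const_nat_at_top)
          show "\<forall>\<^sub>F N in sequentially. N - nat \<bar>k\<bar> \<le> nat (int N - k)" by (intro always_eventually allI) linarith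
        qed
        have "(\<lambda>N. snd z (nat (int N - k))) \<longlonglongrightarrow> D (snd z)"
          by (rule filterlim_compose[OF elim[THEN conjunct2] filt])
        then have "(\<lambda>N. int_iterate f k (snd z (nat (int N - k)))) \<longlonglongrightarrow> int_iterate f k (D (snd z))"
          by (rule bounded_linear.tendsto[OF it[of k, unfolded linear_conv_bounded_linear]])
        ultimately show ?case unfolding X_def Y_def by (intro tendsto_add)
      qed
      have "distr ?M borel (X N) = l k" if N: "k \<le> int N" for N
      proof -
        have "distr ?M borel (X N) = (distr (PiM UNIV m) borel (\<lambda>w. orbit_sum f w k N) \<star>
            distr P borel (\<lambda>\<omega>. int_iterate f k (\<omega> (nat (int N - k)))))"
          unfolding X_def
          by (rule distr_pair_add[where X = "\<lambda>w. orbit_sum f w k N", OF \<Omega>.prob_space_axioms P _ itc]) measurable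
        also have "distr P borel (\<lambda>\<omega>. int_iterate f k (\<omega> (nat (int N - k)))) =
            distr (\<rho> (nat (int N - k))) borel (int_iterate f k)"
          unfolding law[symmetric] by (subst distr_distr) (auto simp: o_def)
        also have "\<dots> = distr (l (k - int N)) borel (f ^^ N)"
          using N by (simp add: \<rho>_def distr_distr_linear[OF l fn it] int_iterate_funpow[OF b N])
        also have "(distr (PiM UNIV m) borel (\<lambda>w. orbit_sum f w k N) \<star> \<dots>) = l k"
          by (rule convolution_recursion_unroll[where m = m and l = l and f = f, OF m f l rec, symmetric])
        finally show ?thesis .
      qed
      then show "\<forall>\<^sub>F N in sequentially. distr ?M borel (X N) = l k"
        by (intro eventually_sequentiallyI[of "nat k"]) simp
    qed
    also have "distr ?M borel Y = (distr (PiM UNIV m) borel (\<lambda>w. orbit_limit f w k) \<star> distr P borel (\<lambda>\<omega>. int_iterate f k (D \<omega>)))"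
      unfolding Y_def
      by (rule distr_pair_add[where X = "\<lambda>w. orbit_limit f w k", OF \<Omega>.prob_space_axioms P _ itD]) measurable
    also have "distr P borel (\<lambda>\<omega>. int_iterate f k (D \<omega>)) = distr \<nu> borel (int_iterate f k)"
      unfolding \<nu>_def by (subst distr_distr) (auto simp: o_def)
    finally show ?thesis by simp
  qed
  with \<nu> show ?thesis by (rule that)
qed

section \<open>The equivalence\<close>

lemma convolution_return_eq_distr:
  fixes M :: "(real ^ 'd) measure"
  assumes M: "M \<in> borel_probs"
  shows "(M \<star> return borel a) = distr M borel (\<lambda>v. v + a)"
proof (rule borel_probs_eqI)
  note [measurable_cong] = borel_probsD(3)[OF M]
  show "(M \<star> return borel a) \<in> borel_probs" by (intro convolution_in_borel_probs return_in_borel_probs M)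
  show "distr M borel (\<lambda>v. v + a) \<in> borel_probs"
    by (intro distr_in_borel_probs borel_probsD(1)[OF M]) measurable
  show "(\<integral>\<^sup>+v. h v \<partial>(M \<star> return borel a)) = (\<integral>\<^sup>+v. h v \<partial>distr M borel (\<lambda>v. v + a))"
    if [measurable]: "h \<in> borel_measurable borel" for h :: "real ^ 'd \<Rightarrow> ennreal"
    by (simp add: nn_integral_convolution_return[OF M] nn_integral_distr)
qed

lemma convolution_return_return:
  fixes M :: "(real ^ 'd) measure"
  assumes M: "M \<in> borel_probs"
  shows "((M \<star> return borel a) \<star> return borel b) = (M \<star> return borel (a + b))"
proof -
  note [measurable_cong] = borel_probsD(3)[OF M]
  have "(M \<star> return borel a) \<in> borel_probs" by (intro convolution_in_borel_probs return_in_borel_probs M)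
  then have "((M \<star> return borel a) \<star> return borel b) = distr (distr M borel (\<lambda>v. v + a)) borel (\<lambda>v. v + b)"
    by (simp only: convolution_return_eq_distr) (simp only: convolution_return_eq_distr[OF M])
  also have "\<dots> = distr M borel (\<lambda>v. v + (a + b))"
    by (subst distr_distr) (auto simp: o_def add.assoc)
  finally show ?thesis by (simp only: convolution_return_eq_distr[OF M])
qed

lemma convolution_return_0:
  fixes M :: "(real ^ 'd) measure"
  assumes M: "M \<in> borel_probs"
  shows "(M \<star> return borel 0) = M"
  using distr_id2[of borel M] by (simp add: convolution_return_eq_distr[OF M] borel_probsD(3)[OF M])

lemma convolution_convolution_return:
  fixes M N :: "(real ^ 'd) measure"
  assumes M: "M \<in> borel_probs" and N: "N \<in> borel_probs"
  shows "((M \<star> return borel a) \<star> (N \<star> return borel b)) = ((M \<star> N) \<star> return borel (a + b))"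
proof (rule borel_probs_eqI)
  let ?A = "M \<star> return borel a" and ?B = "N \<star> return borel b"
  have A: "?A \<in> borel_probs" and B: "?B \<in> borel_probs" and MN: "(M \<star> N) \<in> borel_probs"
    by (intro convolution_in_borel_probs return_in_borel_probs M N)+
  show "(?A \<star> ?B) \<in> borel_probs" "((M \<star> N) \<star> return borel (a + b)) \<in> borel_probs"
    by (intro convolution_in_borel_probs return_in_borel_probs M N)+
  fix h :: "real ^ 'd \<Rightarrow> ennreal" assume [measurable]: "h \<in> borel_measurable borel"
  note [measurable_cong] = borel_probsD(3)[OF N] borel_probsD(3)[OF M]
  have [measurable]: "(\<lambda>u. \<integral>\<^sup>+v. h (u + (v + b)) \<partial>N) \<in> borel_measurable borel"
    using borel_probsD[OF N] by (intro sigma_finite_measure.borel_measurable_nn_integral)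
      (auto intro: prob_space_imp_sigma_finite)
  have "(\<integral>\<^sup>+v. h v \<partial>(?A \<star> ?B)) = (\<integral>\<^sup>+u. \<integral>\<^sup>+v. h (u + v) \<partial>?B \<partial>?A)"
    using borel_probsD[OF A] borel_probsD[OF B] by (intro nn_integral_convolution) auto
  also have "\<dots> = (\<integral>\<^sup>+u. \<integral>\<^sup>+v. h (u + (v + b)) \<partial>N \<partial>?A)"
    by (intro nn_integral_cong nn_integral_convolution_return[OF N, of "\<lambda>v. h (_ + v)"]) measurable
  also have "\<dots> = (\<integral>\<^sup>+u. \<integral>\<^sup>+v. h (u + a + (v + b)) \<partial>N \<partial>M)"
    by (rule nn_integral_convolution_return[OF M]) measurable
  also have "\<dots> = (\<integral>\<^sup>+u. \<integral>\<^sup>+v. h (u + v + (a + b)) \<partial>N \<partial>M)"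
    by (simp add: ac_simps)
  also have "\<dots> = (\<integral>\<^sup>+v. h (v + (a + b)) \<partial>(M \<star> N))"
    using borel_probsD[OF M] borel_probsD[OF N] by (intro nn_integral_convolution[symmetric]) auto
  also have "\<dots> = (\<integral>\<^sup>+v. h v \<partial>((M \<star> N) \<star> return borel (a + b)))"
    by (rule nn_integral_convolution_return[OF MN, symmetric]) measurable
  finally show "(\<integral>\<^sup>+v. h v \<partial>(?A \<star> ?B)) = (\<integral>\<^sup>+v. h v \<partial>((M \<star> N) \<star> return borel (a + b)))" .
qed

lemma distr_convolution_return:
  fixes M :: "(real ^ 'd) measure" and f :: "real ^ 'd \<Rightarrow> real ^ 'd"
  assumes M: "M \<in> borel_probs" and f: "linear f"
  shows "distr (M \<star> return borel a) borel f = (distr M borel f \<star> return borel (f a))"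
  using distr_convolution[OF M return_in_borel_probs f, of a] measurable_linear[OF f]
  by (simp add: distr_return)

lemma shifted_recursion:
  fixes m l :: "int \<Rightarrow> (real ^ 'd) measure"
  assumes m: "\<And>i. m i \<in> borel_probs" and f: "linear f" and l: "\<And>i. l i \<in> borel_probs"
    and rec: "\<And>k. l k = (m k \<star> distr (l (k - 1)) borel f)"
    and y: "\<And>k. y k = x k + f (y (k - 1))"
  shows "(l k \<star> return borel (y k)) =
    ((m k \<star> return borel (x k)) \<star> distr (l (k - 1) \<star> return borel (y (k - 1))) borel f)"
proof -
  have "((m k \<star> return borel (x k)) \<star> distr (l (k - 1) \<star> return borel (y (k - 1))) borel f) =
      ((m k \<star> distr (l (k - 1)) borel f) \<star> return borel (x k + f (y (k - 1))))"
    unfolding distr_convolution_return[OF l f]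
    by (rule convolution_convolution_return[OF m distr_linear_in_borel_probs[OF l f]])
  also have "\<dots> = (l k \<star> return borel (y k))"
    using rec[of k] y[of k] by simp
  finally show ?thesis by simp
qed

lemma lp_seqs_add:
  assumes u: "u \<in> lp_seqs p" and v: "v \<in> lp_seqs p" and p: "0 \<le> p"
  shows "(\<lambda>k. u k + v k) \<in> lp_seqs p"
proof -
  have "(\<integral>\<^sup>+k. ennreal (norm (u k + v k) powr p) \<partial>count_space UNIV) \<le>
      (\<integral>\<^sup>+k. ennreal (2 powr p) * (ennreal (norm (u k) powr p) + ennreal (norm (v k) powr p)) \<partial>count_space UNIV)"
  proof (rule nn_integral_mono)
    fix k
    have "norm (u k + v k) powr p \<le> (norm (u k) + norm (v k)) powr p"
      using p by (intro powr_mono2 norm_triangle_ineq) auto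
    also have "\<dots> \<le> 2 powr p * (norm (u k) powr p + norm (v k) powr p)"
      using p by (intro powr_add_le) auto
    finally show "ennreal (norm (u k + v k) powr p) \<le> ennreal (2 powr p) * (ennreal (norm (u k) powr p) + ennreal (norm (v k) powr p))"
      by (simp add: ennreal_mult[symmetric] ennreal_plus[symmetric] ennreal_leI del: ennreal_plus)
  qed
  also have "\<dots> < \<infinity>" using u v
    by (simp add: nn_integral_cmult nn_integral_add lp_seqs_iff ennreal_mult_less_top)
  finally show ?thesis by (simp add: lp_seqs_iff)
qed

lemma lp_seqs_uminus: "u \<in> lp_seqs p \<Longrightarrow> (\<lambda>k. - u k) \<in> lp_seqs p"
  by (simp add: lp_seqs_def)

lemma lp_seqs_linear_shift:
  fixes f :: "real ^ 'd \<Rightarrow> real ^ 'd"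
  assumes u: "u \<in> lp_seqs p" and f: "linear f" and p: "0 \<le> p"
  shows "(\<lambda>k. f (u (k - 1))) \<in> lp_seqs p"
proof -
  obtain B where B: "B > 0" "\<And>v. norm (f v) \<le> B * norm v" using linear_bounded_pos[OF f] by blast
  have "(\<integral>\<^sup>+k. ennreal (norm (f (u (k - 1))) powr p) \<partial>count_space UNIV) \<le>
      (\<integral>\<^sup>+k. ennreal (B powr p) * ennreal (norm (u (k - 1)) powr p) \<partial>count_space UNIV)"
  proof (rule nn_integral_mono)
    fix k
    have "norm (f (u (k - 1))) powr p \<le> (B * norm (u (k - 1))) powr p" using B p by (intro powr_mono2) auto
    then show "ennreal (norm (f (u (k - 1))) powr p) \<le> ennreal (B powr p) * ennreal (norm (u (k - 1)) powr p)"
      using B by (simp add: powr_mult ennreal_mult[symmetric] ennreal_leI)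
  qed
  also have "\<dots> = ennreal (B powr p) * (\<integral>\<^sup>+k. ennreal (norm (u (k - 1)) powr p) \<partial>count_space UNIV)"
    by (simp add: nn_integral_cmult)
  also have "(\<integral>\<^sup>+k. ennreal (norm (u (k - 1)) powr p) \<partial>count_space UNIV) = (\<integral>\<^sup>+k. ennreal (norm (u k) powr p) \<partial>count_space UNIV)"
    by (rule nn_integral_bij_count_space[where g = "\<lambda>k. k - 1"]) (auto intro: bij_betwI[where g = "\<lambda>k. k + 1"])
  also have "ennreal (B powr p) * \<dots> < \<infinity>" using u by (simp add: lp_seqs_iff ennreal_mult_less_top)
  finally show ?thesis by (simp add: lp_seqs_iff)
qed

text \<open>The value at time 0 is free and taken to be 0; the recursion determines the future, and
  the inverse of \<open>f\<close> the past.\<close>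

lemma affine_recursion_solvable:
  fixes f :: "'a :: ab_group_add \<Rightarrow> 'a"
  assumes b: "bij f"
  shows "\<exists>y. \<forall>k :: int. y k = x k + f (y (k - 1))"
proof -
  define pos where "pos = rec_nat 0 (\<lambda>n v. x (int (Suc n)) + f v)"
  define neg where "neg = rec_nat 0 (\<lambda>n v. inv f (v - x (- int n)))"
  define y where "y k = (if 0 \<le> k then pos (nat k) else neg (nat (- k)))" for k :: int
  have ff: "f (inv f v) = v" for v using b by (simp add: bij_is_surj surj_f_inv_f)
  have y_neg: "y (- int n) = neg n" for n by (cases n) (auto simp: y_def pos_def neg_def simp del: of_nat_Suc)
  have "y k = x k + f (y (k - 1))" for k
  proof (cases "0 < k")
    case True
    then have "k = int (Suc (nat k - 1))" by simp
    then obtain n where n: "k = int (Suc n)" ..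
    have "y k = pos (Suc n)" "y (k - 1) = pos n" by (auto simp: y_def n nat_add_distrib)
    then show ?thesis by (simp add: pos_def n)
  next
    case False
    then have "k = - int (nat (- k))" by simp
    then obtain n where n: "k = - int n" ..
    have k1: "k - 1 = - int (Suc n)" by (simp add: n)
    have "y k = neg n" "y (k - 1) = neg (Suc n)" unfolding n k1[unfolded n] y_neg by simp_all
    then show ?thesis by (simp add: neg_def ff n)
  qed
  then show ?thesis by blast
qed

lemma supported_on_cosets_iff:
  fixes \<mu> :: "int \<Rightarrow> (real ^ 'd) measure"
  assumes \<mu>: "\<And>k. \<mu> k \<in> borel_probs" and f: "linear f"
  shows "supported_on_cosets \<mu> f x \<longleftrightarrow> (\<forall>k. AE v in (\<mu> k \<star> return borel (x k)). v \<in> contraction_subspace f)"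
proof -
  have "(v \<in> (\<lambda>c. c - x k) ` contraction_subspace f) = (v + x k \<in> contraction_subspace f)" for v k
    by (auto simp: image_iff intro!: bexI[of _ "v + x k"])
  moreover have "(AE v in (\<mu> k \<star> return borel (x k)). v \<in> contraction_subspace f) \<longleftrightarrow> (AE v in \<mu> k. v + x k \<in> contraction_subspace f)" for k
    unfolding convolution_return_eq_distr[OF \<mu>]
    using sets_contraction_subspace[OF f]
    by (subst AE_distr_iff) (auto simp: measurable_cong_sets[OF borel_probsD(3)[OF \<mu>] refl])
  ultimately show ?thesis by (simp add: supported_on_cosets_def supported_on_def)
qed

text \<open>The noise translated by \<open>x\<close> lives in the contraction subspace and keeps
  finite costs, so the orbit limits have laws of finite truncated cost. Translating these by
  \<open>- y k\<close> returns to the original noise, and since translations pass through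
  convolutions, the fundamental property is inherited.\<close>

lemma fundamental_solution_exists:
  fixes \<mu> :: "int \<Rightarrow> (real ^ 'd) measure" and f :: "real ^ 'd \<Rightarrow> real ^ 'd"
  assumes p: "1 \<le> p" and \<mu>: "\<And>k. \<mu> k \<in> borel_probs" and \<mu>t: "trunc_cost p \<mu> < \<infinity>"
    and f: "linear f" and b: "bij f" and x: "x \<in> lp_seqs p"
    and supp: "supported_on_cosets \<mu> f x" and lm: "log_moment p \<mu> < \<infinity>"
  shows "\<exists>l. fundamental_solution \<mu> f l \<and> lp_paths_after_shift p f x l"
proof -
  have p0: "0 \<le> p" using p by simp
  define m where "m k = (\<mu> k \<star> return borel (x k))" for k
  have m: "m k \<in> borel_probs" for k unfolding m_def by (intro convolution_in_borel_probs return_in_borel_probs \<mu>)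
  have mC: "AE v in m k. v \<in> contraction_subspace f" for k
    using supp unfolding supported_on_cosets_iff[where \<mu> = \<mu>, OF \<mu> f] m_def by blast
  have mt: "trunc_cost p m < \<infinity>"
    unfolding m_def by (rule total_cost_shift_finite[where \<rho> = \<mu>, OF cost_function_min p0 \<mu> x \<mu>t])
  have "log_cost p \<mu> < \<infinity>" by (rule log_cost_finite_if_log_moment_finite[where \<rho> = \<mu>, OF \<mu> p \<mu>t lm])
  then have ml: "log_cost p m < \<infinity>"
    unfolding m_def by (rule total_cost_shift_finite[where \<rho> = \<mu>, OF cost_function_ln p0 \<mu> x])
  define L where "L k = distr (PiM UNIV m) borel (\<lambda>w. orbit_limit f w k)" for k
  have L: "L k \<in> borel_probs" for k
    unfolding L_def by (rule orbit_limit_law_in_borel_probs[where m = m and f = f, OF m f p mC mt])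
  have Lrec: "L k = (m k \<star> distr (L (k - 1)) borel f)" for k
    unfolding L_def by (rule orbit_limit_law_recursion[where m = m and f = f, OF m f p mC mt])
  have Lt: "trunc_cost p L < \<infinity>"
    unfolding L_def by (rule orbit_limit_trunc_cost_finite[where m = m and f = f, OF m f p mC mt ml])
  from affine_recursion_solvable[OF b, of x] obtain y where "\<forall>k. y k = x k + f (y (k - 1))" ..
  note y = this[rule_format]
  \<comment> \<open>The negatives solve the recursion for \<open>- x\<close>, so
    \<open>shifted_recursion\<close> also undoes the translation.\<close>
  have ny: "- y k = - x k + f (- y (k - 1))" for k
    using y[of k] by (simp add: linear_neg[OF f])
  define l where "l k = (L k \<star> return borel (- y k))" for k
  have l: "l k \<in> borel_probs" for k unfolding l_def by (intro convolution_in_borel_probs return_in_borel_probs L)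
  have \<mu>_eq: "(m k \<star> return borel (- x k)) = \<mu> k" for k
    unfolding m_def by (simp add: convolution_return_return[OF \<mu>] convolution_return_0[OF \<mu>])
  have lL: "(l k \<star> return borel (y k)) = L k" for k
    unfolding l_def by (simp add: convolution_return_return[OF L] convolution_return_0[OF L])
  have sol: "solution \<mu> f l"
    unfolding solution_def
  proof (intro conjI allI l)
    fix k
    show "l k = (\<mu> k \<star> distr (l (k - 1)) borel f)"
      unfolding l_def \<mu>_eq[symmetric]
      by (rule shifted_recursion[where m = m and l = L and f = f and y = "\<lambda>k. - y k" and x = "\<lambda>k. - x k", OF m f L Lrec ny])
  qed
  have "fundamental_solution \<mu> f l"
    unfolding fundamental_solution_def
  proof (intro conjI allI impI sol)
    fix l' assume "solution \<mu> f l'"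
    then have sol': "(\<forall>k. l' k \<in> borel_probs) \<and> (\<forall>k. l' k = (\<mu> k \<star> distr (l' (k - 1)) borel f))"
      unfolding solution_def .
    note l' = sol'[THEN conjunct1, rule_format] and rec' = sol'[THEN conjunct2, rule_format]
    define L' where "L' k = (l' k \<star> return borel (y k))" for k
    have L': "L' k \<in> borel_probs" for k unfolding L'_def by (intro convolution_in_borel_probs return_in_borel_probs l')
    have L'rec: "L' k = (m k \<star> distr (L' (k - 1)) borel f)" for k
      unfolding L'_def m_def
      by (rule shifted_recursion[where m = \<mu> and l = l' and f = f and y = y and x = x, OF \<mu> f l' rec' y])
    show "\<exists>\<nu>\<in>borel_probs. \<forall>k. l' k = (l k \<star> distr \<nu> borel (int_iterate f k))"
    proof (rule solution_eq_orbit_limit_convolution[where m = m and l = L' and f = f and p = p, OF m f b p mC mt L' L'rec], goal_cases)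
      case (1 \<nu>)
      have it: "distr \<nu> borel (int_iterate f k) \<in> borel_probs" for k
        by (intro distr_linear_in_borel_probs 1(1) linear_int_iterate f b)
      have "l' k = (l k \<star> distr \<nu> borel (int_iterate f k))" for k
      proof -
        have "l' k = (L' k \<star> return borel (- y k))"
          unfolding L'_def by (simp add: convolution_return_return[OF l'] convolution_return_0[OF l'])
        also have "L' k = (L k \<star> distr \<nu> borel (int_iterate f k))"
          unfolding L_def by (rule 1(2))
        also have "((L k \<star> distr \<nu> borel (int_iterate f k)) \<star> return borel (- y k)) =
            (l k \<star> distr \<nu> borel (int_iterate f k))"
          using convolution_convolution_return[OF L it, of k "- y k" k 0]
          by (simp add: l_def convolution_return_0[OF it])
        finally show ?thesis .
      qed
      with 1(1) show ?case by blast
    qed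
  qed
  moreover have "lp_paths_after_shift p f x l"
    unfolding lp_paths_after_shift_def
  proof (intro exI[of _ y] conjI allI y)
    show "independent_lp_paths p (\<lambda>k. l k \<star> return borel (y k))"
      unfolding lL by (rule independent_lp_paths_if_trunc_cost_finite[OF L Lt])
  qed
  ultimately show ?thesis by blast
qed

text \<open>Translation by the given \<open>x\<close> and \<open>y\<close> need not bring noise and
  solution into the contraction subspace. The coset representatives \<open>c\<close> of the solution
  correct \<open>y\<close>, and the recursion then dictates the correction of \<open>x\<close>; both
  corrections are in l_p, so all costs stay finite and the estimate for the noise applies.\<close>

lemma log_moment_and_cosets_if_solution:
  fixes \<mu> :: "int \<Rightarrow> (real ^ 'd) measure" and f :: "real ^ 'd \<Rightarrow> real ^ 'd"
  assumes p: "1 \<le> p" and \<mu>: "\<And>k. \<mu> k \<in> borel_probs" and \<mu>t: "trunc_cost p \<mu> < \<infinity>"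
    and f: "linear f" and b: "bij f" and x: "x \<in> lp_seqs p"
    and sol: "solution \<mu> f l" and shift: "lp_paths_after_shift p f x l"
  shows "log_moment p \<mu> < \<infinity> \<and> (\<exists>x'\<in>lp_seqs p. supported_on_cosets \<mu> f x')"
proof -
  have p0: "0 \<le> p" "0 < p" using p by simp_all
  note l = sol[unfolded solution_def, THEN conjunct1, rule_format]
    and rec = sol[unfolded solution_def, THEN conjunct2, rule_format]
  from shift obtain y where shifted: "(\<forall>k. y k = x k + f (y (k - 1))) \<and> independent_lp_paths p (\<lambda>k. l k \<star> return borel (y k))"
    unfolding lp_paths_after_shift_def ..
  note y = shifted[THEN conjunct1, rule_format] and ind = shifted[THEN conjunct2]
  define m where "m k = (\<mu> k \<star> return borel (x k))" for k
  define L where "L k = (l k \<star> return borel (y k))" for k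
  have m: "m k \<in> borel_probs" for k unfolding m_def by (intro convolution_in_borel_probs return_in_borel_probs \<mu>)
  have L: "L k \<in> borel_probs" for k unfolding L_def by (intro convolution_in_borel_probs return_in_borel_probs l)
  have Lt: "trunc_cost p L < \<infinity>"
    unfolding L_def by (rule trunc_cost_finite_if_independent_lp_paths[OF ind])
  have Lrec: "L k = (m k \<star> distr (L (k - 1)) borel f)" for k
    unfolding L_def m_def
    by (rule shifted_recursion[where m = \<mu> and l = l and f = f and y = y and x = x, OF \<mu> f l rec y])
  obtain c where c: "c \<in> lp_seqs p" "\<And>k. AE v in L k. v - c k \<in> contraction_subspace f"
  proof (rule solution_supported_on_lp_cosets[where m = m and l = L and f = f and p = p, OF m f L Lrec Lt p0(2)], goal_cases)
    case (1 c)
    show ?case by (rule 1(1)[OF 1(2-)])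
  qed
  \<comment> \<open>Exactly the shift for which \<open>y - c\<close> solves the affine
    recursion.\<close>
  define x' where "x' k = x k + (- c k + f (c (k - 1)))" for k
  have x': "x' \<in> lp_seqs p"
    unfolding x'_def by (intro lp_seqs_add x lp_seqs_uminus c(1) lp_seqs_linear_shift f p0)
  define m' where "m' k = (\<mu> k \<star> return borel (x' k))" for k
  define y' where "y' k = y k - c k" for k
  have y': "y' k = x' k + f (y' (k - 1))" for k
    using y[of k] by (simp add: y'_def x'_def linear_diff[OF f])
  define L' where "L' k = (l k \<star> return borel (y' k))" for k
  have m': "m' k \<in> borel_probs" for k unfolding m'_def by (intro convolution_in_borel_probs return_in_borel_probs \<mu>)
  have L': "L' k \<in> borel_probs" for k unfolding L'_def by (intro convolution_in_borel_probs return_in_borel_probs l)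
  have L'rec: "L' k = (m' k \<star> distr (L' (k - 1)) borel f)" for k
    unfolding L'_def m'_def
    by (rule shifted_recursion[where m = \<mu> and l = l and f = f and y = y' and x = x', OF \<mu> f l rec y'])
  have L'_eq: "L' k = (L k \<star> return borel (- c k))" for k
    unfolding L'_def L_def by (simp add: convolution_return_return[OF l] y'_def)
  have m'_eq: "m' k = (m k \<star> return borel (- c k + f (c (k - 1))))" for k
    unfolding m'_def m_def by (simp add: convolution_return_return[OF \<mu>] x'_def)
  note Cs = sets_contraction_subspace[OF f]
  have L'C: "AE v in L' k. v \<in> contraction_subspace f" for k
    unfolding L'_eq convolution_return_eq_distr[OF L] using c(2)[of k] Cs
    by (subst AE_distr_iff) (auto simp: measurable_cong_sets[OF borel_probsD(3)[OF L] refl])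
  have m'C: "AE v in m' k. v \<in> contraction_subspace f" for k
  proof -
    have "AE v in m k. v - (c k - f (c (k - 1))) \<in> contraction_subspace f"
      by (rule AE_noise_in_coset[where m = m and l = L and f = f and k = k and c = c, OF m f L Lrec c(2)])
    then show ?thesis
      unfolding m'_eq convolution_return_eq_distr[OF m] using Cs
      by (subst AE_distr_iff) (auto simp: measurable_cong_sets[OF borel_probsD(3)[OF m] refl] algebra_simps)
  qed
  have m't: "trunc_cost p m' < \<infinity>"
    unfolding m'_def by (rule total_cost_shift_finite[where \<rho> = \<mu>, OF cost_function_min p0(1) \<mu> x' \<mu>t])
  have L't: "trunc_cost p L' < \<infinity>"
    unfolding L'_eq by (rule total_cost_shift_finite[where \<rho> = L, OF cost_function_min p0(1) L lp_seqs_uminus[OF c(1)] Lt])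
  have "log_cost p m' < \<infinity>"
    by (rule log_cost_finite_if_solution_trunc_cost_finite[where m = m' and l = L' and f = f,
          OF m' f bij_is_inj[OF b] L' L'rec m'C L'C m't L't p])
  then have "log_cost p (\<lambda>k. m' k \<star> return borel (- x' k)) < \<infinity>"
    by (rule total_cost_shift_finite[where \<rho> = m', OF cost_function_ln p0(1) m' lp_seqs_uminus[OF x']])
  also have "(\<lambda>k. m' k \<star> return borel (- x' k)) = \<mu>"
    unfolding m'_def by (simp add: convolution_return_return[OF \<mu>] convolution_return_0[OF \<mu>])
  finally have "log_moment p \<mu> < \<infinity>"
    by (rule log_moment_finite_if_log_cost_finite[where \<rho> = \<mu>, OF \<mu> p])
  moreover have "supported_on_cosets \<mu> f x'"
    unfolding supported_on_cosets_iff[where \<mu> = \<mu>, OF \<mu> f] using m'C unfolding m'_def by blast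
  ultimately show ?thesis using x' by blast
qed

text \<open>A solution yields cosets only for a corrected sequence, so the link between the two
  occurrences of \<open>x\<close> is expressed both by separate existential quantifiers and, for a
  fixed coset sequence, with the same \<open>x\<close> on both sides. Constructing a fundamental
  solution in one direction and starting from an arbitrary solution in the other settles both
  readings of (2).\<close>

theorem theorem5p1:
  fixes p :: real
    and \<mu> :: "int \<Rightarrow> (real ^ 'd) measure"
    and \<phi> :: "real ^ 'd \<Rightarrow> real ^ 'd"
  assumes "1 \<le> p"
    and "\<And>k. \<mu> k \<in> borel_probs"
    and "independent_lp_paths p \<mu>"
    and "linear \<phi>" and "bij \<phi>"
  shows "((\<exists>x\<in>lp_seqs p. supported_on_cosets \<mu> \<phi> x \<and> log_moment p \<mu> < \<infinity>) \<longleftrightarrow>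
            (\<exists>x\<in>lp_seqs p. \<exists>l. solution \<mu> \<phi> l \<and> lp_paths_after_shift p \<phi> x l))
    \<and> ((\<exists>x\<in>lp_seqs p. supported_on_cosets \<mu> \<phi> x \<and> log_moment p \<mu> < \<infinity>) \<longleftrightarrow>
            (\<exists>x\<in>lp_seqs p. \<exists>l. fundamental_solution \<mu> \<phi> l \<and> lp_paths_after_shift p \<phi> x l))
    \<and> (\<forall>x\<in>lp_seqs p. supported_on_cosets \<mu> \<phi> x \<longrightarrow>
            (log_moment p \<mu> < \<infinity> \<longleftrightarrow>
               (\<exists>l. solution \<mu> \<phi> l \<and> lp_paths_after_shift p \<phi> x l))
          \<and> (log_moment p \<mu> < \<infinity> \<longleftrightarrow>
               (\<exists>l. fundamental_solution \<mu> \<phi> l \<and> lp_paths_after_shift p \<phi> x l)))"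
proof -
  have \<mu>t: "trunc_cost p \<mu> < \<infinity>" by (rule trunc_cost_finite_if_independent_lp_paths[OF assms(3)])
  have 1: "\<exists>l. fundamental_solution \<mu> \<phi> l \<and> lp_paths_after_shift p \<phi> x l"
    if "x \<in> lp_seqs p" "supported_on_cosets \<mu> \<phi> x" "log_moment p \<mu> < \<infinity>" for x
    by (rule fundamental_solution_exists[where \<mu> = \<mu>, OF assms(1,2) \<mu>t assms(4,5) that])
  have 2: "log_moment p \<mu> < \<infinity> \<and> (\<exists>x'\<in>lp_seqs p. supported_on_cosets \<mu> \<phi> x')"
    if "x \<in> lp_seqs p" "solution \<mu> \<phi> l" "lp_paths_after_shift p \<phi> x l" for x l
    by (rule log_moment_and_cosets_if_solution[where \<mu> = \<mu>, OF assms(1,2) \<mu>t assms(4,5) that])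
  have 3: "fundamental_solution \<mu> \<phi> l \<Longrightarrow> solution \<mu> \<phi> l" for l
    unfolding fundamental_solution_def by simp
  show ?thesis using 1 2 3 by blast
qed

end
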